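(* The subgroup permutability degree of $\mathrm{Sz}(2^{2n+1})$ vanishes asymptotically, i.e. $$\lim_{n\to+\infty}\mathfrak{p}\left(\mathrm{Sz}(2^{2n+1})\right)=0.$$
   Context: For a finite group $G$, let $\mathfrak{s}(G)$ be the set of all subgroups of $G$. Subgroups $H,K$ of $G$ permute if $HK=KH$. The subgroup permutability degree of $G$ is $$\mathfrak{p}(G)=\frac{\left|\{(H,K)\in\mathfrak{s}(G)\times\mathfrak{s}(G):HK=KH\}\right|}{|\mathfrak{s}(G)|^2}.$$ Suzuki groups: let $n\ge 1$, $q=2^{2n+1}$, $\theta=2^{n+1}$, and let $\mathbb{F}_q$ be the field with $q$ elements. For $a,b\in\mathbb{F}_q$ and $\lambda\in\mathbb{F}_q^\times$ put $$S(a,b)=\begin{pmatrix} 1 & 0 & 0 & 0 \\ a & 1 & 0 & 0 \\ b & a^\theta & 1 & 0 \\ a^{2+\theta}+ab+b^\theta & a^{1+\theta}+b & a & 1 \end{pmatrix},\quad C(\lambda)=\mathrm{diag}\left(\lambda^{1+\frac{\theta}{2}},\lambda^{\frac{\theta}{2}},\lambda^{-\frac{\theta}{2}},\lambda^{-1-\frac{\theta}{2}}\right),\quad T=\begin{pmatrix} 0 & 0 & 0 & 1 \\ 0 & 0 & 1 & 0 \\ 0 & 1 & 0 & 0 \\ 1 & 0 & 0 & 0 \end{pmatrix}.$$ Then $\mathrm{Sz}(q)$ is the subgroup of $\mathrm{GL}_4(q)$ generated by all $S(a,b)$, all $C(\lambda)$ and $T$. *)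

theory Defs
  imports
    Complex_Main
    "HOL-Algebra.Algebra"
    "Jordan_Normal_Form.Matrix"
begin

text \<open>
  Matrix operations over a ring \<open>R\<close> in the sense of HOL-Algebra.  Only the type of
  matrices is taken from the matrix library: its arithmetic is tied to type classes, whereas here
  the coefficient field has to vary with a natural number.  As there, indices start at \<open>0\<close>.
\<close>

definition matrix_monoid :: "('a, 'm) ring_scheme \<Rightarrow> nat \<Rightarrow> 'a mat monoid" where
  "matrix_monoid R d =
    \<lparr>partial_object.carrier = {A \<in> carrier_mat d d. \<forall>i<d. \<forall>j<d. A $$ (i, j) \<in> carrier R},
     monoid.mult = (\<lambda>A B. mat d d (\<lambda>(i, j).
       finsum R (\<lambda>k. A $$ (i, k) \<otimes>\<^bsub>R\<^esub> B $$ (k, j)) {..<d})),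
     monoid.one = mat d d (\<lambda>(i, j). if i = j then \<one>\<^bsub>R\<^esub> else \<zero>\<^bsub>R\<^esub>)\<rparr>"

definition GL :: "nat \<Rightarrow> ('a, 'm) ring_scheme \<Rightarrow> 'a mat monoid" where
  "GL d R = units_of (matrix_monoid R d)"

definition suzuki_S :: "('a, 'm) ring_scheme \<Rightarrow> nat \<Rightarrow> 'a \<Rightarrow> 'a \<Rightarrow> 'a mat" where
  "suzuki_S R n a b = (let \<theta> = 2 ^ (n + 1) :: nat in
    mat_of_rows_list 4
     [[\<one>\<^bsub>R\<^esub>, \<zero>\<^bsub>R\<^esub>, \<zero>\<^bsub>R\<^esub>, \<zero>\<^bsub>R\<^esub>],
      [a, \<one>\<^bsub>R\<^esub>, \<zero>\<^bsub>R\<^esub>, \<zero>\<^bsub>R\<^esub>],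
      [b, a [^]\<^bsub>R\<^esub> \<theta>, \<one>\<^bsub>R\<^esub>, \<zero>\<^bsub>R\<^esub>],
      [a [^]\<^bsub>R\<^esub> (2 + \<theta>) \<oplus>\<^bsub>R\<^esub> a \<otimes>\<^bsub>R\<^esub> b \<oplus>\<^bsub>R\<^esub> b [^]\<^bsub>R\<^esub> \<theta>,
       a [^]\<^bsub>R\<^esub> (1 + \<theta>) \<oplus>\<^bsub>R\<^esub> b, a, \<one>\<^bsub>R\<^esub>]])"

text \<open>
  The exponents are integers, with \<open>h = \<theta> / 2 = 2 ^ n\<close>; negative powers use the
  multiplicative inverse in \<open>R\<close>.
\<close>

definition suzuki_C :: "('a, 'm) ring_scheme \<Rightarrow> nat \<Rightarrow> 'a \<Rightarrow> 'a mat" where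
  "suzuki_C R n l = (let h = 2 ^ n :: int in
    mat_of_rows_list 4
     [[l [^]\<^bsub>R\<^esub> (1 + h), \<zero>\<^bsub>R\<^esub>, \<zero>\<^bsub>R\<^esub>, \<zero>\<^bsub>R\<^esub>],
      [\<zero>\<^bsub>R\<^esub>, l [^]\<^bsub>R\<^esub> h, \<zero>\<^bsub>R\<^esub>, \<zero>\<^bsub>R\<^esub>],
      [\<zero>\<^bsub>R\<^esub>, \<zero>\<^bsub>R\<^esub>, l [^]\<^bsub>R\<^esub> (- h), \<zero>\<^bsub>R\<^esub>],
      [\<zero>\<^bsub>R\<^esub>, \<zero>\<^bsub>R\<^esub>, \<zero>\<^bsub>R\<^esub>, l [^]\<^bsub>R\<^esub> (- 1 - h)]])"

definition suzuki_T :: "('a, 'm) ring_scheme \<Rightarrow> 'a mat" where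
  "suzuki_T R =
    mat_of_rows_list 4
     [[\<zero>\<^bsub>R\<^esub>, \<zero>\<^bsub>R\<^esub>, \<zero>\<^bsub>R\<^esub>, \<one>\<^bsub>R\<^esub>],
      [\<zero>\<^bsub>R\<^esub>, \<zero>\<^bsub>R\<^esub>, \<one>\<^bsub>R\<^esub>, \<zero>\<^bsub>R\<^esub>],
      [\<zero>\<^bsub>R\<^esub>, \<one>\<^bsub>R\<^esub>, \<zero>\<^bsub>R\<^esub>, \<zero>\<^bsub>R\<^esub>],
      [\<one>\<^bsub>R\<^esub>, \<zero>\<^bsub>R\<^esub>, \<zero>\<^bsub>R\<^esub>, \<zero>\<^bsub>R\<^esub>]]"

text \<open>
  \<open>Sz R n\<close> is the Suzuki group over \<open>R\<close>, meant for a field \<open>R\<close> with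
  \<open>q = 2 ^ (2 * n + 1)\<close> elements.
\<close>

definition Sz :: "('a, 'm) ring_scheme \<Rightarrow> nat \<Rightarrow> 'a mat monoid" where
  "Sz R n = (GL 4 R)\<lparr>carrier := generate (GL 4 R)
     ({suzuki_S R n a b | a b. a \<in> carrier R \<and> b \<in> carrier R}
      \<union> {suzuki_C R n l | l. l \<in> carrier R - {\<zero>\<^bsub>R\<^esub>}}
      \<union> {suzuki_T R})\<rparr>"

definition subgroup_permutability_degree :: "('a, 'm) monoid_scheme \<Rightarrow> real" where
  "subgroup_permutability_degree G =
     real (card {(H, K). subgroup H G \<and> subgroup K G \<and> H <#>\<^bsub>G\<^esub> K = K <#>\<^bsub>G\<^esub> H})
     / (real (card {H. subgroup H G}))\<^sup>2"

end

theory Submission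
  imports
    Defs
    "HOL-Computational_Algebra.Primes"
    "HOL-Number_Theory.Residues"
    "HOL-Real_Asymp.Real_Asymp"
begin

text \<open>
  Write \<open>q = 2 ^ (2 * n + 1)\<close> and \<open>G = Sz(q)\<close>.  The group acts on the Tits ovoid, a set \<open>\<Omega>\<close> of
  \<open>q ^ 2 + 1\<close> lines of the natural module, and every involution fixes exactly one of these points.
  Two consequences of this decide the matter.

  First, suppose that \<open>H\<close> and \<open>K\<close> have even order, that \<open>H\<close> fixes the point \<open>\<alpha>\<close> and \<open>K\<close> fixes the point
  \<open>\<beta>\<close>.  If \<open>H\<close> and \<open>K\<close> permute, then the \<open>K\<close>-orbit of \<open>\<alpha>\<close> is invariant under \<open>H\<close>.  An involution of \<open>H\<close>
  has the single fixed point \<open>\<alpha>\<close> on this orbit, which is therefore of odd size; an involution of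
  \<open>K\<close> then also has a fixed point there, which can only be \<open>\<beta>\<close>, and \<open>\<beta>\<close> is fixed by \<open>K\<close>.  Hence
  \<open>\<alpha> = \<beta>\<close> (\<open>even_fixers_not_permutable\<close>).  Because \<open>G\<close> is transitive, equally many subgroups of this kind
  belong to each of the \<open>q ^ 2 + 1\<close> points, so that they contribute at most \<open>1 / (q ^ 2 + 1)\<close> to the
  permutability degree.

  Secondly, all other subgroups have few generators (\<open>generated_by_if_not_even_fixer\<close>).  If \<open>H\<close> has odd order,
  then the order divides \<open>D = (q - 1) * (q ^ 2 + 1)\<close>, and each generator that is added without
  redundancy uses up a prime factor of \<open>D\<close>.  If \<open>H\<close> has even order but fixes no point, then two
  involutions of \<open>H\<close> with different fixed points generate a dihedral group of twice odd order, so
  that all involutions of \<open>H\<close> are conjugate; this determines the stabilizer in \<open>H\<close> of the fixed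
  point of an involution so tightly that three elements generate it, and its index in \<open>H\<close> is odd
  (\<open>stab_generated_by_three\<close>).  Either way \<open>\<Omega>(D) + 3\<close> generators are enough, where \<open>\<Omega>(D)\<close> is the number
  of prime factors of \<open>D\<close> counted with multiplicity, and so there are at most
  \<open>|G| ^ (\<Omega>(D) + 3)\<close> such subgroups.

  Now \<open>D\<close> divides \<open>2 ^ (4 * (2 * n + 1)) - 1\<close>, and the number of prime factors of \<open>2 ^ k - 1\<close> is \<open>o(k)\<close>:
  large primes are few because their product is bounded, and small primes enter with
  multiplicity \<open>O(log k)\<close> by lifting the exponent (\<open>eventually_few_prime_factors\<close>).  Since
  \<open>|G| < 2 ^ (6 * (2 * n + 1))\<close>, the exceptional subgroups number \<open>2 ^ o(n ^ 2)\<close>, whereas the matrices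
  \<open>S(0, b)\<close> form an elementary abelian group of order \<open>q\<close>, which already has at least
  \<open>2 ^ (n * (n + 1))\<close> subgroups (\<open>card_subgroups_elementary_abelian\<close>).  So the exceptional subgroups are
  negligible, and the degree tends to \<open>0\<close>.
\<close>

hide_const (open) Divisibility.prime

section \<open>Prime factors of numbers of the form \<open>2 ^ k - 1\<close>\<close>

text \<open>
  Write \<open>y = 1 + p * z\<close>.  Modulo \<open>p ^ 2\<close> the powers of \<open>y\<close> are linear in the exponent, and the linear
  terms add up to a multiple of \<open>p ^ 2\<close> because the odd prime \<open>p\<close> divides \<open>p * (p - 1) / 2\<close>.  What
  remains of the sum is \<open>p\<close>.
\<close>

lemma not_square_dvd_power_sum:
  fixes p y :: nat
  assumes p: "prime p" "odd p" and y: "[y = 1] (mod p)"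
  shows "\<not> p ^ 2 dvd (\<Sum>i<p. y ^ i)"
proof
  assume dvd: "p ^ 2 dvd (\<Sum>i<p. y ^ i)"
  obtain z where z: "int y = 1 + int p * z"
    using y by (metis cong_iff_lin cong_int_iff cong_sym of_nat_1)
  have pow: "[int y ^ i = 1 + int i * (int p * z)] (mod (int p)^2)" for i
  proof (induction i)
    case (Suc i)
    have "[int y ^ i * int y = (1 + int i * (int p * z)) * (1 + int p * z)] (mod (int p)^2)"
      using Suc z by (metis cong_scalar_right)
    also have "(1 + int i * (int p * z)) * (1 + int p * z)
        = 1 + int (Suc i) * (int p * z) + (int p)^2 * (int i * z^2)"
      by (simp add: algebra_simps power2_eq_square)
    also have "[\<dots> = 1 + int (Suc i) * (int p * z)] (mod (int p)^2)"
      by (simp add: cong_iff_dvd_diff)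
    finally show ?case by (simp add: mult.commute)
  qed simp
  have "[int (\<Sum>i<p. y ^ i) = (\<Sum>i<p. 1 + int i * (int p * z))] (mod (int p)^2)"
    unfolding of_nat_sum of_nat_power by (rule cong_sum) (rule pow)
  also have "(\<Sum>i<p. 1 + int i * (int p * z)) = int p + (\<Sum>i<p. int i) * (int p * z)"
    by (simp add: sum.distrib sum_distrib_right)
  also have "(\<Sum>i<p. int i) = int p * int ((p - 1) div 2)"
  proof -
    obtain r where r: "p = 2 * r + 1" using p(2) by (auto elim: oddE)
    have "2 * (\<Sum>i<Suc k. int i) = int k * (int k + 1)" for k
      by (induction k) (auto simp: algebra_simps)
    from this[of "2 * r"] have "2 * (\<Sum>i<p. int i) = 2 * (int p * int ((p - 1) div 2))"
      using r by (simp add: algebra_simps)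
    then show ?thesis by simp
  qed
  also have "[int p + int p * int ((p - 1) div 2) * (int p * z) = int p] (mod (int p)^2)"
    by (simp add: cong_iff_dvd_diff power2_eq_square)
  finally have "[int (\<Sum>i<p. y ^ i) = int p] (mod (int p)^2)" .
  moreover have "(int p)^2 dvd int (\<Sum>i<p. y ^ i)"
    using dvd by (metis of_nat_dvd_iff of_nat_power)
  ultimately have "(int p)^2 dvd int p" by (simp add: cong_dvd_iff)
  then have "p ^ 2 dvd p" by (metis of_nat_dvd_iff of_nat_power)
  then have "p * p \<le> p"
    using p(1) by (metis dvd_imp_le power2_eq_square prime_gt_0_nat)
  moreover have "p > 1" using p(1) by (rule prime_gt_1_nat)
  ultimately show False by simp
qed

lemma power_diff_1_nat: "(x::nat) ^ k - 1 = (x - 1) * (\<Sum>i<k. x ^ i)"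
proof (cases "x = 0")
  case True then show ?thesis by (cases k) auto
next
  case False
  have "int (x ^ k - 1) = int x ^ k - 1" using False by (simp add: of_nat_diff)
  also have "\<dots> = (int x - 1) * (\<Sum>i<k. int x ^ i)"
    by (rule power_diff_1_eq)
  also have "\<dots> = int ((x - 1) * (\<Sum>i<k. x ^ i))" using False by (simp add: of_nat_diff)
  finally show ?thesis by (simp only: of_nat_eq_iff)
qed

text \<open>
  Lifting the exponent.  Passing from \<open>x ^ j\<close> to \<open>x ^ (j * p)\<close> gains exactly one factor \<open>p\<close> by the lemma
  above, and an exponent prime to \<open>p\<close> gains none, since then the cofactor
  \<open>1 + x + \<dots> + x ^ (k - 1)\<close> is congruent to \<open>k\<close>.
\<close>

lemma multiplicity_power_minus_1_le:
  fixes p x k :: nat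
  assumes p: "prime p" "odd p" and x: "x > 1" "[x = 1] (mod p)" and k: "k > 0"
  shows "multiplicity p (x ^ k - 1) \<le> multiplicity p (x - 1) + multiplicity p k"
  using k
proof (induction k rule: less_induct)
  case (less k)
  show ?case
  proof (cases "p dvd k")
    case False
    have "[(\<Sum>i<k. x ^ i) = (\<Sum>i<k. 1 ^ i)] (mod p)"
      by (intro cong_sum cong_pow x)
    then have "\<not> p dvd (\<Sum>i<k. x ^ i)" using False by (simp add: cong_dvd_iff)
    then have "multiplicity p (\<Sum>i<k. x ^ i) = 0" by (rule not_dvd_imp_multiplicity_0)
    moreover have "(\<Sum>i<k. x ^ i) \<noteq> 0" using \<open>\<not> p dvd (\<Sum>i<k. x ^ i)\<close> by (metis dvd_0_right)
    ultimately show ?thesis using x p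
      unfolding power_diff_1_nat[of x k]
      by (subst prime_elem_multiplicity_mult_distrib) auto
  next
    case True
    then obtain j where j: "k = j * p" by (metis dvdE mult.commute)
    have j0: "j > 0" "j < k" using less.prems j prime_gt_1_nat[OF p(1)] by auto
    define s where "s = (\<Sum>i<p. (x ^ j) ^ i)"
    have "[x ^ j = 1] (mod p)" using cong_pow[OF x(2), of j] by simp
    then have ns: "\<not> p ^ 2 dvd s" unfolding s_def by (rule not_square_dvd_power_sum[OF p])
    have s0: "s \<noteq> 0" using ns by (metis dvd_0_right)
    have "multiplicity p s < 2"
      using multiplicity_lessI[of s p 2] s0 prime_gt_1_nat[OF p(1)] ns by auto
    moreover have "x ^ k - 1 = (x ^ j - 1) * s"
      unfolding s_def j power_mult by (rule power_diff_1_nat)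
    moreover have "x ^ j - 1 \<noteq> 0"
      using one_less_power[OF x(1) j0(1)] by linarith
    ultimately have "multiplicity p (x ^ k - 1) \<le> multiplicity p (x ^ j - 1) + 1"
      using s0 p by (simp add: prime_elem_multiplicity_mult_distrib)
    also have "\<dots> \<le> multiplicity p (x - 1) + (multiplicity p j + 1)"
      using less.IH[OF j0(2) j0(1)] by simp
    also have "multiplicity p j + 1 = multiplicity p k"
      using j j0 p prime_gt_1_nat[OF p(1)] by (simp add: prime_elem_multiplicity_mult_distrib)
    finally show ?thesis .
  qed
qed

lemma power_multiplicity_le:
  fixes p x :: nat assumes "x > 0" shows "p ^ multiplicity p x \<le> x"
  using assms by (simp add: dvd_imp_le multiplicity_dvd)

text \<open>
  A power of \<open>2\<close> need not be congruent to \<open>1\<close> modulo \<open>p\<close>, but \<open>2 ^ (p - 1)\<close> is; so the exponent is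
  lifted from this base, at the expense of a multiplicity below \<open>p\<close>.
\<close>

lemma multiplicity_two_power_minus_1_le:
  fixes p k :: nat
  assumes p: "prime p" "odd p" and k: "k > 0"
  shows "real (multiplicity p (2 ^ k - 1)) \<le> p + log 2 k"
proof -
  define x :: nat where "x = 2 ^ (p - 1)"
  have p3: "p \<ge> 3" using p by (metis One_nat_def Suc_leI le_neq_implies_less numeral_3_eq_3 prime_ge_2_nat even_numeral numeral_2_eq_2)
  have x1: "x > 1" unfolding x_def using p3 by (intro one_less_power) auto
  have "\<not> p dvd 2" using p3 by (auto dest: dvd_imp_le)
  then have x2: "[x = 1] (mod p)" unfolding x_def using fermat_theorem[OF p(1)] by blast
  have two: "2 ^ multiplicity p y \<le> y" if "y > 0" for y :: nat
    using power_multiplicity_le[OF that, of p] power_mono[of 2 p "multiplicity p y"] p3 by linarith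
  have "x ^ k - 1 = (2 ^ k - 1) * (\<Sum>i<p-1. (2 ^ k) ^ i)"
    unfolding x_def by (metis power_diff_1_nat power_mult mult.commute)
  then have "(2 ^ k - 1) dvd x ^ k - 1" by simp
  moreover have "x ^ k - 1 \<noteq> 0" using one_less_power[OF x1 k] by linarith
  ultimately have "multiplicity p (2 ^ k - 1) \<le> multiplicity p (x ^ k - 1)"
    by (intro dvd_imp_multiplicity_le) auto
  also have "\<dots> \<le> multiplicity p (x - 1) + multiplicity p k"
    by (rule multiplicity_power_minus_1_le[OF p x1 x2 k])
  finally have *: "multiplicity p (2 ^ k - 1) \<le> multiplicity p (x - 1) + multiplicity p k" .
  have "(2::nat) ^ multiplicity p (x - 1) < 2 ^ p"
  proof -
    have "(2::nat) ^ multiplicity p (x - 1) \<le> x - 1" using two x1 by simp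
    also have "\<dots> < x" using x1 by simp
    also have "x \<le> 2 ^ p" unfolding x_def by (rule power_increasing) auto
    finally show ?thesis .
  qed
  then have "multiplicity p (x - 1) < p" by (simp add: power_less_imp_less_exp)
  moreover have "real (multiplicity p k) \<le> log 2 k"
  proof -
    have "2 powr real (multiplicity p k) \<le> real k"
      using two[OF k] by (simp add: powr_realpow flip: of_nat_le_iff)
    then show ?thesis using k by (simp add: le_log_iff)
  qed
  ultimately show ?thesis using * by linarith
qed

lemma size_prime_factorization_eq_sum:
  "size (prime_factorization (n::nat)) = (\<Sum>p\<in>prime_factors n. multiplicity p n)"
  by (auto simp: size_multiset_overloaded_eq count_prime_factorization intro!: sum.cong)

text \<open>
  Prime factors of size at least \<open>2 ^ c\<close> contribute at most \<open>k / c\<close>, because their product is below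
  \<open>2 ^ k\<close>.  There are at most \<open>2 ^ c\<close> smaller ones, and the preceding lemma bounds the multiplicity
  of each.
\<close>

lemma size_prime_factorization_two_power_minus_1:
  fixes c k :: nat
  assumes c: "c > 0" and k: "k > 0"
  shows "real (size (prime_factorization (2 ^ k - 1 :: nat))) \<le> k / c + 2 ^ c * (2 ^ c + log 2 k)"
proof -
  define E :: nat where "E = 2 ^ k - 1"
  define A where "A = {p \<in> prime_factors E. p < 2 ^ c}"
  define B where "B = {p \<in> prime_factors E. \<not> p < 2 ^ c}"
  have E0: "E > 0" unfolding E_def using one_less_power[of "2::nat" k] k by simp
  have oddE: "odd E" unfolding E_def using k by simp
  have fin: "finite A" "finite B" unfolding A_def B_def by auto
  have "size (prime_factorization E) = (\<Sum>p\<in>A. multiplicity p E) + (\<Sum>p\<in>B. multiplicity p E)"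
    unfolding size_prime_factorization_eq_sum A_def B_def
    by (subst sum.union_disjoint[symmetric]) (auto intro!: sum.cong)
  moreover have "real (\<Sum>p\<in>B. multiplicity p E) \<le> k / c"
  proof -
    have "(2 ^ c) ^ (\<Sum>p\<in>B. multiplicity p E) = (\<Prod>p\<in>B. (2 ^ c) ^ multiplicity p E)"
      by (rule power_sum)
    also have "\<dots> \<le> (\<Prod>p\<in>B. p ^ multiplicity p E)"
      by (intro prod_mono conjI power_mono) (auto simp: B_def)
    also have "\<dots> \<le> E"
    proof (rule dvd_imp_le[OF _ E0])
      have "(\<Prod>p\<in>B. p ^ multiplicity p E) dvd (\<Prod>p\<in>prime_factors E. p ^ multiplicity p E)"
        by (intro prod_dvd_prod_subset) (auto simp: B_def)
      also have "\<dots> = E" using E0 by (simp add: prime_factorization_nat[symmetric])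
      finally show "(\<Prod>p\<in>B. p ^ multiplicity p E) dvd E" .
    qed
    also have "E < 2 ^ k" unfolding E_def by simp
    finally have "(2::nat) ^ (c * (\<Sum>p\<in>B. multiplicity p E)) < 2 ^ k" by (simp add: power_mult)
    then have "c * (\<Sum>p\<in>B. multiplicity p E) < k" by (simp add: power_less_imp_less_exp)
    then have "real c * real (\<Sum>p\<in>B. multiplicity p E) < k" by (metis of_nat_less_iff of_nat_mult)
    then show ?thesis using c by (simp add: field_simps)
  qed
  moreover have "real (\<Sum>p\<in>A. multiplicity p E) \<le> 2 ^ c * (2 ^ c + log 2 k)"
  proof -
    have "real (\<Sum>p\<in>A. multiplicity p E) \<le> (\<Sum>p\<in>A. 2 ^ c + log 2 k)"
      unfolding of_nat_sum
    proof (rule sum_mono)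
      fix p assume p: "p \<in> A"
      then have "prime p" "p dvd E" "p < 2 ^ c" by (auto simp: A_def)
      then have "odd p" using oddE by (metis dvd_trans)
      then have "real (multiplicity p E) \<le> p + log 2 k"
        unfolding E_def using multiplicity_two_power_minus_1_le \<open>prime p\<close> k by blast
      moreover have "real p \<le> 2 ^ c" using \<open>p < 2 ^ c\<close>
        by (metis less_imp_le of_nat_le_iff of_nat_numeral of_nat_power)
      ultimately show "real (multiplicity p E) \<le> 2 ^ c + log 2 k" by linarith
    qed
    also have "\<dots> = card A * (2 ^ c + log 2 k)" by simp
    also have "\<dots> \<le> 2 ^ c * (2 ^ c + log 2 k)"
    proof (rule mult_right_mono)
      have "card A \<le> card {..<2 ^ c :: nat}" by (rule card_mono) (auto simp: A_def)
      then have "card A \<le> 2 ^ c" by simp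
      then show "real (card A) \<le> 2 ^ c" by (metis of_nat_le_iff of_nat_numeral of_nat_power)
      show "0 \<le> 2 ^ c + log 2 (real k)" using k by (simp add: zero_le_log_cancel_iff)
    qed
    finally show ?thesis .
  qed
  ultimately show ?thesis unfolding E_def by simp
qed

lemma size_prime_factorization_dvd_mono:
  fixes a b :: nat
  assumes "a dvd b" "b > 0"
  shows "size (prime_factorization a) \<le> size (prime_factorization b)"
proof -
  have "a \<noteq> 0" using assms by auto
  then have "prime_factorization a \<subseteq># prime_factorization b"
    using assms by (subst prime_factorization_subset_iff_dvd) auto
  then show ?thesis by (rule size_mset_mono)
qed

text \<open>
  The factor \<open>50\<close> is a convenient one: it makes the number of the exceptional subgroups smaller than
  the number of all subgroups.  The threshold \<open>2 ^ 400\<close> between small and large primes leaves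
  \<open>4 * m / 400\<close> large prime factors, half of what is allowed, and the other half absorbs the
  logarithmic contribution of the small ones.
\<close>

lemma eventually_few_prime_factors:
  "\<forall>\<^sub>F m in sequentially.
     50 * size (prime_factorization ((2 ^ m - 1) * (2 ^ (2 * m) + 1) :: nat)) \<le> m"
proof -
  have "\<forall>\<^sub>F m in sequentially.
      50 * (real (4 * m) / 400 + (2 ^ 400) * (2 ^ 400 + log 2 (real (4 * m)))) \<le> real m"
  proof -
    define L :: real where "L = 2 ^ 400"
    have "L > 0" unfolding L_def by simp
    then have "\<forall>\<^sub>F m in sequentially.
      50 * (real (4 * m) / 400 + L * (L + log 2 (real (4 * m)))) \<le> real m"
      by real_asymp
    then show ?thesis unfolding L_def .
  qed
  then show ?thesis
    using eventually_gt_at_top[of 0]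
  proof eventually_elim
    case (elim m)
    let ?D = "(2 ^ m - 1) * (2 ^ (2 * m) + 1) :: nat"
    have "(2::nat) ^ (4 * m) = 2 ^ m * 2 ^ m * (2 ^ m * 2 ^ m)"
      by (simp add: power_add[symmetric] del: power_add)
    moreover have "(a - 1) * (a * a + 1) * (a + 1) = a * a * (a * a) - 1" if "a > 0" for a :: nat
      using that by (cases a) (simp_all add: algebra_simps)
    ultimately have "2 ^ (4 * m) - 1 = ?D * (2 ^ m + 1)"
      unfolding mult_2 power_add by (metis zero_less_numeral zero_less_power)
    then have "?D dvd 2 ^ (4 * m) - 1" by simp
    moreover have "(0::nat) < 2 ^ (4 * m) - 1" using elim(2) one_less_power[of "2::nat" "4*m"] by simp
    ultimately have "size (prime_factorization ?D) \<le> size (prime_factorization (2 ^ (4 * m) - 1 :: nat))"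
      by (intro size_prime_factorization_dvd_mono)
    then have "real (size (prime_factorization ?D))
        \<le> real (4 * m) / real 400 + 2 ^ 400 * (2 ^ 400 + log 2 (real (4 * m)))"
      using size_prime_factorization_two_power_minus_1[of 400 "4 * m"] elim(2) by linarith
    then have "50 * real (size (prime_factorization ?D)) \<le> real m" using elim(1) by simp
    then show ?case by linarith
  qed
qed

section \<open>Fixed points of involutions on finite sets\<close>

lemma even_card_iff_even_fixed_points:
  assumes "finite A" and "\<And>x. x \<in> A \<Longrightarrow> f x \<in> A" and "\<And>x. x \<in> A \<Longrightarrow> f (f x) = x"
  shows "even (card A) \<longleftrightarrow> even (card {x \<in> A. f x = x})"
  using assms
proof (induction A rule: finite_psubset_induct)
  case (psubset A)
  show ?case
  proof (cases "\<exists>x\<in>A. f x \<noteq> x")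
    case False
    then have "{x \<in> A. f x = x} = A" by auto
    then show ?thesis by simp
  next
    case True
    then obtain x where x: "x \<in> A" "f x \<noteq> x" by blast
    define B where "B = A - {x, f x}"
    have ffx: "f (f x) = x" and fx: "f x \<in> A" using psubset.prems x by auto
    have inj: "f y = f z \<longleftrightarrow> y = z" if "y \<in> A" "z \<in> A" for y z
      using that psubset.prems(2) by metis
    have B: "B \<subset> A" using x unfolding B_def by auto
    have "even (card B) \<longleftrightarrow> even (card {y \<in> B. f y = y})"
    proof (rule psubset.IH[OF B])
      fix y assume "y \<in> B"
      then show "f (f y) = y" using B psubset.prems(2) by blast
      have "y \<in> A" "y \<noteq> x" "y \<noteq> f x" using \<open>y \<in> B\<close> by (auto simp: B_def)
      then have "f y \<noteq> f x" "f y \<noteq> f (f x)" using inj x fx by auto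
      then show "f y \<in> B" using \<open>y \<in> A\<close> psubset.prems(1) ffx by (auto simp: B_def)
    qed
    moreover have "{y \<in> B. f y = y} = {y \<in> A. f y = y}"
      using x ffx by (auto simp: B_def)
    moreover have "card A = card B + 2"
    proof -
      have "card {x, f x} = 2" using x by auto
      moreover have "{x, f x} \<subseteq> A" using x fx by auto
      ultimately show ?thesis unfolding B_def
        using psubset.hyps by (metis card_Diff_subset card_mono finite_subset le_add_diff_inverse2)
    qed
    ultimately show ?thesis by simp
  qed
qed

section \<open>Counting subgroups by their generators\<close>

context group
begin

lemma finite_subgroup: "finite (carrier G) \<Longrightarrow> subgroup H G \<Longrightarrow> finite H"
  by (rule finite_subset[OF subgroup.subset])

lemma subgroup_pow_closed: "subgroup H G \<Longrightarrow> x \<in> H \<Longrightarrow> x [^] (j::nat) \<in> H"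
  by (induction j) (auto intro: subgroup.one_closed subgroup.m_closed)

text \<open>
  The common counting step behind the orbit-stabilizer theorem and the isomorphism theorem: a
  function on \<open>H\<close> whose nonempty fibres are the left cosets of \<open>K\<close>.
\<close>

lemma card_eq_card_image_times_card_fibre:
  assumes fin: "finite (carrier G)" and H: "subgroup H G" and K: "subgroup K G" "K \<subseteq> H"
    and f: "\<And>x y. x \<in> H \<Longrightarrow> y \<in> H \<Longrightarrow> f x = f y \<longleftrightarrow> inv x \<otimes> y \<in> K"
  shows "card H = card (f ` H) * card K"
proof -
  have finH: "finite H" by (rule finite_subgroup[OF fin H])
  have fibre: "card {y \<in> H. f y = f x} = card K" if x: "x \<in> H" for x
  proof -
    have xG: "x \<in> carrier G" by (rule subgroup.mem_carrier[OF H x])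
    have KG: "K \<subseteq> carrier G" by (rule subgroup.subset[OF K(1)])
    have HG: "H \<subseteq> carrier G" by (rule subgroup.subset[OF H])
    have "{y \<in> H. f y = f x} = (\<lambda>k. x \<otimes> k) ` K"
    proof (intro equalityI subsetI)
      fix y assume "y \<in> {y \<in> H. f y = f x}"
      then have y: "y \<in> H" "inv x \<otimes> y \<in> K" using f[OF x, of y] by auto
      have yG: "y \<in> carrier G" using y HG by blast
      have "y = x \<otimes> (inv x \<otimes> y)" using xG yG by (simp flip: m_assoc)
      then show "y \<in> (\<lambda>k. x \<otimes> k) ` K" using y by blast
    next
      fix y assume "y \<in> (\<lambda>k. x \<otimes> k) ` K"
      then obtain k where k: "k \<in> K" "y = x \<otimes> k" by blast
      have kG: "k \<in> carrier G" using k KG by blast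
      have "y \<in> H" unfolding k(2) using k x K by (intro subgroup.m_closed[OF H]) auto
      moreover have "inv x \<otimes> y = k" using k kG xG by (simp flip: m_assoc)
      ultimately show "y \<in> {y \<in> H. f y = f x}" using f[OF x, of y] k by auto
    qed
    moreover have "inj_on (\<lambda>k. x \<otimes> k) K"
      using xG KG by (intro inj_onI) (metis l_cancel subsetD)
    ultimately show ?thesis by (simp add: card_image)
  qed
  have "card H = (\<Sum>z\<in>f ` H. card {y \<in> H. f y = z})"
    using sum.image_gen[OF finH, of "\<lambda>_. 1::nat" f] by simp
  also have "\<dots> = (\<Sum>z\<in>f ` H. card K)" using fibre by (intro sum.cong) auto
  finally show ?thesis by simp
qed

lemma card_subgroup_dvd:
  assumes "subgroup H G" "subgroup K G" "K \<subseteq> H"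
  shows "card K dvd card H"
proof -
  interpret H: group "G\<lparr>carrier := H\<rparr>" by (rule subgroup_imp_group[OF assms(1)])
  have "subgroup K (G\<lparr>carrier := H\<rparr>)" by (rule subgroup_incl[OF assms(2,1,3)])
  from H.lagrange[OF this] have "card (rcosets\<^bsub>G\<lparr>carrier := H\<rparr>\<^esub> K) * card K = card H"
    by (simp add: order_def)
  then show ?thesis by (metis dvd_triv_right)
qed

lemma finite_subgroups: "finite (carrier G) \<Longrightarrow> finite {H. subgroup H G}"
  by (rule finite_subset[of _ "Pow (carrier G)"]) (auto dest: subgroup.subset)

lemma generate_subgroup_idem:
  assumes "subgroup K G" shows "generate G K = K"
  by (intro equalityI generate_subgroup_incl[OF subset_refl assms] subsetI generate.incl)

lemma card_subgroup_pos:
  assumes "finite (carrier G)" "subgroup H G" shows "card H > 0"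
  using finite_subgroup[OF assms] subgroup.one_closed[OF assms(2)] by (auto simp: card_gt_0_iff)

text \<open>
  Each new generator enlarges the subgroup generated so far, hence removes at least one prime
  factor from the index that remains.
\<close>

lemma generate_by_index_prime_factors:
  assumes fin: "finite (carrier G)" and H: "subgroup H G"
    and K: "subgroup K G" "K \<subseteq> H" "card H = card K * d"
  shows "\<exists>xs. set xs \<subseteq> H \<and> length xs \<le> size (prime_factorization d) \<and> H = generate G (K \<union> set xs)"
  using K
proof (induction d arbitrary: K rule: less_induct)
  case (less d)
  have HG: "H \<subseteq> carrier G" by (rule subgroup.subset[OF H])
  show ?case
  proof (cases "K = H")
    case True
    then have "H = generate G (K \<union> set [])" using generate_subgroup_idem[OF H] by simp
    then show ?thesis by (intro exI[of _ "[]"]) simp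
  next
    case False
    then obtain h where h: "h \<in> H" "h \<notin> K" using less.prems by blast
    define K' where "K' = generate G (K \<union> {h})"
    have inc: "K \<union> {h} \<subseteq> H" using h less.prems by blast
    have K': "subgroup K' G" unfolding K'_def using inc HG by (intro generate_is_subgroup) blast
    have K'H: "K' \<subseteq> H" unfolding K'_def by (rule generate_subgroup_incl[OF inc H])
    have KK': "K \<subseteq> K'" "h \<in> K'" unfolding K'_def by (auto intro: generate.incl)
    obtain e where e: "card K' = card K * e"
      using card_subgroup_dvd[OF K' less.prems(1) KK'(1)] by (auto elim: dvdE)
    obtain d' where d': "card H = card K' * d'"
      using card_subgroup_dvd[OF H K' K'H] by (auto elim: dvdE)
    have pos: "card K > 0" "card K' > 0" "card H > 0"
      by (rule card_subgroup_pos[OF fin less.prems(1)] card_subgroup_pos[OF fin K']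
          card_subgroup_pos[OF fin H])+
    have finK': "finite K'" by (rule finite_subgroup[OF fin K'])
    have "K \<subset> K'" using KK' h by blast
    then have "card K < card K'" using finK' psubset_card_mono by blast
    then have "card K * 1 < card K * e" using e by simp
    then have e1: "e > 1" using pos(1) by (metis mult_less_cancel1)
    have "card K * d = card K * (e * d')" using e d' less.prems(3) by (metis mult.assoc)
    then have d: "d = e * d'" using pos(1) by (metis mult_cancel1 less_irrefl)
    have d'0: "d' > 0" using pos(3) d' by (metis gr0I mult_0_right less_irrefl)
    have "d' < d" using d e1 d'0 by simp
    from less.IH[OF this K' K'H d'] obtain xs where xs: "set xs \<subseteq> H"
      "length xs \<le> size (prime_factorization d')" "H = generate G (K' \<union> set xs)" by blast
    have "prime_factorization e \<noteq> {#}" using e1 by (auto simp: prime_factorization_empty_iff)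
    then have "size (prime_factorization e) \<ge> 1" by (metis One_nat_def Suc_leI nonempty_has_size)
    moreover have "size (prime_factorization d) = size (prime_factorization e) + size (prime_factorization d')"
      using d e1 d'0 by (simp add: prime_factorization_mult)
    ultimately have len: "length (h # xs) \<le> size (prime_factorization d)" using xs(2) by simp
    have sub: "K \<union> set (h # xs) \<subseteq> H" using inc xs by auto
    have gen: "subgroup (generate G (K \<union> set (h # xs))) G"
      using sub HG by (intro generate_is_subgroup) blast
    have "K' \<subseteq> generate G (K \<union> set (h # xs))"
      unfolding K'_def by (rule mono_generate) auto
    moreover have "set xs \<subseteq> generate G (K \<union> set (h # xs))" by (auto intro: generate.incl)
    ultimately have "generate G (K' \<union> set xs) \<subseteq> generate G (K \<union> set (h # xs))"
      by (intro generate_subgroup_incl[OF _ gen]) blast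
    then have "H \<subseteq> generate G (K \<union> set (h # xs))" by (simp flip: xs(3))
    moreover have "generate G (K \<union> set (h # xs)) \<subseteq> H" by (rule generate_subgroup_incl[OF sub H])
    ultimately have "H = generate G (K \<union> set (h # xs))" by blast
    then show ?thesis using len sub by blast
  qed
qed

text \<open>
  Repetitions in the list are harmless, so these are the subgroups with at most \<open>k\<close> generators (if
  \<open>k > 0\<close>); a fixed length makes them easy to count.
\<close>

definition generated_by :: "nat \<Rightarrow> 'a set set" where
  "generated_by k = {generate G (set xs) | xs. set xs \<subseteq> carrier G \<and> length xs = k}"

lemma card_generated_by:
  assumes "finite (carrier G)"
  shows "finite (generated_by k)" "card (generated_by k) \<le> order G ^ k"
proof -
  have eq: "generated_by k = (\<lambda>xs. generate G (set xs)) ` {xs. set xs \<subseteq> carrier G \<and> length xs = k}"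
    unfolding generated_by_def by auto
  show "finite (generated_by k)" unfolding eq using finite_lists_length_eq[OF assms] by blast
  show "card (generated_by k) \<le> order G ^ k"
    unfolding eq order_def card_lists_length_eq[OF assms, symmetric]
    by (rule card_image_le[OF finite_lists_length_eq[OF assms]])
qed

lemma generated_by_of_index:
  assumes fin: "finite (carrier G)" and H: "subgroup H G" and abc: "a \<in> H" "b \<in> H" "c \<in> H"
    and d: "card H = card (generate G {a, b, c}) * d"
    and k: "size (prime_factorization d) + 3 \<le> k"
  shows "H \<in> generated_by k"
proof -
  let ?K = "generate G {a, b, c}"
  have HG: "H \<subseteq> carrier G" by (rule subgroup.subset[OF H])
  have abcH: "{a, b, c} \<subseteq> H" using abc by blast
  then have K: "subgroup ?K G" using HG by (intro generate_is_subgroup) blast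
  have KH: "?K \<subseteq> H" by (rule generate_subgroup_incl[OF abcH H])
  obtain xs where xs: "set xs \<subseteq> H" "length xs \<le> size (prime_factorization d)"
    "H = generate G (?K \<union> set xs)"
    using generate_by_index_prime_factors[OF fin H K KH d] by (elim exE conjE) rule
  define ys where "ys = [a, b, c] @ xs @ replicate (k - 3 - length xs) a"
  have ys: "set ys = {a, b, c} \<union> set xs" unfolding ys_def by (auto simp: set_replicate_conv_if)
  have ysH: "set ys \<subseteq> H" unfolding ys using abcH xs(1) by blast
  have gen: "subgroup (generate G (set ys)) G" using ysH HG by (intro generate_is_subgroup) blast
  have "?K \<subseteq> generate G (set ys)" by (rule mono_generate) (use ys in blast)
  moreover have "set xs \<subseteq> generate G (set ys)" using ys by (auto intro: generate.incl)
  ultimately have "?K \<union> set xs \<subseteq> generate G (set ys)" by blast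
  then have "generate G (?K \<union> set xs) \<subseteq> generate G (set ys)"
    by (rule generate_subgroup_incl[OF _ gen])
  then have "H \<subseteq> generate G (set ys)" by (simp flip: xs(3))
  moreover have "generate G (set ys) \<subseteq> H" by (rule generate_subgroup_incl[OF ysH H])
  moreover have "length ys = k" unfolding ys_def using k xs(2) by simp
  ultimately show ?thesis unfolding generated_by_def using ysH HG by blast
qed

text \<open>
  Every list of \<open>n\<close> elements of \<open>E\<close> spans a subgroup with at most \<open>2 ^ n\<close> elements, and such a subgroup
  is spanned by at most \<open>(2 ^ n) ^ n\<close> of the \<open>(2 ^ m) ^ n\<close> lists.
\<close>

lemma card_subgroups_elementary_abelian:
  assumes fin: "finite (carrier G)" and E: "subgroup E G" "card E = 2 ^ m"
    and sq: "\<And>x. x \<in> E \<Longrightarrow> x \<otimes> x = \<one>" and nm: "n \<le> m"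
  shows "2 ^ (n * (m - n)) \<le> card {H. subgroup H G}"
proof -
  have EG: "E \<subseteq> carrier G" by (rule subgroup.subset[OF E(1)])
  have inv_eq: "inv x = x" if "x \<in> E" for x
    using sq[OF that] EG that by (metis inv_equality subsetD)
  have comm: "x \<otimes> y = y \<otimes> x" if "x \<in> E" "y \<in> E" for x y
  proof -
    have xy: "x \<otimes> y \<in> E" by (rule subgroup.m_closed[OF E(1) that])
    have "x \<otimes> y = inv (x \<otimes> y)" using inv_eq[OF xy] by simp
    also have "\<dots> = inv y \<otimes> inv x" using that EG by (simp add: inv_mult_group subset_iff)
    also have "\<dots> = y \<otimes> x" using inv_eq that by simp
    finally show ?thesis .
  qed
  \<comment> \<open>the products over the sublists of a list, of which there are at most \<open>2 ^ n\<close>\<close>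
  define sp where "sp = (\<lambda>xs. foldr (\<lambda>x S. {e \<otimes> c | e c. e \<in> {\<one>, x} \<and> c \<in> S}) xs {\<one>})"
  have sp_Nil: "sp [] = {\<one>}" and sp_Cons: "sp (x # xs) = {e \<otimes> c | e c. e \<in> {\<one>, x} \<and> c \<in> sp xs}"
    for x xs by (simp_all add: sp_def)
  have sp: "subgroup (sp xs) G \<and> sp xs \<subseteq> E \<and> set xs \<subseteq> sp xs \<and> card (sp xs) \<le> 2 ^ length xs \<and> finite (sp xs)"
    if "set xs \<subseteq> E" for xs
    using that
  proof (induction xs)
    case Nil
    then show ?case using E by (auto simp: sp_Nil triv_subgroup subgroup.one_closed)
  next
    case (Cons x xs)
    then have x: "x \<in> E" "x \<in> carrier G" and S: "subgroup (sp xs) G" "sp xs \<subseteq> E" "set xs \<subseteq> sp xs"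
      "card (sp xs) \<le> 2 ^ length xs" "finite (sp xs)" using EG by auto
    let ?D = "{\<one>, x}"
    have one: "\<one> \<in> sp xs" by (rule subgroup.one_closed[OF S(1)])
    have mE: "y \<otimes> z \<in> E" if "y \<in> E" "z \<in> E" for y z by (rule subgroup.m_closed[OF E(1) that])
    have DE: "e \<in> E" if "e \<in> ?D" for e
      using that x(1) subgroup.one_closed[OF E(1)] by auto
    have D: "e \<otimes> e' \<in> ?D" if "e \<in> ?D" "e' \<in> ?D" for e e'
      using that x(2) sq[OF x(1)] by auto
    have sub: "sp (x # xs) \<subseteq> E" unfolding sp_Cons using mE[OF DE subsetD[OF S(2)]] by blast
    have "subgroup (sp (x # xs)) G"
    proof (rule subgroupI)
      show "sp (x # xs) \<subseteq> carrier G" using sub EG by blast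
      show "sp (x # xs) \<noteq> {}" using one by (auto simp: sp_Cons)
      show "inv a \<in> sp (x # xs)" if "a \<in> sp (x # xs)" for a
        using that sub inv_eq by (metis subsetD)
      fix a b assume "a \<in> sp (x # xs)" "b \<in> sp (x # xs)"
      then obtain e c e' c' where a: "a = e \<otimes> c" "e \<in> ?D" "c \<in> sp xs"
        and b: "b = e' \<otimes> c'" "e' \<in> ?D" "c' \<in> sp xs" unfolding sp_Cons by blast
      have inE: "e \<in> E" "e' \<in> E" "c \<in> E" "c' \<in> E" using a b DE S(2) by blast+
      then have inG: "e \<in> carrier G" "e' \<in> carrier G" "c \<in> carrier G" "c' \<in> carrier G"
        using EG by blast+
      have "a \<otimes> b = e \<otimes> (c \<otimes> e') \<otimes> c'" using a b inG by (simp add: m_assoc)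
      also have "c \<otimes> e' = e' \<otimes> c" by (rule comm[OF inE(3,2)])
      also have "e \<otimes> (e' \<otimes> c) \<otimes> c' = (e \<otimes> e') \<otimes> (c \<otimes> c')" using inG by (simp add: m_assoc)
      finally show "a \<otimes> b \<in> sp (x # xs)"
        using D[OF a(2) b(2)] subgroup.m_closed[OF S(1) a(3) b(3)] unfolding sp_Cons by blast
    qed
    moreover have "set (x # xs) \<subseteq> sp (x # xs)"
    proof
      fix y assume "y \<in> set (x # xs)"
      then have "y = x \<otimes> \<one> \<or> y = \<one> \<otimes> y \<and> y \<in> sp xs"
        using x(2) S(3) subset_trans[OF S(2) EG] by (auto intro!: l_one[symmetric])
      then show "y \<in> sp (x # xs)" using one unfolding sp_Cons by blast
    qed
    moreover have "card (sp (x # xs)) \<le> 2 ^ length (x # xs)" "finite (sp (x # xs))"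
    proof -
      have im: "sp (x # xs) = (\<lambda>(e, c). e \<otimes> c) ` (?D \<times> sp xs)" unfolding sp_Cons by auto
      then show "finite (sp (x # xs))" using S(5) by simp
      have "card (sp (x # xs)) \<le> card (?D \<times> sp xs)"
        unfolding im by (rule card_image_le) (use S(5) in simp)
      also have "\<dots> \<le> 2 * 2 ^ length xs"
        unfolding card_cartesian_product using S(4) by (intro mult_le_mono) (auto simp: card_insert_if)
      finally show "card (sp (x # xs)) \<le> 2 ^ length (x # xs)" by simp
    qed
    ultimately show ?case using sub by simp
  qed
  define L where "L = {xs. set xs \<subseteq> E \<and> length xs = n}"
  have finE: "finite E" by (rule finite_subgroup[OF fin E(1)])
  have finL: "finite L" unfolding L_def by (rule finite_lists_length_eq[OF finE])
  have "card L = (2 ^ m) ^ n" unfolding L_def using card_lists_length_eq[OF finE] E by simp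
  have sub: "sp ` L \<subseteq> {H. subgroup H G}"
  proof
    fix H assume "H \<in> sp ` L"
    then obtain zs where "set zs \<subseteq> E" "H = sp zs" by (auto simp: L_def)
    then show "H \<in> {H. subgroup H G}" using sp[of zs] by simp
  qed
  have "card L = (\<Sum>H\<in>sp ` L. card {xs \<in> L. sp xs = H})"
    using sum.image_gen[OF finL, of "\<lambda>_. 1::nat" sp] by simp
  also have "\<dots> \<le> (\<Sum>H\<in>sp ` L. 2 ^ (n * n))"
  proof (rule sum_mono)
    fix H assume "H \<in> sp ` L"
    then obtain zs where zs: "set zs \<subseteq> E" "length zs = n" "H = sp zs" by (auto simp: L_def)
    have H: "finite H" "card H \<le> 2 ^ n" using sp[OF zs(1)] zs by auto
    have "{xs \<in> L. sp xs = H} \<subseteq> {xs. set xs \<subseteq> H \<and> length xs = n}"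
    proof
      fix xs assume "xs \<in> {xs \<in> L. sp xs = H}"
      then show "xs \<in> {xs. set xs \<subseteq> H \<and> length xs = n}" using sp[of xs] by (simp add: L_def)
    qed
    then have "card {xs \<in> L. sp xs = H} \<le> card H ^ n"
      unfolding card_lists_length_eq[OF H(1), symmetric]
      by (rule card_mono[OF finite_lists_length_eq[OF H(1)]])
    also have "\<dots> \<le> (2 ^ n) ^ n" using H by (intro power_mono) auto
    finally show "card {xs \<in> L. sp xs = H} \<le> 2 ^ (n * n)" by (simp add: power_mult)
  qed
  also have "\<dots> = card (sp ` L) * 2 ^ (n * n)" by simp
  also have "\<dots> \<le> card {H. subgroup H G} * 2 ^ (n * n)"
    using card_mono[OF finite_subgroups[OF fin] sub] by simp
  finally have "2 ^ (m * n) \<le> card {H. subgroup H G} * 2 ^ (n * n)"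
    using \<open>card L = (2 ^ m) ^ n\<close> by (simp add: power_mult)
  moreover have "(2::nat) ^ (m * n) = 2 ^ (n * (m - n)) * 2 ^ (n * n)"
  proof -
    obtain r where "m = n + r" using nm le_Suc_ex by blast
    then have "m * n = n * (m - n) + n * n" by (simp add: algebra_simps)
    then show ?thesis by (simp only: power_add)
  qed
  ultimately show ?thesis by simp
qed

end

abbreviation (in group) (input) conj :: "'a \<Rightarrow> 'a \<Rightarrow> 'a" where
  "conj g h \<equiv> inv g \<otimes> h \<otimes> g"

lemma (in group) conjugation_hom:
  assumes "g \<in> carrier G" shows "group_hom G G (conj g)"
proof (unfold_locales, rule homI)
  fix x y assume xy: "x \<in> carrier G" "y \<in> carrier G"
  have "inv g \<otimes> x \<otimes> g \<otimes> (inv g \<otimes> y \<otimes> g) = inv g \<otimes> x \<otimes> (g \<otimes> (inv g \<otimes> (y \<otimes> g)))"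
    using assms xy by (simp add: m_assoc)
  also have "g \<otimes> (inv g \<otimes> (y \<otimes> g)) = y \<otimes> g"
    using assms xy by (simp flip: m_assoc)
  finally show "inv g \<otimes> (x \<otimes> y) \<otimes> g = inv g \<otimes> x \<otimes> g \<otimes> (inv g \<otimes> y \<otimes> g)"
    using assms xy by (simp add: m_assoc)
qed (use assms in auto)

lemma (in group) conjugation_eq_iff:
  assumes "g \<in> carrier G" "x \<in> carrier G" "y \<in> carrier G"
  shows "inv g \<otimes> x \<otimes> g = inv g \<otimes> y \<otimes> g \<longleftrightarrow> x = y"
  using assms by simp

lemma (in group) inv_cancel_left:
  assumes "x \<in> carrier G" "y \<in> carrier G"
  shows "inv x \<otimes> (x \<otimes> y) = y" "x \<otimes> (inv x \<otimes> y) = y"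
  using assms by (simp_all flip: m_assoc)

section \<open>Groups that act like a Suzuki group\<close>

locale finite_group_action = group G for G (structure) +
  fixes \<Omega> :: "'w set" and act :: "'a \<Rightarrow> 'w \<Rightarrow> 'w"
  assumes finite_carrier: "finite (carrier G)"
    and finite_points: "finite \<Omega>"
    and act_closed: "g \<in> carrier G \<Longrightarrow> \<omega> \<in> \<Omega> \<Longrightarrow> act g \<omega> \<in> \<Omega>"
    and act_one: "\<omega> \<in> \<Omega> \<Longrightarrow> act \<one> \<omega> = \<omega>"
    and act_mult: "g \<in> carrier G \<Longrightarrow> h \<in> carrier G \<Longrightarrow> \<omega> \<in> \<Omega> \<Longrightarrow> act (g \<otimes> h) \<omega> = act g (act h \<omega>)"
begin

lemma act_inv_eq:
  assumes "g \<in> carrier G" "\<omega> \<in> \<Omega>" "act g \<omega> = \<omega>'" shows "act (inv g) \<omega>' = \<omega>"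
  using assms act_mult[of "inv g" g \<omega>] act_one by auto

lemma act_inv_act: "g \<in> carrier G \<Longrightarrow> \<omega> \<in> \<Omega> \<Longrightarrow> act (inv g) (act g \<omega>) = \<omega>"
  using act_inv_eq by blast

lemma act_act_inv: "g \<in> carrier G \<Longrightarrow> \<omega> \<in> \<Omega> \<Longrightarrow> act g (act (inv g) \<omega>) = \<omega>"
  using act_inv_act[of "inv g"] by simp

definition stab :: "'w \<Rightarrow> 'a set" where
  "stab \<omega> = {g \<in> carrier G. act g \<omega> = \<omega>}"

lemma stab_subgroup:
  assumes "\<omega> \<in> \<Omega>" shows "subgroup (stab \<omega>) G"
  using assms act_one act_mult act_inv_eq by (intro subgroupI) (auto simp: stab_def)

lemma card_eq_card_orbit_times_card_stab:
  assumes H: "subgroup H G" and \<omega>: "\<omega> \<in> \<Omega>"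
  shows "card H = card ((\<lambda>h. act h \<omega>) ` H) * card (H \<inter> stab \<omega>)"
proof (rule card_eq_card_image_times_card_fibre[OF finite_carrier H])
  show "subgroup (H \<inter> stab \<omega>) G" by (rule subgroups_Inter_pair[OF H stab_subgroup[OF \<omega>]])
  show "H \<inter> stab \<omega> \<subseteq> H" by blast
  fix x y assume xy: "x \<in> H" "y \<in> H"
  then have G: "x \<in> carrier G" "y \<in> carrier G" using subgroup.mem_carrier[OF H] by auto
  have "inv x \<otimes> y \<in> H" using xy H by (simp add: subgroup.m_closed subgroup.m_inv_closed)
  moreover have "act (inv x \<otimes> y) \<omega> = \<omega> \<longleftrightarrow> act x \<omega> = act y \<omega>"
    using G \<omega> act_mult[of "inv x" y \<omega>] act_inv_act[of x \<omega>] act_act_inv[of x "act y \<omega>"] act_closed[of y \<omega>]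
    by auto
  ultimately show "act x \<omega> = act y \<omega> \<longleftrightarrow> inv x \<otimes> y \<in> H \<inter> stab \<omega>"
    using G by (simp add: stab_def)
qed

end

text \<open>
  What the proof needs to know about \<open>Sz(q)\<close>.  The elements of \<open>stab pt\<close> whose fourth power is trivial
  form, in the Suzuki group, the Sylow \<open>2\<close>-subgroup \<open>P\<close> of the stabilizer of \<open>pt\<close>; this description is
  invariant under conjugation, so that every property transfers to the other points.  The assumptions
  on \<open>P\<close> say in turn that it acts semiregularly away from \<open>pt\<close>, that its involutions are central in it,
  that elements with equal squares differ by an involution or the identity, and that the stabilizer of
  \<open>pt\<close> in any subgroup \<open>H\<close> is cyclic modulo \<open>P\<close>, generated by the image of \<open>x\<close>.
\<close>

locale suzuki_type_action = finite_group_action G \<Omega> act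
  for G (structure) and \<Omega> :: "'w set" and act :: "'a \<Rightarrow> 'w \<Rightarrow> 'w" +
  fixes pt :: 'w
  assumes odd_points: "odd (card \<Omega>)"
    and pt: "pt \<in> \<Omega>"
    and transitive: "\<omega> \<in> \<Omega> \<Longrightarrow> \<exists>g\<in>carrier G. act g pt = \<omega>"
    and semiregular: "\<lbrakk>u \<in> stab pt; (u \<otimes> u) \<otimes> (u \<otimes> u) = \<one>; u \<noteq> \<one>; \<omega> \<in> \<Omega>; act u \<omega> = \<omega>\<rbrakk> \<Longrightarrow> \<omega> = pt"
    and involution_central_pt: "\<lbrakk>u \<in> stab pt; u \<otimes> u = \<one>; v \<in> stab pt; (v \<otimes> v) \<otimes> (v \<otimes> v) = \<one>\<rbrakk>
      \<Longrightarrow> u \<otimes> v = v \<otimes> u"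
    and equal_squares_pt: "\<lbrakk>u \<in> stab pt; (u \<otimes> u) \<otimes> (u \<otimes> u) = \<one>; v \<in> stab pt; (v \<otimes> v) \<otimes> (v \<otimes> v) = \<one>;
      u \<otimes> u = v \<otimes> v\<rbrakk> \<Longrightarrow> (inv u \<otimes> v) \<otimes> (inv u \<otimes> v) = \<one>"
    and cyclic_quotient_pt: "subgroup H G \<Longrightarrow> \<exists>x\<in>H \<inter> stab pt. \<forall>h\<in>H \<inter> stab pt. \<exists>j::nat.
      (let u = inv (x [^] j) \<otimes> h in (u \<otimes> u) \<otimes> (u \<otimes> u) = \<one>)"
begin

text \<open>
  By transitivity, every stabilizer is a conjugate of the stabilizer of \<open>pt\<close>.
\<close>

lemma transport:
  assumes "\<omega> \<in> \<Omega>"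
  obtains g where "g \<in> carrier G" "act g pt = \<omega>"
    "\<forall>h\<in>carrier G. conj g h \<in> stab pt \<longleftrightarrow> h \<in> stab \<omega>"
proof -
  obtain g where g: "g \<in> carrier G" "act g pt = \<omega>" using transitive[OF assms] by blast
  have "act (conj g h) pt = pt \<longleftrightarrow> act h \<omega> = \<omega>" if h: "h \<in> carrier G" for h
  proof -
    have "act (conj g h) pt = act (inv g) (act h \<omega>)"
      using g h pt assms by (simp add: act_mult)
    moreover have "act (inv g) (act h \<omega>) = pt \<longleftrightarrow> act h \<omega> = \<omega>"
      using act_act_inv[of g "act h \<omega>"] act_inv_act[of g pt] act_closed[of h \<omega>] g h pt assms by auto
    ultimately show ?thesis by simp
  qed
  then show ?thesis using that g by (auto simp: stab_def)
qed

lemma involution_central: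
  assumes \<omega>: "\<omega> \<in> \<Omega>" and u: "u \<in> stab \<omega>" "u \<otimes> u = \<one>"
    and v: "v \<in> stab \<omega>" "(v \<otimes> v) \<otimes> (v \<otimes> v) = \<one>"
  shows "u \<otimes> v = v \<otimes> u"
proof -
  obtain g where g: "g \<in> carrier G" and "act g pt = \<omega>"
    and st': "\<forall>h\<in>carrier G. conj g h \<in> stab pt \<longleftrightarrow> h \<in> stab \<omega>"
    by (rule transport[OF \<omega>])
  note st = bspec[OF st']
  interpret c: group_hom G G "conj g" by (rule conjugation_hom[OF g])
  have G: "u \<in> carrier G" "v \<in> carrier G" using u v by (auto simp: stab_def)
  let ?c = "conj g"
  have "?c u \<otimes> ?c v = ?c v \<otimes> ?c u"
  proof (rule involution_central_pt)
    show "?c u \<in> stab pt" "?c v \<in> stab pt" using st u v G by auto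
    show "?c u \<otimes> ?c u = \<one>" using u G by (metis c.hom_mult c.hom_one)
    show "?c v \<otimes> ?c v \<otimes> (?c v \<otimes> ?c v) = \<one>" using v G by (metis c.hom_mult c.hom_one m_closed)
  qed
  then have "?c (u \<otimes> v) = ?c (v \<otimes> u)" using G by (metis c.hom_mult)
  then show ?thesis using conjugation_eq_iff[OF g, of "u \<otimes> v" "v \<otimes> u"] G by blast
qed

lemma equal_squares:
  assumes \<omega>: "\<omega> \<in> \<Omega>" and u: "u \<in> stab \<omega>" "(u \<otimes> u) \<otimes> (u \<otimes> u) = \<one>"
    and v: "v \<in> stab \<omega>" "(v \<otimes> v) \<otimes> (v \<otimes> v) = \<one>" and uv: "u \<otimes> u = v \<otimes> v"
  shows "(inv u \<otimes> v) \<otimes> (inv u \<otimes> v) = \<one>"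
proof -
  obtain g where g: "g \<in> carrier G" and "act g pt = \<omega>"
    and st': "\<forall>h\<in>carrier G. conj g h \<in> stab pt \<longleftrightarrow> h \<in> stab \<omega>"
    by (rule transport[OF \<omega>])
  note st = bspec[OF st']
  interpret c: group_hom G G "conj g" by (rule conjugation_hom[OF g])
  have G: "u \<in> carrier G" "v \<in> carrier G" using u v by (auto simp: stab_def)
  let ?c = "conj g"
  have "(inv (?c u) \<otimes> ?c v) \<otimes> (inv (?c u) \<otimes> ?c v) = \<one>"
  proof (rule equal_squares_pt)
    show "?c u \<in> stab pt" "?c v \<in> stab pt" using st u v G by auto
    show "?c u \<otimes> ?c u \<otimes> (?c u \<otimes> ?c u) = \<one>" using u G by (metis c.hom_mult c.hom_one m_closed)
    show "?c v \<otimes> ?c v \<otimes> (?c v \<otimes> ?c v) = \<one>" using v G by (metis c.hom_mult c.hom_one m_closed)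
    show "?c u \<otimes> ?c u = ?c v \<otimes> ?c v" using uv G by (metis c.hom_mult)
  qed
  then have "?c ((inv u \<otimes> v) \<otimes> (inv u \<otimes> v)) = ?c \<one>"
    using G by (metis c.hom_inv c.hom_mult c.hom_one inv_closed m_closed)
  then show ?thesis using conjugation_eq_iff[OF g, of "(inv u \<otimes> v) \<otimes> (inv u \<otimes> v)" \<one>] G by simp
qed

lemma cyclic_quotient:
  assumes \<omega>: "\<omega> \<in> \<Omega>" and H: "subgroup H G"
  obtains x where "x \<in> H" "x \<in> stab \<omega>"
    "\<And>h. h \<in> H \<Longrightarrow> h \<in> stab \<omega> \<Longrightarrow> \<exists>j::nat.
      (let u = inv (x [^] j) \<otimes> h in (u \<otimes> u) \<otimes> (u \<otimes> u) = \<one>)"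
proof -
  obtain g where g: "g \<in> carrier G" and "act g pt = \<omega>"
    and st': "\<forall>h\<in>carrier G. conj g h \<in> stab pt \<longleftrightarrow> h \<in> stab \<omega>"
    by (rule transport[OF \<omega>])
  note st = bspec[OF st']
  interpret c: group_hom G G "conj g" by (rule conjugation_hom[OF g])
  let ?c = "conj g"
  have HG: "\<And>h. h \<in> H \<Longrightarrow> h \<in> carrier G" by (rule subgroup.mem_carrier[OF H])
  have "subgroup (?c ` H) G" by (rule c.subgroup_img_is_subgroup[OF H])
  then obtain x' where x': "x' \<in> ?c ` H \<inter> stab pt" and
    ex: "\<And>h. h \<in> ?c ` H \<inter> stab pt \<Longrightarrow> \<exists>j::nat. (let u = inv (x' [^] j) \<otimes> h in (u \<otimes> u) \<otimes> (u \<otimes> u) = \<one>)"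
    using cyclic_quotient_pt by metis
  obtain x where x: "x \<in> H" "x' = ?c x" using x' by blast
  have xs: "x \<in> stab \<omega>" using x' x(2) st[OF HG[OF x(1)]] by simp
  show ?thesis
  proof (rule that[OF x(1) xs])
    fix h assume h: "h \<in> H" "h \<in> stab \<omega>"
    then have "?c h \<in> ?c ` H \<inter> stab pt" using HG st by blast
    then obtain j :: nat where j: "(let u = inv (?c x [^] j) \<otimes> ?c h in (u \<otimes> u) \<otimes> (u \<otimes> u) = \<one>)"
      using ex x(2) by blast
    have G: "x \<in> carrier G" "h \<in> carrier G" "x [^] j \<in> carrier G" using HG x h by auto
    define u where "u = inv (x [^] j) \<otimes> h"
    have uG: "u \<in> carrier G" unfolding u_def using G by simp
    have "inv (?c x [^] j) \<otimes> ?c h = inv (?c (x [^] j)) \<otimes> ?c h" using c.hom_nat_pow[OF G(1), of j] by simp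
    also have "\<dots> = ?c u" unfolding u_def using G c.hom_mult[of "inv (x [^] j)" h] c.hom_inv[of "x [^] j"] by simp
    finally have "(?c u \<otimes> ?c u) \<otimes> (?c u \<otimes> ?c u) = \<one>" using j by (simp add: Let_def)
    then have "?c ((u \<otimes> u) \<otimes> (u \<otimes> u)) = ?c \<one>"
      using uG by (metis c.hom_mult c.hom_one m_closed)
    then have "(u \<otimes> u) \<otimes> (u \<otimes> u) = \<one>"
      using conjugation_eq_iff[OF g, of "(u \<otimes> u) \<otimes> (u \<otimes> u)" \<one>] uG by simp
    then show "\<exists>j::nat. (let u = inv (x [^] j) \<otimes> h in (u \<otimes> u) \<otimes> (u \<otimes> u) = \<one>)"
      unfolding u_def Let_def by blast
  qed
qed

definition involution_at :: "'w \<Rightarrow> 'a \<Rightarrow> bool" where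
  "involution_at \<omega> t \<longleftrightarrow> t \<in> stab \<omega> \<and> t \<noteq> \<one> \<and> t \<otimes> t = \<one>"

lemma involution_fixed_point_unique:
  assumes t: "involution_at \<alpha> t" and \<alpha>: "\<alpha> \<in> \<Omega>" and \<beta>: "\<beta> \<in> \<Omega>" "act t \<beta> = \<beta>"
  shows "\<beta> = \<alpha>"
proof -
  obtain g where g: "g \<in> carrier G" "act g pt = \<alpha>"
    and st': "\<forall>h\<in>carrier G. conj g h \<in> stab pt \<longleftrightarrow> h \<in> stab \<alpha>"
    by (rule transport[OF \<alpha>])
  note st = bspec[OF st']
  interpret c: group_hom G G "conj g" by (rule conjugation_hom[OF g(1)])
  let ?c = "conj g"
  have tG: "t \<in> carrier G" and t1: "t \<noteq> \<one>" "t \<otimes> t = \<one>" "t \<in> stab \<alpha>"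
    using t by (auto simp: involution_at_def stab_def)
  have "?c t \<in> stab pt" using st tG t1 by blast
  moreover have "?c t \<noteq> \<one>" using conjugation_eq_iff[OF g(1) tG, of \<one>] t1 g(1) by simp
  moreover have "?c t \<otimes> ?c t = \<one>" using tG t1 by (metis c.hom_mult c.hom_one)
  moreover have \<gamma>: "act (inv g) \<beta> \<in> \<Omega>" using g \<beta> act_closed by simp
  moreover have "act (?c t) (act (inv g) \<beta>) = act (inv g) \<beta>"
    using g \<beta> tG \<gamma> act_act_inv[OF g(1) \<beta>(1)] by (simp add: act_mult)
  ultimately have "act (inv g) \<beta> = pt" using semiregular[of "?c t" "act (inv g) \<beta>"] by simp
  then show ?thesis using act_act_inv[OF g(1) \<beta>(1)] g(2) by simp
qed

text \<open>
  An involution has just one fixed point and pairs off all the other points.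
\<close>

lemma odd_if_invariant_under_involution:
  assumes t: "involution_at \<alpha> t" and \<alpha>: "\<alpha> \<in> \<Omega>"
    and A: "A \<subseteq> \<Omega>" "\<And>\<omega>. \<omega> \<in> A \<Longrightarrow> act t \<omega> \<in> A"
  shows "odd (card A) \<longleftrightarrow> \<alpha> \<in> A"
proof -
  have tG: "t \<in> carrier G" "t \<otimes> t = \<one>" using t by (auto simp: involution_at_def stab_def)
  have "even (card A) \<longleftrightarrow> even (card {\<omega> \<in> A. act t \<omega> = \<omega>})"
  proof (rule even_card_iff_even_fixed_points)
    show "finite A" using A finite_points finite_subset by blast
    show "act t (act t \<omega>) = \<omega>" if "\<omega> \<in> A" for \<omega>
      using that A(1) tG act_mult[of t t \<omega>] act_one by auto
  qed (use A in auto)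
  also have "{\<omega> \<in> A. act t \<omega> = \<omega>} = (if \<alpha> \<in> A then {\<alpha>} else {})"
    using involution_fixed_point_unique[OF t \<alpha>] A t by (auto simp: involution_at_def stab_def)
  finally show ?thesis by (auto split: if_splits)
qed

lemma involution_fixes_point:
  assumes t: "t \<in> carrier G" "t \<noteq> \<one>" "t \<otimes> t = \<one>"
  obtains \<alpha> where "\<alpha> \<in> \<Omega>" "involution_at \<alpha> t"
proof -
  have "even (card \<Omega>) \<longleftrightarrow> even (card {\<omega> \<in> \<Omega>. act t \<omega> = \<omega>})"
  proof (rule even_card_iff_even_fixed_points[OF finite_points])
    show "act t (act t \<omega>) = \<omega>" if "\<omega> \<in> \<Omega>" for \<omega>
      using that t act_mult[of t t \<omega>] act_one by auto
  qed (use t act_closed in auto)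
  then have "{\<omega> \<in> \<Omega>. act t \<omega> = \<omega>} \<noteq> {}" using odd_points by (metis card.empty even_zero)
  then show ?thesis using t that by (auto simp: involution_at_def stab_def)
qed

text \<open>
  Inversion pairs off the elements of \<open>H\<close> that are not their own inverses; as \<open>card H\<close> is even, the
  identity cannot be the only one that is left over.
\<close>

lemma even_subgroup_has_involution:
  assumes H: "subgroup H G" "even (card H)"
  obtains \<alpha> t where "\<alpha> \<in> \<Omega>" "t \<in> H" "involution_at \<alpha> t"
proof -
  have HG: "\<And>h. h \<in> H \<Longrightarrow> h \<in> carrier G" by (rule subgroup.mem_carrier[OF H(1)])
  have "even (card H) \<longleftrightarrow> even (card {h \<in> H. inv h = h})"
    by (rule even_card_iff_even_fixed_points)
      (use finite_subgroup[OF finite_carrier H(1)] subgroup.m_inv_closed[OF H(1)] HG in auto)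
  then have "even (card {h \<in> H. inv h = h})" using H by simp
  moreover have "\<one> \<in> {h \<in> H. inv h = h}" using subgroup.one_closed[OF H(1)] by simp
  ultimately have "{h \<in> H. inv h = h} \<noteq> {\<one>}" by (metis card_1_singleton_iff odd_one One_nat_def)
  then obtain t where t: "t \<in> H" "inv t = t" "t \<noteq> \<one>" using \<open>\<one> \<in> {h \<in> H. inv h = h}\<close> by blast
  have "t \<otimes> inv t = \<one>" by (rule r_inv[OF HG[OF t(1)]])
  then have "t \<otimes> t = \<one>" by (simp only: t(2))
  from involution_fixes_point[OF HG[OF t(1)] t(3) this]
  obtain \<alpha> where "\<alpha> \<in> \<Omega>" "involution_at \<alpha> t" .
  then show ?thesis by (intro that[OF _ t(1)])
qed

text \<open>
  Let \<open>c = s \<otimes> t\<close>, which \<open>s\<close> inverts.  If the order of \<open>c\<close> is \<open>2 * k + 1\<close>, then \<open>c [^] k\<close> conjugates \<open>s\<close>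
  to \<open>t\<close>.  If it were \<open>2 * k\<close>, then the involution \<open>c [^] k\<close> would commute with both \<open>s\<close> and \<open>t\<close>, which
  would force its fixed point to be the one of \<open>s\<close> and the one of \<open>t\<close>.
\<close>

lemma involutions_conjugate:
  assumes s: "involution_at \<alpha> s" and t: "involution_at \<beta> t"
    and ab: "\<alpha> \<in> \<Omega>" "\<beta> \<in> \<Omega>" "\<alpha> \<noteq> \<beta>" and H: "subgroup H G" "s \<in> H" "t \<in> H"
  shows "\<exists>h\<in>H. h \<otimes> s = t \<otimes> h"
proof -
  have sG: "s \<in> carrier G" "s \<otimes> s = \<one>" and tG: "t \<in> carrier G" "t \<otimes> t = \<one>"
    using s t by (auto simp: involution_at_def stab_def)
  have invs: "inv s = s" "inv t = t" using sG tG by (auto intro: inv_equality)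
  define c where "c = s \<otimes> t"
  have cG: "c \<in> carrier G" unfolding c_def using sG tG by simp
  have cH: "c \<in> H" unfolding c_def using H by (simp add: subgroup.m_closed)
  have invc: "inv c = t \<otimes> s" unfolding c_def using sG tG invs by (simp add: inv_mult_group)
  have cpow: "s \<otimes> c [^] k = inv (c [^] k) \<otimes> s" for k :: nat
  proof (induction k)
    case 0 then show ?case using sG by simp
  next
    case (Suc k)
    have "s \<otimes> c [^] Suc k = s \<otimes> c [^] k \<otimes> c" using sG cG by (simp add: m_assoc)
    also have "\<dots> = inv (c [^] k) \<otimes> (s \<otimes> c)" using Suc sG cG by (simp add: m_assoc)
    also have "s \<otimes> c = inv c \<otimes> s"
      unfolding invc unfolding c_def using sG tG by (simp add: m_assoc) (simp flip: m_assoc)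
    also have "inv (c [^] k) \<otimes> (inv c \<otimes> s) = inv (c \<otimes> c [^] k) \<otimes> s"
      using sG cG by (simp add: inv_mult_group m_assoc)
    also have "c \<otimes> c [^] k = c [^] Suc k" using cG by (metis nat_pow_Suc nat_pow_Suc2)
    finally show ?case .
  qed
  have ord: "c [^] ord c = \<one>" "ord c > 0" using pow_ord_eq_1[OF cG] ord_ge_1[OF finite_carrier cG] by auto
  show ?thesis
  proof (cases "odd (ord c)")
    case True
    then obtain k where k: "ord c = 2 * k + 1" by (rule oddE)
    have "t \<otimes> c [^] k = t \<otimes> s \<otimes> (s \<otimes> c [^] k)" using sG tG cG
      by (simp add: m_assoc) (simp flip: m_assoc add: sG)
    also have "\<dots> = inv c \<otimes> (inv (c [^] k) \<otimes> s)" using cpow invc by simp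
    also have "\<dots> = inv (c [^] Suc k) \<otimes> s" using cG sG by (simp add: inv_mult_group m_assoc)
    also have "inv (c [^] Suc k) = c [^] k"
    proof (rule inv_equality)
      have "c [^] k \<otimes> c [^] Suc k = c [^] (k + Suc k)" using cG by (rule nat_pow_mult)
      then show "c [^] k \<otimes> c [^] Suc k = \<one>" using k ord(1) by (simp add: mult_2)
    qed (use cG in auto)
    finally show ?thesis using subgroup_pow_closed[OF H(1) cH, of k] by metis
  next
    case False
    then obtain k where k: "ord c = 2 * k" by (auto elim: evenE)
    define z where "z = c [^] k"
    have zG: "z \<in> carrier G" unfolding z_def using cG by simp
    have k0: "k > 0" "k < ord c" using k ord(2) by auto
    have z1: "z \<noteq> \<one>" unfolding z_def using k0 pow_eq_id[OF cG] by (auto dest: dvd_imp_le)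
    have zz: "z \<otimes> z = \<one>"
      unfolding z_def using cG k ord(1) nat_pow_mult[OF cG, of k k] by (simp add: mult_2)
    then have invz: "inv z = z" using zG by (metis inv_equality)
    have sz: "s \<otimes> z = z \<otimes> s" using cpow[of k] invz unfolding z_def by simp
    have cz: "c \<otimes> z = z \<otimes> c" unfolding z_def using cG by (metis nat_pow_Suc nat_pow_Suc2)
    have tz: "t \<otimes> z = z \<otimes> t"
    proof -
      have tc: "t = s \<otimes> c" unfolding c_def using sG tG by (simp flip: m_assoc)
      have "t \<otimes> z = s \<otimes> (z \<otimes> c)" unfolding tc using sG cG zG cz by (simp add: m_assoc)
      also have "\<dots> = z \<otimes> s \<otimes> c" using sG cG zG sz by (simp flip: m_assoc)
      finally show ?thesis unfolding tc using sG cG zG by (simp add: m_assoc)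
    qed
    obtain \<gamma> where \<gamma>: "\<gamma> \<in> \<Omega>" "involution_at \<gamma> z" using involution_fixes_point[OF zG z1 zz] by blast
    have fix_of: "\<delta> = \<gamma>" if w: "involution_at \<delta> w" "\<delta> \<in> \<Omega>" "w \<otimes> z = z \<otimes> w" for \<delta> w
    proof -
      have wG: "w \<in> carrier G" using w by (auto simp: involution_at_def stab_def)
      have "act z (act w \<gamma>) = act w (act z \<gamma>)"
        using w(3) \<gamma> wG zG by (simp flip: act_mult)
      then have "act z (act w \<gamma>) = act w \<gamma>" using \<gamma> by (simp add: involution_at_def stab_def)
      then have "act w \<gamma> = \<gamma>"
        using involution_fixed_point_unique[OF \<gamma>(2,1), of "act w \<gamma>"] act_closed[OF wG \<gamma>(1)] by blast
      then show ?thesis using involution_fixed_point_unique[OF w(1,2) \<gamma>(1)] by simp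
    qed
    have "\<alpha> = \<gamma>" by (rule fix_of[OF s ab(1) sz])
    moreover have "\<beta> = \<gamma>" by (rule fix_of[OF t ab(2) tz])
    ultimately show ?thesis using ab by simp
  qed
qed


text \<open>
  Two involutions \<open>s\<close> and \<open>t\<close> of \<open>H\<close> with the same fixed point \<open>\<alpha>\<close> are conjugate by way of a third one with
  another fixed point, which exists because \<open>H\<close> moves \<open>\<alpha>\<close>.  The conjugating element maps the fixed point
  of \<open>s\<close> to that of \<open>t\<close>, so it fixes \<open>\<alpha>\<close>.
\<close>

lemma involutions_at_point_conjugate:
  assumes s: "involution_at \<alpha> s" "s \<in> H" and t: "involution_at \<alpha> t" "t \<in> H"
    and \<alpha>: "\<alpha> \<in> \<Omega>" and H: "subgroup H G" and k: "k \<in> H" "act k \<alpha> \<noteq> \<alpha>"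
  obtains h where "h \<in> H" "h \<in> stab \<alpha>" "h \<otimes> s = t \<otimes> h"
proof -
  have HG: "\<And>h. h \<in> H \<Longrightarrow> h \<in> carrier G" by (rule subgroup.mem_carrier[OF H])
  have sG: "s \<in> carrier G" "s \<otimes> s = \<one>" "s \<noteq> \<one>" "act s \<alpha> = \<alpha>"
    and tG: "t \<in> carrier G" "t \<otimes> t = \<one>" "act t \<alpha> = \<alpha>"
    using s t by (auto simp: involution_at_def stab_def)
  have kG: "k \<in> carrier G" by (rule HG[OF k(1)])
  define \<beta> where "\<beta> = act k \<alpha>"
  have \<beta>: "\<beta> \<in> \<Omega>" "\<beta> \<noteq> \<alpha>" unfolding \<beta>_def using k(2) act_closed[OF kG \<alpha>] by auto
  define r where "r = k \<otimes> s \<otimes> inv k"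
  have rG: "r \<in> carrier G" unfolding r_def using kG sG by simp
  have rH: "r \<in> H" unfolding r_def using H k s by (simp add: subgroup.m_closed subgroup.m_inv_closed)
  have "r \<otimes> r = k \<otimes> s \<otimes> (inv k \<otimes> k) \<otimes> (s \<otimes> inv k)"
    unfolding r_def using kG sG(1) by (simp add: m_assoc inv_cancel_left)
  also have "\<dots> = k \<otimes> (s \<otimes> s) \<otimes> inv k" using kG sG(1) by (simp add: m_assoc)
  finally have rr: "r \<otimes> r = \<one>" using kG sG by simp
  have r1: "r \<noteq> \<one>"
  proof
    assume "r = \<one>"
    then have "k \<otimes> s = k" unfolding r_def using kG sG by (metis inv_closed inv_equality inv_inv m_closed)
    then show False using kG sG by simp
  qed
  have "act r \<beta> = \<beta>" unfolding r_def \<beta>_def using kG sG \<alpha> act_closed act_inv_act by (simp add: act_mult)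
  then have r: "involution_at \<beta> r" using rG rr r1 by (simp add: involution_at_def stab_def)
  obtain a where a: "a \<in> H" "a \<otimes> s = r \<otimes> a"
    using involutions_conjugate[OF s(1) r \<alpha> \<beta>(1) _ H s(2) rH] \<beta>(2) by auto
  obtain b where b: "b \<in> H" "b \<otimes> r = t \<otimes> b"
    using involutions_conjugate[OF r t(1) \<beta>(1) \<alpha> \<beta>(2) H rH t(2)] by auto
  have abG: "a \<in> carrier G" "b \<in> carrier G" using a b HG by auto
  define h where "h = b \<otimes> a"
  have hH: "h \<in> H" unfolding h_def by (rule subgroup.m_closed[OF H b(1) a(1)])
  have hG: "h \<in> carrier G" by (rule HG[OF hH])
  have "h \<otimes> s = b \<otimes> r \<otimes> a" unfolding h_def using abG sG rG a by (simp add: m_assoc)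
  also have "\<dots> = t \<otimes> h" unfolding h_def using abG tG b by (simp add: m_assoc)
  finally have hs: "h \<otimes> s = t \<otimes> h" .
  have "act t (act h \<alpha>) = act h \<alpha>"
    using hs hG sG tG \<alpha> by (metis act_mult)
  then have "act h \<alpha> = \<alpha>"
    using involution_fixed_point_unique[OF t(1) \<alpha> act_closed[OF hG \<alpha>]] by simp
  then have "h \<in> stab \<alpha>" using hG by (simp add: stab_def)
  then show ?thesis using that hH hs by simp
qed

text \<open>
  Let \<open>U\<close> be the set of elements of \<open>H \<inter> stab \<alpha>\<close> with trivial fourth power, and let \<open>x\<close> generate the
  cyclic quotient.  Since the involutions in \<open>U\<close> are conjugate under \<open>H \<inter> stab \<alpha>\<close> and centralized
  by \<open>U\<close>, the powers of \<open>x\<close> already permute them transitively; so \<open>x\<close> and \<open>t\<close> generate all of them.  If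
  \<open>U\<close> contains an element \<open>u\<close> that is not an involution and not the identity, then the square of any
  other such \<open>v\<close> is the square of a conjugate \<open>w\<close> of \<open>u\<close> by an element of the group generated
  by \<open>x\<close>, and \<open>w\<close> differs from \<open>v\<close> by an involution or the identity.
\<close>

lemma stab_generated_by_three:
  assumes H: "subgroup H G" and \<alpha>: "\<alpha> \<in> \<Omega>" and t: "involution_at \<alpha> t" "t \<in> H"
    and k: "k \<in> H" "act k \<alpha> \<noteq> \<alpha>"
  obtains x u where "x \<in> H" "u \<in> H" "H \<inter> stab \<alpha> \<subseteq> generate G {x, t, u}"
proof -
  have HG: "\<And>h. h \<in> H \<Longrightarrow> h \<in> carrier G" by (rule subgroup.mem_carrier[OF H])
  have Hc: "H \<subseteq> carrier G" by (rule subgroup.subset[OF H])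
  obtain x where x: "x \<in> H" "x \<in> stab \<alpha>" and
    cyc: "\<And>h. h \<in> H \<Longrightarrow> h \<in> stab \<alpha> \<Longrightarrow> \<exists>j::nat. (let u = inv (x [^] j) \<otimes> h in (u \<otimes> u) \<otimes> (u \<otimes> u) = \<one>)"
    using cyclic_quotient[OF \<alpha> H] by blast
  have xG: "x \<in> carrier G" by (rule HG[OF x(1)])
  have tG: "t \<in> carrier G" "t \<otimes> t = \<one>" "t \<in> stab \<alpha>" using t by (auto simp: involution_at_def stab_def)
  have SA: "subgroup (H \<inter> stab \<alpha>) G" by (rule subgroups_Inter_pair[OF H stab_subgroup[OF \<alpha>]])
  define U where "U = {v \<in> H \<inter> stab \<alpha>. (v \<otimes> v) \<otimes> (v \<otimes> v) = \<one>}"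
  \<comment> \<open>the quotient by \<open>U\<close> is cyclic, generated by \<open>x\<close>\<close>
  have split: "\<exists>j::nat. \<exists>v\<in>U. h = x [^] j \<otimes> v" if h: "h \<in> H \<inter> stab \<alpha>" for h
  proof -
    obtain j :: nat where j: "(let u = inv (x [^] j) \<otimes> h in (u \<otimes> u) \<otimes> (u \<otimes> u) = \<one>)"
      using cyc[of h] h by blast
    have "x [^] j \<in> H \<inter> stab \<alpha>" using x by (intro subgroup_pow_closed[OF SA]) simp
    then have "inv (x [^] j) \<otimes> h \<in> H \<inter> stab \<alpha>"
      by (intro subgroup.m_closed[OF SA] subgroup.m_inv_closed[OF SA] h)
    then have "inv (x [^] j) \<otimes> h \<in> U" using j by (simp add: U_def Let_def)
    moreover have "h = x [^] j \<otimes> (inv (x [^] j) \<otimes> h)"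
      using h HG xG by (simp flip: m_assoc)
    ultimately show ?thesis by blast
  qed
  \<comment> \<open>the conjugating element may be replaced by a power of \<open>x\<close>, as \<open>U\<close> centralizes \<open>t\<close>\<close>
  have inv_conj: "\<exists>j::nat. s \<otimes> x [^] j = x [^] j \<otimes> t" if s: "s \<in> H" "involution_at \<alpha> s" for s
  proof -
    obtain h where h: "h \<in> H" "h \<in> stab \<alpha>" "h \<otimes> t = s \<otimes> h"
      using involutions_at_point_conjugate[OF t s(2,1) \<alpha> H k] by blast
    then obtain j :: nat and v where v: "v \<in> U" "h = x [^] j \<otimes> v" using split by blast
    have sG: "s \<in> carrier G" by (rule HG[OF s(1)])
    have vG: "v \<in> carrier G" using v HG by (auto simp: U_def)
    have "t \<otimes> v = v \<otimes> t"
      using v tG by (intro involution_central[OF \<alpha>]) (auto simp: U_def)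
    then have "s \<otimes> x [^] j \<otimes> v = x [^] j \<otimes> t \<otimes> v"
      using h(3) v(2) xG sG tG vG by (simp add: m_assoc)
    then have "s \<otimes> x [^] j = x [^] j \<otimes> t" using xG sG tG vG by simp
    then show ?thesis by blast
  qed
  have main: "\<exists>u\<in>H. U \<subseteq> generate G {x, t, u}"
  proof -
    have gen_inv: "s \<in> generate G {x, t, u}"
      if s: "s \<in> H" "s \<in> stab \<alpha>" "s \<otimes> s = \<one>" and u: "u \<in> H" for s u
    proof -
      have gen: "subgroup (generate G {x, t, u}) G"
        using xG tG HG[OF u] by (intro generate_is_subgroup) auto
      have xt: "x \<in> generate G {x, t, u}" "t \<in> generate G {x, t, u}" by (auto intro: generate.incl)
      show ?thesis
      proof (cases "s = \<one>")
        case True then show ?thesis using subgroup.one_closed[OF gen] by simp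
      next
        case False
        then have "involution_at \<alpha> s" using s by (simp add: involution_at_def)
        then obtain j :: nat where j: "s \<otimes> x [^] j = x [^] j \<otimes> t" using inv_conj s by blast
        then have "s = x [^] j \<otimes> t \<otimes> inv (x [^] j)"
          using HG[OF s(1)] xG tG by (simp add: inv_solve_right)
        moreover have "x [^] j \<in> generate G {x, t, u}" by (rule subgroup_pow_closed[OF gen xt(1)])
        ultimately show ?thesis using xt gen by (simp add: subgroup.m_closed subgroup.m_inv_closed)
      qed
    qed
    show ?thesis
    proof (cases "\<exists>u\<in>U. u \<otimes> u \<noteq> \<one>")
      case False
      have "U \<subseteq> generate G {x, t, t}"
      proof
        fix v assume v: "v \<in> U"
        then have "v \<otimes> v = \<one>" using False by blast
        then show "v \<in> generate G {x, t, t}" using v by (intro gen_inv[OF _ _ _ t(2)]) (auto simp: U_def)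
      qed
      then show ?thesis using t(2) by (rule bexI)
    next
      case True
      then obtain u where u: "u \<in> U" "u \<otimes> u \<noteq> \<one>" by blast
      have uH: "u \<in> H" "u \<in> stab \<alpha>" "(u \<otimes> u) \<otimes> (u \<otimes> u) = \<one>" using u by (auto simp: U_def)
      have uG: "u \<in> carrier G" by (rule HG[OF uH(1)])
      have gen: "subgroup (generate G {x, t, u}) G"
        using xG tG uG by (intro generate_is_subgroup) auto
      have xu: "x \<in> generate G {x, t, u}" "u \<in> generate G {x, t, u}" by (auto intro: generate.incl)
      have sq_inv: "involution_at \<alpha> (v \<otimes> v)" "v \<otimes> v \<in> H" if v: "v \<in> U" "v \<otimes> v \<noteq> \<one>" for v
      proof -
        have "v \<in> H \<inter> stab \<alpha>" using v by (simp add: U_def)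
        then have "v \<otimes> v \<in> H \<inter> stab \<alpha>" by (intro subgroup.m_closed[OF SA])
        then show "involution_at \<alpha> (v \<otimes> v)" "v \<otimes> v \<in> H" using v by (auto simp: U_def involution_at_def)
      qed
      have "v \<in> generate G {x, t, u}" if v: "v \<in> U" for v
      proof (cases "v \<otimes> v = \<one>")
        case True
        then show ?thesis using v gen_inv[OF _ _ _ uH(1)] by (auto simp: U_def)
      next
        case False
        have vH: "v \<in> H" "v \<in> stab \<alpha>" "(v \<otimes> v) \<otimes> (v \<otimes> v) = \<one>" using v by (auto simp: U_def)
        have vG: "v \<in> carrier G" by (rule HG[OF vH(1)])
        obtain i :: nat where i: "u \<otimes> u \<otimes> x [^] i = x [^] i \<otimes> t" using inv_conj sq_inv[OF u] by blast
        obtain j :: nat where j: "v \<otimes> v \<otimes> x [^] j = x [^] j \<otimes> t" using inv_conj sq_inv[OF v False] by blast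
        define y where "y = x [^] j \<otimes> inv (x [^] i)"
        have yS: "y \<in> H \<inter> stab \<alpha>" unfolding y_def
          using x by (intro subgroup.m_closed[OF SA] subgroup.m_inv_closed[OF SA] subgroup_pow_closed[OF SA]) auto
        have yG: "y \<in> carrier G" using yS HG by blast
        have yg: "y \<in> generate G {x, t, u}" unfolding y_def
          using xu by (intro subgroup.m_closed[OF gen] subgroup.m_inv_closed[OF gen] subgroup_pow_closed[OF gen])
        define w where "w = y \<otimes> u \<otimes> inv y"
        have wS: "w \<in> H \<inter> stab \<alpha>" unfolding w_def
          using yS uH by (intro subgroup.m_closed[OF SA] subgroup.m_inv_closed[OF SA]) auto
        have wG: "w \<in> carrier G" using wS HG by blast
        have wg: "w \<in> generate G {x, t, u}" unfolding w_def
          using yg xu by (intro subgroup.m_closed[OF gen] subgroup.m_inv_closed[OF gen])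
        have tt: "t = inv (x [^] i) \<otimes> (u \<otimes> u \<otimes> x [^] i)" using i xG tG by (simp flip: m_assoc)
        have ww: "w \<otimes> w = v \<otimes> v"
        proof -
          have "w \<otimes> w = y \<otimes> u \<otimes> (inv y \<otimes> y) \<otimes> (u \<otimes> inv y)"
            unfolding w_def using yG uG by (simp add: m_assoc inv_cancel_left)
          also have "\<dots> = y \<otimes> (u \<otimes> u) \<otimes> inv y" using yG uG by (simp add: m_assoc)
          also have "inv y = x [^] i \<otimes> inv (x [^] j)"
            unfolding y_def using xG by (simp add: inv_mult_group)
          also have "y \<otimes> (u \<otimes> u) \<otimes> (x [^] i \<otimes> inv (x [^] j))
              = x [^] j \<otimes> (inv (x [^] i) \<otimes> (u \<otimes> u \<otimes> x [^] i)) \<otimes> inv (x [^] j)"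
            unfolding y_def using xG uG by (simp add: m_assoc)
          also have "\<dots> = x [^] j \<otimes> t \<otimes> inv (x [^] j)" using tt by simp
          also have "\<dots> = v \<otimes> v" using j[symmetric] vG xG by (simp add: m_assoc)
          finally show ?thesis .
        qed
        have "(inv w \<otimes> v) \<otimes> (inv w \<otimes> v) = \<one>"
          using wS vH ww by (intro equal_squares[OF \<alpha>]) auto
        moreover have "inv w \<otimes> v \<in> H \<inter> stab \<alpha>"
          using wS vH by (intro subgroup.m_closed[OF SA] subgroup.m_inv_closed[OF SA]) auto
        ultimately have "inv w \<otimes> v \<in> generate G {x, t, u}" using gen_inv[OF _ _ _ uH(1)] by blast
        then have "w \<otimes> (inv w \<otimes> v) \<in> generate G {x, t, u}" by (rule subgroup.m_closed[OF gen wg])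
        moreover have "w \<otimes> (inv w \<otimes> v) = v" using wG vG by (simp flip: m_assoc)
        ultimately show ?thesis by simp
      qed
      then show ?thesis using uH(1) by blast
    qed
  qed
  then obtain u where u: "u \<in> H" "U \<subseteq> generate G {x, t, u}" by blast
  have gen: "subgroup (generate G {x, t, u}) G"
    using xG tG HG[OF u(1)] by (intro generate_is_subgroup) auto
  have xg: "x \<in> generate G {x, t, u}" by (auto intro: generate.incl)
  have "H \<inter> stab \<alpha> \<subseteq> generate G {x, t, u}"
  proof
    fix h assume "h \<in> H \<inter> stab \<alpha>"
    then obtain j :: nat and v where v: "v \<in> U" "h = x [^] j \<otimes> v" using split by blast
    then show "h \<in> generate G {x, t, u}"
      using u(2) xg by (auto intro!: subgroup.m_closed[OF gen] subgroup_pow_closed[OF gen])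
  qed
  then show ?thesis using that x(1) u(1) by blast
qed


definition subgroups :: "'a set set" where
  "subgroups = {H. subgroup H G}"

definition even_fixers :: "'w \<Rightarrow> 'a set set" where
  "even_fixers \<alpha> = {H. subgroup H G \<and> even (card H) \<and> H \<subseteq> stab \<alpha>}"

lemma even_fixers_involution:
  assumes "H \<in> even_fixers \<alpha>" obtains t where "t \<in> H" "involution_at \<alpha> t"
proof -
  have H: "subgroup H G" "even (card H)" "H \<subseteq> stab \<alpha>" using assms by (auto simp: even_fixers_def)
  obtain \<beta> t where t: "t \<in> H" "involution_at \<beta> t" by (rule even_subgroup_has_involution[OF H(1,2)])
  then have "involution_at \<alpha> t" using H(3) by (auto simp: involution_at_def)
  then show ?thesis using that t(1) by blast
qed

lemma even_fixers_disjoint: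
  assumes "\<alpha> \<in> \<Omega>" "\<beta> \<in> \<Omega>" "H \<in> even_fixers \<alpha>" "H \<in> even_fixers \<beta>" shows "\<beta> = \<alpha>"
proof -
  obtain t where t: "t \<in> H" "involution_at \<alpha> t" by (rule even_fixers_involution[OF assms(3)])
  have "act t \<beta> = \<beta>" using t(1) assms(4) by (auto simp: even_fixers_def stab_def)
  then show ?thesis by (rule involution_fixed_point_unique[OF t(2) assms(1,2)])
qed

text \<open>
  The \<open>K\<close>-orbit of \<open>\<alpha>\<close> is invariant under \<open>K\<close> and, if the subgroups permute, under \<open>H\<close>.  By parity it
  contains the fixed point \<open>\<beta>\<close> of an involution of \<open>K\<close>; but \<open>K\<close> fixes \<open>\<beta>\<close>, so \<open>\<beta>\<close> is in no other orbit than its own.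
\<close>

lemma even_fixers_not_permutable:
  assumes ab: "\<alpha> \<in> \<Omega>" "\<beta> \<in> \<Omega>" and H: "H \<in> even_fixers \<alpha>" and K: "K \<in> even_fixers \<beta>"
    and perm: "H <#> K = K <#> H"
  shows "\<beta> = \<alpha>"
proof (rule ccontr)
  assume neq: "\<beta> \<noteq> \<alpha>"
  have sub: "subgroup H G" "subgroup K G" "H \<subseteq> stab \<alpha>" "K \<subseteq> stab \<beta>"
    using H K by (auto simp: even_fixers_def)
  have G: "\<And>h. h \<in> H \<Longrightarrow> h \<in> carrier G" "\<And>k. k \<in> K \<Longrightarrow> k \<in> carrier G"
    using subgroup.mem_carrier sub by metis+
  obtain s where s: "s \<in> H" "involution_at \<alpha> s" by (rule even_fixers_involution[OF H])
  obtain t where t: "t \<in> K" "involution_at \<beta> t" by (rule even_fixers_involution[OF K])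
  define A where "A = (\<lambda>k. act k \<alpha>) ` K"
  have A: "A \<subseteq> \<Omega>" unfolding A_def using ab G act_closed by auto
  have "\<alpha> \<in> A"
    unfolding A_def using subgroup.one_closed[OF sub(2)] act_one[OF ab(1)] by force
  moreover have "act s \<omega> \<in> A" if \<omega>: "\<omega> \<in> A" for \<omega>
  proof -
    obtain k where k: "k \<in> K" "\<omega> = act k \<alpha>" using \<omega> by (auto simp: A_def)
    have "s \<otimes> k \<in> K <#> H" using s(1) k(1) unfolding perm[symmetric] by (auto simp: set_mult_def)
    then obtain k' h' where kh: "k' \<in> K" "h' \<in> H" "s \<otimes> k = k' \<otimes> h'" by (auto simp: set_mult_def)
    have "act s \<omega> = act (s \<otimes> k) \<alpha>" using k s(1) G ab by (simp add: act_mult)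
    also have "\<dots> = act k' (act h' \<alpha>)" unfolding kh(3) using kh G ab by (simp add: act_mult)
    also have "act h' \<alpha> = \<alpha>" using kh(2) sub(3) by (auto simp: stab_def)
    finally show ?thesis using kh(1) by (simp add: A_def)
  qed
  ultimately have "odd (card A)" using odd_if_invariant_under_involution[OF s(2) ab(1) A] by blast
  moreover have "act t \<omega> \<in> A" if \<omega>: "\<omega> \<in> A" for \<omega>
  proof -
    obtain k where k: "k \<in> K" "\<omega> = act k \<alpha>" using \<omega> by (auto simp: A_def)
    have "act t \<omega> = act (t \<otimes> k) \<alpha>" using k t(1) G ab by (simp add: act_mult)
    then show ?thesis using subgroup.m_closed[OF sub(2) t(1) k(1)] by (simp add: A_def)
  qed
  ultimately have "\<beta> \<in> A" using odd_if_invariant_under_involution[OF t(2) ab(2) A] by blast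
  then obtain k where k: "k \<in> K" "act k \<alpha> = \<beta>" by (auto simp: A_def)
  have "act (inv k) \<beta> = \<alpha>" by (rule act_inv_eq[OF G(2)[OF k(1)] ab(1) k(2)])
  moreover have "act (inv k) \<beta> = \<beta>"
    using subgroup.m_inv_closed[OF sub(2) k(1)] sub(4) by (auto simp: stab_def)
  ultimately show False using neq by simp
qed

lemma card_even_fixers_eq:
  assumes "\<alpha> \<in> \<Omega>" shows "card (even_fixers \<alpha>) = card (even_fixers pt)"
proof -
  obtain g where g: "g \<in> carrier G" "act g pt = \<alpha>"
    and st': "\<forall>h\<in>carrier G. conj g h \<in> stab pt \<longleftrightarrow> h \<in> stab \<alpha>"
    by (rule transport[OF assms])
  note st = bspec[OF st']
  let ?c = "conj g" and ?d = "conj (inv g)"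
  interpret c: group_hom G G ?c by (rule conjugation_hom[OF g(1)])
  interpret d: group_hom G G ?d by (rule conjugation_hom) (use g in simp)
  have cd: "?c (?d h) = h" "?d (?c h) = h" if "h \<in> carrier G" for h
    using that g(1) by (simp_all add: m_assoc inv_cancel_left)
  have inj: "inj_on ?c (carrier G)" "inj_on ?d (carrier G)"
    using cd by (metis (no_types, lifting) inj_onI)+
  have c: "?c ` H \<in> even_fixers pt" if "H \<in> even_fixers \<alpha>" for H
  proof -
    have H: "subgroup H G" "even (card H)" "H \<subseteq> stab \<alpha>" using that by (auto simp: even_fixers_def)
    have HG: "H \<subseteq> carrier G" by (rule subgroup.subset[OF H(1)])
    have "card (?c ` H) = card H" by (rule card_image[OF inj_on_subset[OF inj(1) HG]])
    moreover have "?c ` H \<subseteq> stab pt" using st H(3) HG by blast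
    ultimately show ?thesis using c.subgroup_img_is_subgroup[OF H(1)] H by (simp add: even_fixers_def)
  qed
  have d: "?d ` H \<in> even_fixers \<alpha>" if "H \<in> even_fixers pt" for H
  proof -
    have H: "subgroup H G" "even (card H)" "H \<subseteq> stab pt" using that by (auto simp: even_fixers_def)
    have HG: "H \<subseteq> carrier G" by (rule subgroup.subset[OF H(1)])
    have "card (?d ` H) = card H" by (rule card_image[OF inj_on_subset[OF inj(2) HG]])
    moreover have "?d ` H \<subseteq> stab \<alpha>"
    proof
      fix x assume "x \<in> ?d ` H"
      then obtain h where h: "h \<in> H" "x = ?d h" by blast
      have "h \<in> carrier G" "h \<in> stab pt" using h(1) HG H(3) by auto
      then show "x \<in> stab \<alpha>" using st[of x] cd(1)[of h] h(2) d.hom_closed[of h] by simp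
    qed
    ultimately show ?thesis using d.subgroup_img_is_subgroup[OF H(1)] H by (simp add: even_fixers_def)
  qed
  have "bij_betw (\<lambda>H. ?c ` H) (even_fixers \<alpha>) (even_fixers pt)"
  proof (rule bij_betw_byWitness[where f' = "\<lambda>H. ?d ` H"])
    have im: "?d ` ?c ` H = H" "?c ` ?d ` H = H" if "H \<subseteq> carrier G" for H
      using that cd by (force simp: image_image subset_iff)+
    have gc: "H \<subseteq> carrier G" if "H \<in> even_fixers \<beta>" for H \<beta>
      using that by (auto simp: even_fixers_def dest: subgroup.subset)
    show "\<forall>H\<in>even_fixers \<alpha>. ?d ` ?c ` H = H" by (intro ballI im(1) gc)
    show "\<forall>H\<in>even_fixers pt. ?c ` ?d ` H = H" by (intro ballI im(2) gc)
  qed (use c d in auto)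
  then show ?thesis by (rule bij_betw_same_card)
qed

text \<open>
  A subgroup \<open>H\<close> of odd order is built from the trivial subgroup, whose index in \<open>H\<close> is odd.  In a
  subgroup \<open>H\<close> of even order that fixes no point, let \<open>\<alpha>\<close> be the fixed point of an involution: the
  index of \<open>H \<inter> stab \<alpha>\<close> in \<open>H\<close> is the size of an orbit, which is odd by parity, and three
  elements generate a subgroup that contains \<open>H \<inter> stab \<alpha>\<close>.  An odd index divides \<open>D\<close>.
\<close>

lemma generated_by_if_not_even_fixer:
  assumes ord: "order G dvd 2 ^ e * D" and D: "odd D"
    and H: "subgroup H G" "\<And>\<alpha>. \<alpha> \<in> \<Omega> \<Longrightarrow> H \<notin> even_fixers \<alpha>"
  shows "H \<in> generated_by (size (prime_factorization D) + 3)"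
proof -
  have D0: "D > 0" using D by (cases D) auto
  have Hord: "card H dvd 2 ^ e * D"
    using lagrange[OF H(1)] ord by (metis dvd_trans dvd_triv_right)
  have bound: "size (prime_factorization d) + 3 \<le> size (prime_factorization D) + 3"
    if d: "odd d" "d dvd card H" for d
  proof -
    have "d dvd 2 ^ e * D" using d(2) Hord by (rule dvd_trans)
    moreover have "coprime d (2 ^ e)" using d(1) by simp
    ultimately have "d dvd D" by (simp add: coprime_dvd_mult_right_iff)
    then have "prime_factorization d \<subseteq># prime_factorization D"
      using D0 by (subst prime_factorization_subset_iff_dvd) (auto intro: Nat.gr0I)
    then show ?thesis by (simp add: size_mset_mono)
  qed
  show ?thesis
  proof (cases "even (card H)")
    case False
    have one: "\<one> \<in> H" by (rule subgroup.one_closed[OF H(1)])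
    have "generate G {\<one>, \<one>, \<one>} = {\<one>}" using generate_one by simp
    then show ?thesis
      using False bound[of "card H"] by (intro generated_by_of_index[OF finite_carrier H(1) one one one]) auto
  next
    case True
    obtain \<alpha> t where t: "\<alpha> \<in> \<Omega>" "t \<in> H" "involution_at \<alpha> t"
      by (rule even_subgroup_has_involution[OF H(1) True])
    have "\<not> H \<subseteq> stab \<alpha>" using H t(1) True by (auto simp: even_fixers_def)
    moreover have HG: "H \<subseteq> carrier G" by (rule subgroup.subset[OF H(1)])
    ultimately obtain k where k: "k \<in> H" "act k \<alpha> \<noteq> \<alpha>" by (auto simp: stab_def)
    obtain x u where xu: "x \<in> H" "u \<in> H" "H \<inter> stab \<alpha> \<subseteq> generate G {x, t, u}"
      by (rule stab_generated_by_three[OF H(1) t(1,3,2) k])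
    let ?K = "generate G {x, t, u}"
    have sub: "{x, t, u} \<subseteq> H" using xu t by simp
    have K: "subgroup ?K G" using sub HG by (intro generate_is_subgroup) blast
    have KH: "?K \<subseteq> H" by (rule generate_subgroup_incl[OF sub H(1)])
    obtain d where d: "card H = card ?K * d"
      using card_subgroup_dvd[OF H(1) K KH] by (elim dvdE)
    have SA: "subgroup (H \<inter> stab \<alpha>) G" by (rule subgroups_Inter_pair[OF H(1) stab_subgroup[OF t(1)]])
    obtain j where j: "card ?K = card (H \<inter> stab \<alpha>) * j"
      using card_subgroup_dvd[OF K SA xu(3)] by (elim dvdE)
    define A where "A = (\<lambda>h. act h \<alpha>) ` H"
    have "card A * card (H \<inter> stab \<alpha>) = card (H \<inter> stab \<alpha>) * j * d"
      unfolding A_def card_eq_card_orbit_times_card_stab[OF H(1) t(1), symmetric] d j ..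
    then have "card (H \<inter> stab \<alpha>) * card A = card (H \<inter> stab \<alpha>) * (j * d)"
      by (simp only: mult.commute mult.assoc)
    then have "card A = j * d"
      using card_subgroup_pos[OF finite_carrier SA] by simp
    moreover have "odd (card A)"
    proof -
      have "A \<subseteq> \<Omega>" unfolding A_def using t(1) HG act_closed by auto
      moreover have "act t \<omega> \<in> A" if \<omega>: "\<omega> \<in> A" for \<omega>
      proof -
        obtain h where h: "h \<in> H" "\<omega> = act h \<alpha>" using \<omega> by (auto simp: A_def)
        have "act t \<omega> = act (t \<otimes> h) \<alpha>" using h t(1,2) HG by (simp add: act_mult subset_iff)
        then show ?thesis using subgroup.m_closed[OF H(1) t(2) h(1)] by (simp add: A_def)
      qed
      moreover have "\<alpha> \<in> A"
        unfolding A_def using subgroup.one_closed[OF H(1)] act_one[OF t(1)] by force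
      ultimately show ?thesis using odd_if_invariant_under_involution[OF t(3,1)] by blast
    qed
    ultimately have "odd d" by simp
    then show ?thesis
      using bound[of d] d by (intro generated_by_of_index[OF finite_carrier H(1) xu(1) t(2) xu(2) d]) auto
  qed
qed

text \<open>
  Let \<open>N\<close> be the number of subgroups and \<open>M\<close> the bound for those that are not of even order with a fixed
  point.  At most \<open>2 * M * N\<close> pairs have a member of this exceptional kind; in any other permuting pair
  both members fix the same point.  With \<open>m\<close> subgroups for each of the \<open>w\<close> points there are at most
  \<open>w * m ^ 2\<close> pairs of the latter kind, and \<open>w * m \<le> N\<close>.
\<close>

theorem permutability_degree_le:
  assumes ord: "order G dvd 2 ^ e * D" and D: "odd D"
  shows "subgroup_permutability_degree G
    \<le> 2 * real (order G ^ (size (prime_factorization D) + 3)) / real (card subgroups) + 1 / real (card \<Omega>)"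
proof -
  define k where "k = size (prime_factorization D) + 3"
  define M where "M = order G ^ k"
  define N where "N = card subgroups"
  define m where "m = card (even_fixers pt)"
  define w where "w = card \<Omega>"
  define bad where "bad = generated_by k"
  have finS: "finite subgroups" unfolding subgroups_def by (rule finite_subgroups[OF finite_carrier])
  have "carrier G \<in> subgroups" unfolding subgroups_def using subgroup_self by simp
  then have N0: "N > 0" unfolding N_def using finS card_gt_0_iff by blast
  have w0: "w > 0" unfolding w_def using finite_points pt card_gt_0_iff by blast
  have bad: "finite bad" "card bad \<le> M"
    unfolding bad_def M_def by (rule card_generated_by[OF finite_carrier])+
  have fixersS: "even_fixers \<alpha> \<subseteq> subgroups" for \<alpha> by (auto simp: even_fixers_def subgroups_def)
  have fing: "finite (even_fixers \<alpha>)" for \<alpha> using fixersS finS by (rule finite_subset)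
  have wm: "w * m \<le> N"
  proof -
    have "card (\<Union>\<alpha>\<in>\<Omega>. even_fixers \<alpha>) = (\<Sum>\<alpha>\<in>\<Omega>. card (even_fixers \<alpha>))"
      using finite_points fing even_fixers_disjoint by (intro card_UN_disjoint) blast+
    also have "\<dots> = w * m" using card_even_fixers_eq by (simp add: w_def m_def)
    finally show ?thesis using card_mono[OF finS, of "\<Union>\<alpha>\<in>\<Omega>. even_fixers \<alpha>"] fixersS unfolding N_def by auto
  qed
  define P where "P = {(H, K). subgroup H G \<and> subgroup K G \<and> H <#> K = K <#> H}"
  have "P \<subseteq> bad \<times> subgroups \<union> (subgroups \<times> bad \<union> (\<Union>\<alpha>\<in>\<Omega>. even_fixers \<alpha> \<times> even_fixers \<alpha>))" (is "_ \<subseteq> ?R")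
  proof
    fix p assume "p \<in> P"
    then obtain H K where p: "p = (H, K)" and HK: "subgroup H G" "subgroup K G" "H <#> K = K <#> H"
      by (auto simp: P_def)
    have S: "H \<in> subgroups" "K \<in> subgroups" using HK by (auto simp: subgroups_def)
    consider "H \<in> bad" | "K \<in> bad" | \<alpha> \<beta> where "\<alpha> \<in> \<Omega>" "\<beta> \<in> \<Omega>" "H \<in> even_fixers \<alpha>" "K \<in> even_fixers \<beta>"
      using generated_by_if_not_even_fixer[OF ord D HK(1)] generated_by_if_not_even_fixer[OF ord D HK(2)]
      unfolding bad_def k_def by blast
    then show "p \<in> ?R"
    proof cases
      case 3
      then have "\<beta> = \<alpha>" using even_fixers_not_permutable HK(3) by blast
      then show ?thesis using 3 p by auto
    qed (use S p in auto)
  qed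
  moreover have finR: "finite ?R" using bad finS fing finite_points by auto
  ultimately have "card P \<le> card ?R" by (intro card_mono)
  also have "\<dots> \<le> card (bad \<times> subgroups) + (card (subgroups \<times> bad) + card (\<Union>\<alpha>\<in>\<Omega>. even_fixers \<alpha> \<times> even_fixers \<alpha>))"
    by (meson card_Un_le add_left_mono order_trans)
  also have "card (\<Union>\<alpha>\<in>\<Omega>. even_fixers \<alpha> \<times> even_fixers \<alpha>) \<le> (\<Sum>\<alpha>\<in>\<Omega>. card (even_fixers \<alpha> \<times> even_fixers \<alpha>))"
    by (rule card_UN_le[OF finite_points])
  also have "\<dots> = w * (m * m)" using card_even_fixers_eq by (simp add: w_def m_def card_cartesian_product)
  finally have "card P \<le> card bad * N + (N * card bad + w * (m * m))"
    by (simp only: card_cartesian_product N_def)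
  then have "card P \<le> 2 * (card bad * N) + w * m * m"
    by (simp add: mult.commute mult.left_commute)
  moreover have "card bad * N \<le> M * N" using bad by simp
  ultimately have "card P \<le> 2 * M * N + w * m * m" by linarith
  then have "real (card P) \<le> real (2 * M * N + w * m * m)" by (rule of_nat_mono)
  also have "\<dots> = 2 * real M * real N + real (w * m) * real m" by simp
  also have "\<dots> \<le> 2 * real M * real N + real N * (real N / real w)"
  proof -
    have "real m \<le> real N / real w" using wm w0 by (simp add: field_simps flip: of_nat_mult)
    then have "real (w * m) * real m \<le> real N * (real N / real w)"
      using of_nat_mono[OF wm, where 'a = real] by (intro mult_mono) auto
    then show ?thesis by simp
  qed
  finally have "real (card P) \<le> 2 * real M * real N + real N * (real N / real w)" .
  then have "real (card P) / (real N)\<^sup>2 \<le> (2 * real M * real N + real N * (real N / real w)) / (real N)\<^sup>2"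
    by (intro divide_right_mono) auto
  also have "\<dots> = 2 * real M / real N + 1 / real w"
    using N0 w0 by (simp add: field_simps power2_eq_square)
  finally show ?thesis
    unfolding subgroup_permutability_degree_def P_def[symmetric] subgroups_def[symmetric]
    by (simp add: N_def M_def k_def w_def)
qed

end

section \<open>The field and the function that defines the ovoid\<close>

locale suzuki_field = field R for R :: "('a, 'm) ring_scheme" (structure) +
  fixes n :: nat
  assumes n_pos: "n \<ge> 1"
    and card_carrier: "card (carrier R) = 2 ^ (2 * n + 1)"
begin

abbreviation Fq :: "'a set" where "Fq \<equiv> carrier R"

lemma finite_carrier: "finite Fq"
  using card_carrier by (metis card.infinite power_not_zero zero_neq_numeral)

text \<open>
  If only \<open>\<zero>\<close> were its own negative, then negation would pair off the other elements, and the field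
  would have odd size.
\<close>

lemma char_2:
  assumes x: "x \<in> Fq" shows "x \<oplus> x = \<zero>"
proof -
  have "even (card Fq) \<longleftrightarrow> even (card {y \<in> Fq. \<ominus> y = y})"
    by (rule even_card_iff_even_fixed_points[OF finite_carrier]) auto
  then have "even (card {y \<in> Fq. \<ominus> y = y})" using card_carrier by simp
  then have "{y \<in> Fq. \<ominus> y = y} \<noteq> {\<zero>}" by (metis card_1_singleton_iff odd_one One_nat_def)
  moreover have "\<zero> \<in> {y \<in> Fq. \<ominus> y = y}" by simp
  ultimately obtain y where y: "y \<in> Fq" "\<ominus> y = y" "y \<noteq> \<zero>" by blast
  have yy: "y \<oplus> y = \<zero>" using y by (metis r_neg)
  have "y \<otimes> (x \<oplus> x) = (y \<oplus> y) \<otimes> x" using x y by (simp add: l_distr r_distr)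
  then have "y \<otimes> (x \<oplus> x) = \<zero>" using yy x by simp
  then show ?thesis using integral[of y "x \<oplus> x"] x y by simp
qed

lemma char_2_left:
  assumes "x \<in> Fq" "y \<in> Fq" shows "x \<oplus> (x \<oplus> y) = y"
  using assms char_2[of x] by (simp flip: a_assoc)

lemma eq_if_sum_zero:
  assumes "x \<in> Fq" "y \<in> Fq" "x \<oplus> y = \<zero>" shows "x = y"
  using assms by (metis char_2_left r_zero)

lemma power_card:
  assumes x: "x \<in> Fq" shows "x [^] (2 ^ (2 * n + 1) :: nat) = x"
proof (cases "x = \<zero>")
  case True
  then show ?thesis by (simp add: nat_pow_zero)
next
  case False
  interpret U: group "Multiplicative_Group.mult_of R" by (rule field_mult_group)
  have "x [^]\<^bsub>Multiplicative_Group.mult_of R\<^esub> order (Multiplicative_Group.mult_of R) = \<one>\<^bsub>Multiplicative_Group.mult_of R\<^esub>"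
    using x False by (intro U.pow_order_eq_1) auto
  then have "x [^] (2 ^ (2 * n + 1) - 1 :: nat) = \<one>"
    using order_mult_of[OF finite_carrier] card_carrier by (simp add: order_def Multiplicative_Group.nat_pow_mult_of)
  moreover have "(2 ^ (2 * n + 1) :: nat) = Suc (2 ^ (2 * n + 1) - 1)" by simp
  ultimately show ?thesis using x by (metis l_one nat_pow_Suc)
qed

text \<open>
  The Tits endomorphism \<open>x \<mapsto> x ^ \<theta>\<close>, a square root of the Frobenius endomorphism (\<open>tau_tau\<close>).
\<close>

definition tau :: "'a \<Rightarrow> 'a" ("\<tau>") where
  "\<tau> x = x [^] (2 ^ (n + 1) :: nat)"

lemma tau_closed [simp]: "x \<in> Fq \<Longrightarrow> \<tau> x \<in> Fq"
  by (simp add: tau_def)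

lemma power_two_power_add:
  assumes "x \<in> Fq" "y \<in> Fq"
  shows "(x \<oplus> y) [^] (2 ^ k :: nat) = x [^] (2 ^ k :: nat) \<oplus> y [^] (2 ^ k :: nat)"
proof (induction k)
  case 0 then show ?case using assms by simp
next
  case (Suc k)
  have sq: "z [^] (2 ^ Suc k :: nat) = z [^] (2 ^ k :: nat) \<otimes> z [^] (2 ^ k :: nat)" if "z \<in> Fq" for z
    using that by (simp add: nat_pow_mult mult_2)
  let ?x = "x [^] (2 ^ k :: nat)" and ?y = "y [^] (2 ^ k :: nat)"
  have "(x \<oplus> y) [^] (2 ^ Suc k :: nat) = (?x \<oplus> ?y) \<otimes> (?x \<oplus> ?y)"
    using sq[of "x \<oplus> y"] Suc assms by simp
  also have "\<dots> = ?x \<otimes> ?x \<oplus> ?y \<otimes> ?y"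
    using assms by (simp add: l_distr r_distr a_ac m_ac char_2 char_2_left)
  finally show ?case using sq assms by simp
qed

lemma tau_add [simp]: "x \<in> Fq \<Longrightarrow> y \<in> Fq \<Longrightarrow> \<tau> (x \<oplus> y) = \<tau> x \<oplus> \<tau> y"
  unfolding tau_def by (rule power_two_power_add)

lemma tau_mult [simp]: "x \<in> Fq \<Longrightarrow> y \<in> Fq \<Longrightarrow> \<tau> (x \<otimes> y) = \<tau> x \<otimes> \<tau> y"
  unfolding tau_def by (rule nat_pow_distrib)

lemma tau_zero [simp]: "\<tau> \<zero> = \<zero>" and tau_one [simp]: "\<tau> \<one> = \<one>"
  by (simp_all add: tau_def nat_pow_zero)

lemma tau_tau [simp]:
  assumes "x \<in> Fq" shows "\<tau> (\<tau> x) = x \<otimes> x"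
proof -
  have "\<tau> (\<tau> x) = x [^] (2 ^ (2 * n + 1) * 2 :: nat)"
  proof -
    have "(n + 1) + (n + 1) = Suc (2 * n + 1)" by simp
    then have "(2 ^ (n + 1) * 2 ^ (n + 1) :: nat) = 2 ^ (2 * n + 1) * 2"
      by (metis power_add power_Suc2)
    then show ?thesis unfolding tau_def using assms by (simp only: nat_pow_pow)
  qed
  also have "\<dots> = (x [^] (2 ^ (2 * n + 1) :: nat)) [^] (2 :: nat)"
    using assms by (simp only: nat_pow_pow)
  also have "\<dots> = x \<otimes> x" using power_card[OF assms] assms by (simp add: numeral_2_eq_2)
  finally show ?thesis .
qed

lemma tau_eq_zero_iff: "x \<in> Fq \<Longrightarrow> \<tau> x = \<zero> \<longleftrightarrow> x = \<zero>"
  using tau_tau[of x] integral[of x x] by (metis tau_zero)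

lemmas field_2_simps = a_ac m_ac l_distr r_distr char_2 char_2_left

lemma square_eq_one_iff:
  assumes "x \<in> Fq" "x \<otimes> x = \<one>" shows "x = \<one>"
proof -
  have "(x \<oplus> \<one>) \<otimes> (x \<oplus> \<one>) = \<zero>" using assms by (simp add: field_2_simps)
  then have "x \<oplus> \<one> = \<zero>" using assms integral by blast
  then show ?thesis using assms eq_if_sum_zero by simp
qed

text \<open>
  The lower left entry of \<open>S(a, b)\<close>.  The points of the Tits ovoid are \<open>(0 : 0 : 0 : 1)\<close> and
  \<open>(1 : a : b : ov a b)\<close>.
\<close>

definition ov :: "'a \<Rightarrow> 'a \<Rightarrow> 'a" where
  "ov a b = a \<otimes> a \<otimes> \<tau> a \<oplus> a \<otimes> b \<oplus> \<tau> b"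

lemma ov_closed [simp]: "a \<in> Fq \<Longrightarrow> b \<in> Fq \<Longrightarrow> ov a b \<in> Fq"
  by (simp add: ov_def)

text \<open>
  This identity expresses that reversing the coordinates maps the ovoid to itself (\<open>ov_swap\<close>), and it
  also shows that \<open>ov\<close> vanishes only at the origin.
\<close>

lemma ov_identity:
  assumes "a \<in> Fq" "b \<in> Fq"
  shows "a \<otimes> b \<otimes> \<tau> (ov a b) \<oplus> b \<otimes> b \<otimes> \<tau> b \<oplus> \<tau> a \<otimes> (ov a b \<otimes> ov a b) = ov a b \<otimes> \<tau> (ov a b)"
  using assms unfolding ov_def by (simp add: field_2_simps)

lemma ov_add:
  assumes "a \<in> Fq" "b \<in> Fq" "c \<in> Fq" "d \<in> Fq"
  shows "ov (c \<oplus> a) (d \<oplus> \<tau> c \<otimes> a \<oplus> b) = ov c d \<oplus> (c \<otimes> \<tau> c \<oplus> d) \<otimes> a \<oplus> c \<otimes> b \<oplus> ov a b"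
  using assms unfolding ov_def by (simp add: field_2_simps)

lemma ov_eq_zero:
  assumes "a \<in> Fq" "b \<in> Fq" "ov a b = \<zero>" shows "a = \<zero>" "b = \<zero>"
proof -
  have "b \<otimes> b \<otimes> \<tau> b = \<zero>" using ov_identity[OF assms(1,2)] assms by simp
  then have "b \<otimes> b = \<zero> \<or> \<tau> b = \<zero>" using integral[of "b \<otimes> b" "\<tau> b"] assms by simp
  then show b: "b = \<zero>" using tau_eq_zero_iff[of b] integral[of b b] assms by auto
  then have "a \<otimes> a \<otimes> \<tau> a = \<zero>" using assms by (simp add: ov_def)
  then have "a \<otimes> a = \<zero> \<or> \<tau> a = \<zero>" using integral[of "a \<otimes> a" "\<tau> a"] assms by simp
  then show "a = \<zero>" using tau_eq_zero_iff[of a] integral[of a a] assms by auto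
qed

lemma inv_nonzero [simp]:
  assumes "x \<in> Fq" "x \<noteq> \<zero>"
  shows "inv x \<in> Fq" "inv x \<otimes> x = \<one>" "x \<otimes> inv x = \<one>" "inv x \<noteq> \<zero>"
proof -
  have u: "x \<in> Units R" using assms field_Units by blast
  then show "inv x \<in> Fq" "inv x \<otimes> x = \<one>" "x \<otimes> inv x = \<one>" by simp_all
  then show "inv x \<noteq> \<zero>" using assms by (metis r_null zero_not_one)
qed

lemma tau_inv:
  assumes "x \<in> Fq" "x \<noteq> \<zero>" shows "\<tau> (inv x) = inv (\<tau> x)"
proof -
  have "\<tau> (inv x) \<otimes> \<tau> x = \<one>" using assms by (simp flip: tau_mult)
  then show ?thesis using assms comm_inv_char[of "\<tau> x" "\<tau> (inv x)"] by (simp add: m_comm)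
qed

lemma inv_left:
  assumes "x \<in> Fq" "x \<noteq> \<zero>" "y \<in> Fq"
  shows "inv x \<otimes> (x \<otimes> y) = y" "x \<otimes> (inv x \<otimes> y) = y"
  using assms by (simp_all flip: m_assoc)

lemma ov_swap:
  assumes "a \<in> Fq" "b \<in> Fq" and nz: "ov a b \<noteq> \<zero>"
  defines "i \<equiv> inv (ov a b)"
  shows "ov (i \<otimes> b) (i \<otimes> a) = i"
proof -
  let ?z = "ov a b"
  have i: "i \<in> Fq" "i \<otimes> ?z = \<one>" unfolding i_def using assms by simp_all
  have ti: "\<tau> i \<otimes> \<tau> ?z = \<one>" using i assms by (simp flip: tau_mult)
  have zc: "?z \<in> Fq" using assms by simp
  have iz: "i \<otimes> (?z \<otimes> y) = y" "?z \<otimes> (i \<otimes> y) = y" if "y \<in> Fq" for y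
    using that i zc by (simp_all add: m_comm[of ?z i] flip: m_assoc)
  have tz: "\<tau> i \<otimes> (\<tau> ?z \<otimes> y) = y" if "y \<in> Fq" for y
    using that i zc ti by (simp flip: m_assoc)
  have "i = (i \<otimes> i \<otimes> \<tau> i) \<otimes> (?z \<otimes> \<tau> ?z)"
  proof -
    have "(i \<otimes> i \<otimes> \<tau> i) \<otimes> (?z \<otimes> \<tau> ?z) = i \<otimes> (i \<otimes> ?z) \<otimes> (\<tau> i \<otimes> \<tau> ?z)"
      using i(1) zc by (simp add: m_ac)
    then show ?thesis using i ti by simp
  qed
  also have "\<dots> = (i \<otimes> i \<otimes> \<tau> i) \<otimes> (a \<otimes> b \<otimes> \<tau> ?z \<oplus> b \<otimes> b \<otimes> \<tau> b \<oplus> \<tau> a \<otimes> (?z \<otimes> ?z))"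
    using ov_identity[OF assms(1,2)] by simp
  also have "\<dots> = (\<tau> i \<otimes> \<tau> ?z) \<otimes> (i \<otimes> i \<otimes> (a \<otimes> b)) \<oplus> i \<otimes> i \<otimes> \<tau> i \<otimes> (b \<otimes> b \<otimes> \<tau> b)
      \<oplus> (i \<otimes> ?z) \<otimes> (i \<otimes> ?z) \<otimes> (\<tau> i \<otimes> \<tau> a)"
    using i(1) zc assms(1,2) by (simp add: r_distr m_ac)
  also have "\<dots> = ov (i \<otimes> b) (i \<otimes> a)"
    using i ti assms(1,2) unfolding ov_def[of "i \<otimes> b"] by (simp add: a_ac m_ac)
  finally show ?thesis ..
qed

text \<open>
  The monomials \<open>x ^ (\<theta> + 2)\<close>, \<open>x ^ 2\<close> and \<open>x ^ \<theta>\<close> are linearly independent as functions.  The right-hand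
  side is additive in \<open>x\<close>, whereas replacing \<open>x\<close> by \<open>x + 1\<close> on the left shows that additivity fails by
  \<open>A * (x ^ 2 + x ^ \<theta>)\<close>; and \<open>x ^ 2 + x ^ \<theta>\<close> vanishes only for \<open>x \<in> {0, 1}\<close>, which is not the whole field
  as \<open>n \<ge> 1\<close>.
\<close>

lemma tau_polynomial_identity:
  assumes A: "A \<in> Fq" and B: "B \<in> Fq" and C: "C \<in> Fq"
    and eq: "\<And>x. x \<in> Fq \<Longrightarrow> A \<otimes> (x \<otimes> x \<otimes> \<tau> x) = B \<otimes> (x \<otimes> x) \<oplus> C \<otimes> \<tau> x"
  shows "A = \<zero>" "B = \<zero>" "C = \<zero>"
proof -
  have "\<exists>x\<in>Fq. x \<noteq> \<zero> \<and> x \<noteq> \<one>"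
  proof (rule ccontr)
    assume "\<not> ?thesis"
    then have "Fq \<subseteq> {\<zero>, \<one>}" by blast
    then have "card Fq \<le> card {\<zero>, \<one>}" by (intro card_mono) auto
    also have "\<dots> \<le> 2" by (simp add: card_insert_if)
    finally have "(2::nat) ^ (2 * n + 1) \<le> 2 ^ 1" using card_carrier by simp
    then have "2 * n + 1 \<le> 1" by (metis power_le_imp_le_exp one_less_numeral_iff semiring_norm(76))
    then show False using n_pos by simp
  qed
  then obtain x where x: "x \<in> Fq" "x \<noteq> \<zero>" "x \<noteq> \<one>" by blast
  define s where "s = x \<otimes> x \<oplus> \<tau> x"
  have sc: "s \<in> Fq" unfolding s_def using x by simp
  have s0: "s \<noteq> \<zero>"
  proof
    assume "s = \<zero>"
    then have t: "\<tau> x = x \<otimes> x" unfolding s_def using x by (metis eq_if_sum_zero m_closed tau_closed)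
    have "x \<otimes> x = \<tau> (x \<otimes> x)" using tau_tau[OF x(1)] t by simp
    also have "\<dots> = x \<otimes> x \<otimes> (x \<otimes> x)" using x(1) t by (simp only: tau_mult)
    finally have "x \<otimes> x = x \<otimes> (x \<otimes> (x \<otimes> x))" using x(1) by (simp only: m_assoc m_closed)
    then have "x = x \<otimes> (x \<otimes> x)" using x m_lcancel[of x x "x \<otimes> (x \<otimes> x)"] by simp
    then have "x \<otimes> \<one> = x \<otimes> (x \<otimes> x)" using x by simp
    then have "\<one> = x \<otimes> x" using x m_lcancel[of x \<one> "x \<otimes> x"] by simp
    then show False using square_eq_one_iff[OF x(1)] x(3) by simp
  qed
  have one: "A = B \<oplus> C" using eq[of \<one>] A B C by simp
  have "A \<otimes> s = A \<otimes> ((x \<oplus> \<one>) \<otimes> (x \<oplus> \<one>) \<otimes> \<tau> (x \<oplus> \<one>)) \<oplus> A \<otimes> (x \<otimes> x \<otimes> \<tau> x) \<oplus> A"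
    unfolding s_def using A x by (simp add: field_2_simps)
  also have "A \<otimes> ((x \<oplus> \<one>) \<otimes> (x \<oplus> \<one>) \<otimes> \<tau> (x \<oplus> \<one>)) = B \<otimes> ((x \<oplus> \<one>) \<otimes> (x \<oplus> \<one>)) \<oplus> C \<otimes> \<tau> (x \<oplus> \<one>)"
    using x by (intro eq) simp
  also have "\<dots> \<oplus> A \<otimes> (x \<otimes> x \<otimes> \<tau> x) \<oplus> A
      = B \<otimes> ((x \<oplus> \<one>) \<otimes> (x \<oplus> \<one>)) \<oplus> C \<otimes> \<tau> (x \<oplus> \<one>) \<oplus> (B \<otimes> (x \<otimes> x) \<oplus> C \<otimes> \<tau> x) \<oplus> (B \<oplus> C)"
    using eq[OF x(1)] one by simp
  also have "\<dots> = \<zero>" using B C x by (simp add: field_2_simps)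
  finally show A0: "A = \<zero>" using integral[of A s] A sc s0 by simp
  then have BC: "B = C" using one B C by (metis eq_if_sum_zero)
  have "C \<otimes> s = \<zero>"
    using eq[OF x(1)] A0 BC x C unfolding s_def by (simp add: r_distr)
  then show "C = \<zero>" using integral[of C s] C sc s0 by simp
  then show "B = \<zero>" using BC by simp
qed

text \<open>
  The two coordinate axes give two polynomial identities of the form considered above.  This lemma is
  what makes the stabilizer of the two points \<open>(1 : 0 : 0 : 0)\<close> and \<open>(0 : 0 : 0 : 1)\<close> small.
\<close>

lemma ov_linear_invariance:
  assumes "s \<in> Fq" "t \<in> Fq" "r \<in> Fq" "p \<in> Fq"
    and eq: "\<And>a b. a \<in> Fq \<Longrightarrow> b \<in> Fq \<Longrightarrow>
      ov (s \<otimes> a \<oplus> r \<otimes> b) (t \<otimes> a \<oplus> p \<otimes> b) = ov a b"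
  shows "s = \<one>" "t = \<zero>" "r = \<zero>" "p = \<one>"
proof -
  have 1: "(s \<otimes> s \<otimes> \<tau> s \<oplus> \<one>) \<otimes> (x \<otimes> x \<otimes> \<tau> x) = (s \<otimes> t) \<otimes> (x \<otimes> x) \<oplus> \<tau> t \<otimes> \<tau> x"
    if x: "x \<in> Fq" for x
  proof -
    have "ov (s \<otimes> x) (t \<otimes> x) = ov x \<zero>" using eq[OF x zero_closed] assms x by simp
    then have "ov (s \<otimes> x) (t \<otimes> x) \<oplus> s \<otimes> x \<otimes> (t \<otimes> x) \<oplus> \<tau> (t \<otimes> x) \<oplus> x \<otimes> x \<otimes> \<tau> x
      = ov x \<zero> \<oplus> s \<otimes> x \<otimes> (t \<otimes> x) \<oplus> \<tau> (t \<otimes> x) \<oplus> x \<otimes> x \<otimes> \<tau> x" by simp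
    then show ?thesis using assms(1-4) x by (simp add: ov_def field_2_simps)
  qed
  have s1: "s \<otimes> s \<otimes> \<tau> s \<oplus> \<one> = \<zero>" and "\<tau> t = \<zero>"
    using tau_polynomial_identity[OF _ _ _ 1] assms(1-4) by auto
  then show t: "t = \<zero>" using tau_eq_zero_iff assms by blast
  have 2: "(r \<otimes> r \<otimes> \<tau> r) \<otimes> (x \<otimes> x \<otimes> \<tau> x) = (r \<otimes> p) \<otimes> (x \<otimes> x) \<oplus> (\<tau> p \<oplus> \<one>) \<otimes> \<tau> x"
    if x: "x \<in> Fq" for x
  proof -
    have "ov (r \<otimes> x) (p \<otimes> x) = ov \<zero> x" using eq[OF zero_closed x] assms x by simp
    then have "ov (r \<otimes> x) (p \<otimes> x) \<oplus> r \<otimes> x \<otimes> (p \<otimes> x) \<oplus> \<tau> (p \<otimes> x)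
      = ov \<zero> x \<oplus> r \<otimes> x \<otimes> (p \<otimes> x) \<oplus> \<tau> (p \<otimes> x)" by simp
    then show ?thesis using assms(1-4) x by (simp add: ov_def field_2_simps)
  qed
  have r0: "r \<otimes> r \<otimes> \<tau> r = \<zero>" and p1: "\<tau> p \<oplus> \<one> = \<zero>"
    using tau_polynomial_identity[OF _ _ _ 2] assms(1-4) by auto
  have "r \<otimes> r = \<zero> \<or> \<tau> r = \<zero>" using r0 integral[of "r \<otimes> r" "\<tau> r"] assms by simp
  then show "r = \<zero>" using tau_eq_zero_iff[of r] integral[of r r] assms by auto
  have "\<tau> p = \<one>" using p1 assms(4) eq_if_sum_zero[of "\<tau> p" \<one>] by simp
  then have "\<tau> (\<tau> p) = \<one>" by simp
  then show "p = \<one>" using square_eq_one_iff[OF assms(4)] assms(4) by simp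
  have ss: "s \<otimes> s \<otimes> \<tau> s = \<one>" using s1 assms(1) eq_if_sum_zero[of "s \<otimes> s \<otimes> \<tau> s" \<one>] by simp
  then have "\<tau> (s \<otimes> s \<otimes> \<tau> s) = \<one>" by simp
  then have "(s \<otimes> \<tau> s) \<otimes> (s \<otimes> \<tau> s) = \<one>" using assms(1) by (simp add: m_ac)
  then have "s \<otimes> \<tau> s = \<one>" using square_eq_one_iff[of "s \<otimes> \<tau> s"] assms(1) by simp
  then show "s = \<one>" using ss assms(1) by (simp add: m_assoc)
qed

end

section \<open>Matrices acting on column vectors\<close>

type_synonym 'a vec4 = "'a \<times> 'a \<times> 'a \<times> 'a"

lemma matrix_monoid_simps:
  "carrier (matrix_monoid R d) = {A \<in> carrier_mat d d. \<forall>i<d. \<forall>j<d. A $$ (i, j) \<in> carrier R}"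
  "A \<otimes>\<^bsub>matrix_monoid R d\<^esub> B = mat d d (\<lambda>(i, j).
     finsum R (\<lambda>k. A $$ (i, k) \<otimes>\<^bsub>R\<^esub> B $$ (k, j)) {..<d})"
  "\<one>\<^bsub>matrix_monoid R d\<^esub> = mat d d (\<lambda>(i, j). if i = j then \<one>\<^bsub>R\<^esub> else \<zero>\<^bsub>R\<^esub>)"
  by (simp_all only: matrix_monoid_def partial_object.select_convs monoid.select_convs)

context suzuki_field
begin

abbreviation M :: "'a mat monoid" where "M \<equiv> matrix_monoid R 4"

definition V :: "'a vec4 set" where
  "V = Fq \<times> Fq \<times> Fq \<times> Fq"

lemma in_V_iff [simp]:
  "(x, y, z, w) \<in> V \<longleftrightarrow> x \<in> Fq \<and> y \<in> Fq \<and> z \<in> Fq \<and> w \<in> Fq"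
  by (simp add: V_def)

definition sum4 :: "(nat \<Rightarrow> 'a) \<Rightarrow> 'a" where
  "sum4 f = f 0 \<oplus> (f 1 \<oplus> (f 2 \<oplus> f 3))"

lemma sum4_closed: "(\<And>k. k < 4 \<Longrightarrow> f k \<in> Fq) \<Longrightarrow> sum4 f \<in> Fq"
  by (simp add: sum4_def)

lemma sum4_cong: "(\<And>k. k < 4 \<Longrightarrow> f k = g k) \<Longrightarrow> sum4 f = sum4 g"
  by (simp add: sum4_def)

lemma sum4_distrib:
  assumes "c \<in> Fq" "\<And>k. k < 4 \<Longrightarrow> f k \<in> Fq"
  shows "sum4 f \<otimes> c = sum4 (\<lambda>k. f k \<otimes> c)" "c \<otimes> sum4 f = sum4 (\<lambda>k. c \<otimes> f k)"
  using assms by (simp_all add: sum4_def l_distr r_distr)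

lemma sum4_add:
  assumes "\<And>k. k < 4 \<Longrightarrow> f k \<in> Fq" "\<And>k. k < 4 \<Longrightarrow> g k \<in> Fq"
  shows "sum4 f \<oplus> sum4 g = sum4 (\<lambda>k. f k \<oplus> g k)"
  using assms by (simp add: sum4_def a_ac)

lemma sum4_swap:
  assumes "\<And>k j. k < 4 \<Longrightarrow> j < 4 \<Longrightarrow> p k j \<in> Fq"
  shows "sum4 (\<lambda>j. sum4 (\<lambda>k. p k j)) = sum4 (\<lambda>k. sum4 (\<lambda>j. p k j))"
  unfolding sum4_def[of "\<lambda>j. sum4 (\<lambda>k. p k j)"] sum4_def[of "\<lambda>j. p _ j"]
  using assms by (simp add: sum4_add)

abbreviation mat_mult :: "'a mat \<Rightarrow> 'a mat \<Rightarrow> 'a mat" (infixl "\<cdot>" 70) where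
  "A \<cdot> B \<equiv> A \<otimes>\<^bsub>M\<^esub> B"

definition row_mult :: "'a mat \<Rightarrow> nat \<Rightarrow> 'a vec4 \<Rightarrow> 'a" where
  "row_mult A i = (\<lambda>(x, y, z, w).
    A $$ (i, 0) \<otimes> x \<oplus> (A $$ (i, 1) \<otimes> y \<oplus> (A $$ (i, 2) \<otimes> z \<oplus> A $$ (i, 3) \<otimes> w)))"

definition mv :: "'a mat \<Rightarrow> 'a vec4 \<Rightarrow> 'a vec4" where
  "mv A v = (row_mult A 0 v, row_mult A 1 v, row_mult A 2 v, row_mult A 3 v)"

lemma mat_entry [simp]:
  "A \<in> carrier M \<Longrightarrow> i < 4 \<Longrightarrow> j < 4 \<Longrightarrow> A $$ (i, j) \<in> Fq"
  by (simp only: matrix_monoid_simps mem_Collect_eq)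

lemma mat_dim: "A \<in> carrier M \<Longrightarrow> A \<in> carrier_mat 4 4"
  by (simp only: matrix_monoid_simps mem_Collect_eq)

lemma mat_closedI:
  "A \<in> carrier_mat 4 4 \<Longrightarrow> (\<And>i j. i < 4 \<Longrightarrow> j < 4 \<Longrightarrow> A $$ (i, j) \<in> Fq) \<Longrightarrow> A \<in> carrier M"
  by (simp only: matrix_monoid_simps mem_Collect_eq) blast

lemma less_four_cases: "(i::nat) < 4 \<Longrightarrow> i = 0 \<or> i = 1 \<or> i = 2 \<or> i = 3"
  by linarith

lemma mult_entry:
  assumes "A \<in> carrier M" "B \<in> carrier M" "i < 4" "j < 4"
  shows "(A \<cdot> B) $$ (i, j) = sum4 (\<lambda>k. A $$ (i, k) \<otimes> B $$ (k, j))"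
proof -
  have four: "{..<4::nat} = {0, 1, 2, 3}" by auto
  have "(A \<cdot> B) $$ (i, j) = finsum R (\<lambda>k. A $$ (i, k) \<otimes> B $$ (k, j)) {0, 1, 2, 3}"
    unfolding matrix_monoid_simps(2) four using assms(3,4) by (simp only: index_mat case_prod_conv)
  also have "\<dots> = sum4 (\<lambda>k. A $$ (i, k) \<otimes> B $$ (k, j))"
    using assms by (simp add: finsum_insert Pi_def sum4_def)
  finally show ?thesis .
qed

lemma mult_closed:
  assumes "A \<in> carrier M" "B \<in> carrier M" shows "A \<cdot> B \<in> carrier M"
proof -
  have "A \<cdot> B \<in> carrier_mat 4 4" unfolding matrix_monoid_simps by (rule mat_carrier)
  moreover have "(A \<cdot> B) $$ (i, j) \<in> Fq" if "i < 4" "j < 4" for i j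
    using assms that by (simp add: mult_entry sum4_closed)
  ultimately show ?thesis by (rule mat_closedI)
qed

lemma one_closed_mat: "\<one>\<^bsub>M\<^esub> \<in> carrier M"
  by (rule mat_closedI) (auto simp: matrix_monoid_simps(3))

lemma row_mult_closed [simp]: "A \<in> carrier M \<Longrightarrow> v \<in> V \<Longrightarrow> i < 4 \<Longrightarrow> row_mult A i v \<in> Fq"
  by (cases v) (auto simp: row_mult_def)

lemma mv_closed: "A \<in> carrier M \<Longrightarrow> v \<in> V \<Longrightarrow> mv A v \<in> V"
  by (simp add: mv_def)

lemma row_mult_mult:
  assumes "A \<in> carrier M" "B \<in> carrier M" "v \<in> V" "i < 4"
  shows "row_mult (A \<cdot> B) i v = row_mult A i (mv B v)"
proof -
  obtain x y z w where v: "v = (x, y, z, w)" by (cases v)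
  define c :: "nat \<Rightarrow> 'a" where "c k = (if k = 0 then x else if k = 1 then y else if k = 2 then z else w)" for k
  have row: "row_mult D k v = sum4 (\<lambda>j. D $$ (k, j) \<otimes> c j)" for D k
    by (simp add: row_mult_def sum4_def v c_def)
  have c: "c k \<in> Fq" for k using assms(3) by (simp add: v c_def)
  have A: "A $$ (i, j) \<in> Fq" if "j < 4" for j using mat_entry[OF assms(1,4) that] .
  have B: "B $$ (k, j) \<in> Fq" if "k < 4" "j < 4" for k j using mat_entry[OF assms(2) that] .
  have "row_mult (A \<cdot> B) i v = sum4 (\<lambda>j. sum4 (\<lambda>k. A $$ (i, k) \<otimes> (B $$ (k, j) \<otimes> c j)))"
    unfolding row
  proof (rule sum4_cong)
    fix j :: nat assume j: "j < 4"
    have "(A \<cdot> B) $$ (i, j) \<otimes> c j = sum4 (\<lambda>k. A $$ (i, k) \<otimes> B $$ (k, j) \<otimes> c j)"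
      unfolding mult_entry[OF assms(1,2,4) j] using A B c j by (intro sum4_distrib) auto
    also have "\<dots> = sum4 (\<lambda>k. A $$ (i, k) \<otimes> (B $$ (k, j) \<otimes> c j))"
      using A B c j by (intro sum4_cong m_assoc) auto
    finally show "(A \<cdot> B) $$ (i, j) \<otimes> c j = sum4 (\<lambda>k. A $$ (i, k) \<otimes> (B $$ (k, j) \<otimes> c j))" .
  qed
  also have "\<dots> = sum4 (\<lambda>k. sum4 (\<lambda>j. A $$ (i, k) \<otimes> (B $$ (k, j) \<otimes> c j)))"
    using A B c by (intro sum4_swap) auto
  also have "\<dots> = sum4 (\<lambda>k. A $$ (i, k) \<otimes> row_mult B k v)"
    unfolding row using A B c by (intro sum4_cong sum4_distrib(2)[symmetric]) auto
  also have "\<dots> = row_mult A i (mv B v)" by (simp add: row_mult_def sum4_def mv_def)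
  finally show ?thesis .
qed

lemma mv_mult:
  "A \<in> carrier M \<Longrightarrow> B \<in> carrier M \<Longrightarrow> v \<in> V \<Longrightarrow> mv (A \<cdot> B) v = mv A (mv B v)"
  by (simp add: mv_def row_mult_mult)

lemma mv_one: "v \<in> V \<Longrightarrow> mv \<one>\<^bsub>M\<^esub> v = v"
  by (cases v) (auto simp: mv_def row_mult_def matrix_monoid_simps(3))

definition e1 :: "'a vec4" where "e1 = (\<one>, \<zero>, \<zero>, \<zero>)"
definition e2 :: "'a vec4" where "e2 = (\<zero>, \<one>, \<zero>, \<zero>)"
definition e3 :: "'a vec4" where "e3 = (\<zero>, \<zero>, \<one>, \<zero>)"
definition e4 :: "'a vec4" where "e4 = (\<zero>, \<zero>, \<zero>, \<one>)"

lemma e_in_V [simp]: "e1 \<in> V" "e2 \<in> V" "e3 \<in> V" "e4 \<in> V"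
  by (auto simp: e1_def e2_def e3_def e4_def)

lemma mv_columns:
  assumes "A \<in> carrier M"
  shows "mv A e1 = (A $$ (0, 0), A $$ (1, 0), A $$ (2, 0), A $$ (3, 0))"
    "mv A e2 = (A $$ (0, 1), A $$ (1, 1), A $$ (2, 1), A $$ (3, 1))"
    "mv A e3 = (A $$ (0, 2), A $$ (1, 2), A $$ (2, 2), A $$ (3, 2))"
    "mv A e4 = (A $$ (0, 3), A $$ (1, 3), A $$ (2, 3), A $$ (3, 3))"
  using assms by (simp_all add: mv_def row_mult_def e1_def e2_def e3_def e4_def)

text \<open>
  Matrices are from now on compared through their action on column vectors, which reduces
  products to compositions.
\<close>

lemma mat_eqI_basis:
  assumes A: "A \<in> carrier M" and B: "B \<in> carrier M"
    and "mv A e1 = mv B e1" "mv A e2 = mv B e2" "mv A e3 = mv B e3" "mv A e4 = mv B e4"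
  shows "A = B"
proof (rule eq_matI)
  fix i j assume "i < dim_row B" "j < dim_col B"
  then have "i < 4" "j < 4" using mat_dim[OF B] by auto
  then show "A $$ (i, j) = B $$ (i, j)"
    using assms(3-6) unfolding mv_columns[OF A] mv_columns[OF B]
    by (auto dest!: less_four_cases)
qed (use mat_dim[OF A] mat_dim[OF B] in auto)

lemma mat_eqI:
  assumes "A \<in> carrier M" "B \<in> carrier M" "\<And>v. v \<in> V \<Longrightarrow> mv A v = mv B v"
  shows "A = B"
  using assms by (intro mat_eqI_basis) auto

lemma monoid_M: "monoid M"
proof (rule monoidI)
  fix A B C assume "A \<in> carrier M" "B \<in> carrier M" "C \<in> carrier M"
  then show "A \<cdot> B \<cdot> C = A \<cdot> (B \<cdot> C)"
    by (intro mat_eqI) (simp_all add: mult_closed mv_mult mv_closed)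
next
  fix A assume "A \<in> carrier M"
  then show "\<one>\<^bsub>M\<^esub> \<cdot> A = A" "A \<cdot> \<one>\<^bsub>M\<^esub> = A"
    by (auto intro!: mat_eqI simp: mult_closed mv_mult mv_closed mv_one one_closed_mat)
qed (auto intro: mult_closed one_closed_mat)

lemma group_GL: "group (GL 4 R)"
  unfolding GL_def by (rule monoid.units_group[OF monoid_M])

definition scal :: "'a \<Rightarrow> 'a vec4 \<Rightarrow> 'a vec4" where
  "scal c = (\<lambda>(x, y, z, w). (c \<otimes> x, c \<otimes> y, c \<otimes> z, c \<otimes> w))"

lemma scal_closed: "c \<in> Fq \<Longrightarrow> v \<in> V \<Longrightarrow> scal c v \<in> V"
  by (cases v) (auto simp: scal_def)

lemma scal_scal: "c \<in> Fq \<Longrightarrow> d \<in> Fq \<Longrightarrow> v \<in> V \<Longrightarrow> scal c (scal d v) = scal (c \<otimes> d) v"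
  by (cases v) (auto simp: scal_def m_assoc)

lemma scal_one: "v \<in> V \<Longrightarrow> scal \<one> v = v"
  by (cases v) (auto simp: scal_def)

lemma mv_scal: "A \<in> carrier M \<Longrightarrow> c \<in> Fq \<Longrightarrow> v \<in> V \<Longrightarrow> mv A (scal c v) = scal c (mv A v)"
  by (cases v) (auto simp: scal_def mv_def row_mult_def r_distr m_lcomm)

text \<open>
  The alternating form whose Gram matrix is \<open>T\<close>; signs do not matter in characteristic \<open>2\<close>.
\<close>

definition form :: "'a vec4 \<Rightarrow> 'a vec4 \<Rightarrow> 'a" where
  "form = (\<lambda>(x, y, z, w) (x', y', z', w'). x \<otimes> w' \<oplus> y \<otimes> z' \<oplus> z \<otimes> y' \<oplus> w \<otimes> x')"

abbreviation S :: "'a \<Rightarrow> 'a \<Rightarrow> 'a mat" where "S \<equiv> suzuki_S R n"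
abbreviation C :: "'a \<Rightarrow> 'a mat" where "C \<equiv> suzuki_C R n"
abbreviation T :: "'a mat" where "T \<equiv> suzuki_T R"

lemma S_mat:
  assumes "a \<in> Fq" "b \<in> Fq"
  shows "S a b \<in> carrier M"
    and "x \<in> Fq \<Longrightarrow> y \<in> Fq \<Longrightarrow> z \<in> Fq \<Longrightarrow> w \<in> Fq \<Longrightarrow>
      mv (S a b) (x, y, z, w) =
      (x, a \<otimes> x \<oplus> y, b \<otimes> x \<oplus> (\<tau> a \<otimes> y \<oplus> z),
       ov a b \<otimes> x \<oplus> ((a \<otimes> \<tau> a \<oplus> b) \<otimes> y \<oplus> (a \<otimes> z \<oplus> w)))"
proof -
  have pw: "a [^] (2 + 2 ^ (n + 1) :: nat) = a \<otimes> a \<otimes> \<tau> a" "a [^] (1 + 2 ^ (n + 1) :: nat) = a \<otimes> \<tau> a"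
    using assms nat_pow_mult[of a 2 "2 ^ (n + 1)"] nat_pow_mult[of a 1 "2 ^ (n + 1)"]
    by (simp_all add: tau_def numeral_2_eq_2)
  have S_eq: "S a b = mat_of_rows_list 4
     [[\<one>, \<zero>, \<zero>, \<zero>], [a, \<one>, \<zero>, \<zero>], [b, \<tau> a, \<one>, \<zero>], [ov a b, a \<otimes> \<tau> a \<oplus> b, a, \<one>]]"
    unfolding suzuki_S_def Let_def pw ov_def unfolding tau_def ..
  show "S a b \<in> carrier M"
    unfolding S_eq using assms
    by (intro mat_closedI) (auto simp: mat_of_rows_list_def dest!: less_four_cases)
  assume "x \<in> Fq" "y \<in> Fq" "z \<in> Fq" "w \<in> Fq"
  then show "mv (S a b) (x, y, z, w) =
      (x, a \<otimes> x \<oplus> y, b \<otimes> x \<oplus> (\<tau> a \<otimes> y \<oplus> z),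
       ov a b \<otimes> x \<oplus> ((a \<otimes> \<tau> a \<oplus> b) \<otimes> y \<oplus> (a \<otimes> z \<oplus> w)))"
    unfolding S_eq mv_def row_mult_def using assms by (simp add: mat_of_rows_list_def)
qed

lemma T_mat:
  shows "T \<in> carrier M"
    and "x \<in> Fq \<Longrightarrow> y \<in> Fq \<Longrightarrow> z \<in> Fq \<Longrightarrow> w \<in> Fq \<Longrightarrow>
      mv T (x, y, z, w) = (w, z, y, x)"
proof -
  show "T \<in> carrier M"
    unfolding suzuki_T_def
    by (intro mat_closedI) (auto simp: mat_of_rows_list_def dest!: less_four_cases)
  assume "x \<in> Fq" "y \<in> Fq" "z \<in> Fq" "w \<in> Fq"
  then show "mv T (x, y, z, w) = (w, z, y, x)"
    unfolding suzuki_T_def mv_def row_mult_def by (simp add: mat_of_rows_list_def)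
qed

lemma pow_nonzero: "x \<in> Fq \<Longrightarrow> x \<noteq> \<zero> \<Longrightarrow> x [^] (k::nat) \<noteq> \<zero>"
  by (induction k) (auto dest: integral)

text \<open>
  The power \<open>l ^ (\<theta> / 2)\<close>, which is the preimage of \<open>l\<close> under \<open>\<tau>\<close>.
\<close>

definition half :: "'a \<Rightarrow> 'a" where "half l = l [^] (2 ^ n :: nat)"

lemma half_closed [simp]: "l \<in> Fq \<Longrightarrow> half l \<in> Fq"
  by (simp add: half_def)

lemma half_nonzero: "l \<in> Fq \<Longrightarrow> l \<noteq> \<zero> \<Longrightarrow> half l \<noteq> \<zero>"
  unfolding half_def by (rule pow_nonzero)

lemma half_mult: "k \<in> Fq \<Longrightarrow> l \<in> Fq \<Longrightarrow> half k \<otimes> half l = half (k \<otimes> l)"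
  unfolding half_def by (rule nat_pow_distrib[symmetric])

lemma tau_half:
  assumes "l \<in> Fq" shows "\<tau> (half l) = l"
proof -
  have "2 ^ n * 2 ^ (n + 1) = (2 ^ (2 * n + 1) :: nat)"
    by (metis power_add mult_2 add.assoc)
  then show ?thesis unfolding tau_def half_def using assms power_card by (simp only: nat_pow_pow)
qed

lemma C_mat:
  assumes l: "l \<in> Fq" "l \<noteq> \<zero>"
  defines "u \<equiv> half l"
  shows "C l \<in> carrier M"
    and "x \<in> Fq \<Longrightarrow> y \<in> Fq \<Longrightarrow> z \<in> Fq \<Longrightarrow> w \<in> Fq \<Longrightarrow>
      mv (C l) (x, y, z, w) = (l \<otimes> u \<otimes> x, u \<otimes> y, inv u \<otimes> z, inv (l \<otimes> u) \<otimes> w)"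
proof -
  have u: "u \<in> Fq" "u \<noteq> \<zero>" unfolding u_def using l half_nonzero by auto
  have lu: "l \<otimes> u \<in> Fq" "l \<otimes> u \<noteq> \<zero>" using l u integral by auto
  have h: "(2 ^ n :: int) = int (2 ^ n)" "1 + (2 ^ n :: int) = int (1 + 2 ^ n)" by simp_all
  have p1: "l [^] (1 + 2 ^ n :: nat) = l \<otimes> u"
    unfolding u_def half_def plus_1_eq_Suc by (rule nat_pow_Suc2[OF l(1)])
  have pw: "l [^] (1 + 2 ^ n :: int) = l \<otimes> u" "l [^] (2 ^ n :: int) = u"
    unfolding h(2) int_pow_int p1 by (simp, unfold h(1) int_pow_int u_def half_def, simp)
  have neg: "- (2 ^ n :: int) < 0" "- 1 - (2 ^ n :: int) < 0"
    "nat (- (- (2 ^ n :: int))) = 2 ^ n" "nat (- (- 1 - (2 ^ n :: int))) = 1 + 2 ^ n"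
  proof -
    have "(0::int) < 2 ^ n" by simp
    then show "- (2 ^ n :: int) < 0" "- 1 - (2 ^ n :: int) < 0" by linarith+
    show "nat (- (- (2 ^ n :: int))) = 2 ^ n" by (simp add: nat_power_eq)
    have "- (- 1 - (2 ^ n :: int)) = int (1 + 2 ^ n)" by simp
    then show "nat (- (- 1 - (2 ^ n :: int))) = 1 + 2 ^ n" by (metis nat_int)
  qed
  have pn: "l [^] (- (2 ^ n) :: int) = inv u" "l [^] (- 1 - 2 ^ n :: int) = inv (l \<otimes> u)"
    unfolding int_pow_def2 neg(3,4) p1 using neg(1,2) by (simp_all add: u_def half_def)
  have C_eq: "C l = mat_of_rows_list 4
     [[l \<otimes> u, \<zero>, \<zero>, \<zero>], [\<zero>, u, \<zero>, \<zero>], [\<zero>, \<zero>, inv u, \<zero>], [\<zero>, \<zero>, \<zero>, inv (l \<otimes> u)]]"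
    unfolding suzuki_C_def Let_def pw pn ..
  show "C l \<in> carrier M"
    unfolding C_eq using l u lu inv_nonzero(1)[OF lu] inv_nonzero(1)[OF u]
    by (intro mat_closedI) (auto simp: mat_of_rows_list_def dest!: less_four_cases)
  assume "x \<in> Fq" "y \<in> Fq" "z \<in> Fq" "w \<in> Fq"
  then show "mv (C l) (x, y, z, w) =
      (l \<otimes> u \<otimes> x, u \<otimes> y, inv u \<otimes> z, inv (l \<otimes> u) \<otimes> w)"
    unfolding C_eq mv_def row_mult_def using l u lu inv_nonzero(1)[OF lu] inv_nonzero(1)[OF u]
    by (simp add: mat_of_rows_list_def)
qed

end

section \<open>The generators preserve the ovoid and an alternating form\<close>

context suzuki_field
begin

definition ovpt :: "'a \<Rightarrow> 'a \<Rightarrow> 'a vec4" where "ovpt a b = (\<one>, a, b, ov a b)"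

definition ovoid :: "'a vec4 set" where
  "ovoid = insert e4 {ovpt a b | a b. a \<in> Fq \<and> b \<in> Fq}"

definition cone :: "'a vec4 set" where
  "cone = {scal c v | c v. c \<in> Fq - {\<zero>} \<and> v \<in> ovoid}"

lemma ovpt_closed [simp]: "a \<in> Fq \<Longrightarrow> b \<in> Fq \<Longrightarrow> ovpt a b \<in> V"
  by (simp add: ovpt_def)

lemma ovoid_subset: "ovoid \<subseteq> V"
  unfolding ovoid_def using ovpt_closed e_in_V by blast

lemma ovpt_in_ovoid: "a \<in> Fq \<Longrightarrow> b \<in> Fq \<Longrightarrow> ovpt a b \<in> ovoid"
  by (auto simp: ovoid_def)

lemma coneI: "c \<in> Fq \<Longrightarrow> c \<noteq> \<zero> \<Longrightarrow> v \<in> ovoid \<Longrightarrow> scal c v \<in> cone"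
  unfolding cone_def by blast

lemma ovoid_subset_cone: "ovoid \<subseteq> cone"
proof
  fix v assume v: "v \<in> ovoid"
  then have "scal \<one> v = v" using ovoid_subset by (intro scal_one) blast
  then show "v \<in> cone" using coneI[OF one_closed one_not_zero v] by simp
qed

lemma e4_in_cone: "e4 \<in> cone"
  using ovoid_subset_cone by (auto simp: ovoid_def)

text \<open>
  The form is recorded together with the ovoid because it confines a matrix that fixes
  \<open>e1\<close> and \<open>e4\<close> to act on \<open>e2\<close> and \<open>e3\<close> within their span.
\<close>

definition preserving :: "'a mat set" where
  "preserving = {A \<in> carrier M. (\<forall>v\<in>ovoid. mv A v \<in> cone) \<and> (\<forall>v\<in>V. \<forall>w\<in>V. form (mv A v) (mv A w) = form v w)}"

lemma preserving_cone:
  assumes "A \<in> preserving" "v \<in> cone" shows "mv A v \<in> cone"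
proof -
  obtain c u where u: "v = scal c u" "c \<in> Fq" "c \<noteq> \<zero>" "u \<in> ovoid" using assms(2) by (auto simp: cone_def)
  have A: "A \<in> carrier M" "mv A u \<in> cone" using assms(1) u(4) by (auto simp: preserving_def)
  obtain d w where w: "mv A u = scal d w" "d \<in> Fq" "d \<noteq> \<zero>" "w \<in> ovoid" using A(2) by (auto simp: cone_def)
  have "mv A v = scal (c \<otimes> d) w"
    using u w A(1) subsetD[OF ovoid_subset u(4)] subsetD[OF ovoid_subset w(4)]
    by (simp add: mv_scal scal_scal)
  moreover have "scal (c \<otimes> d) w \<in> cone"
    using u w integral[of c d] by (intro coneI) auto
  ultimately show ?thesis by simp
qed

lemma preserving_mult:
  assumes "A \<in> preserving" "B \<in> preserving" shows "A \<cdot> B \<in> preserving"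
proof -
  have AB: "A \<in> carrier M" "B \<in> carrier M" using assms by (auto simp: preserving_def)
  have "mv (A \<cdot> B) v \<in> cone" if "v \<in> ovoid" for v
  proof -
    have "mv (A \<cdot> B) v = mv A (mv B v)" using that ovoid_subset by (intro mv_mult[OF AB]) blast
    moreover have "mv A (mv B v) \<in> cone"
      using that ovoid_subset_cone by (intro preserving_cone[OF assms(1)] preserving_cone[OF assms(2)]) blast
    ultimately show ?thesis by simp
  qed
  moreover have "form (mv (A \<cdot> B) v) (mv (A \<cdot> B) w) = form v w" if "v \<in> V" "w \<in> V" for v w
    using that AB assms by (simp add: mv_mult mv_closed preserving_def)
  ultimately show ?thesis using mult_closed[OF AB] by (simp add: preserving_def)
qed

lemma S_ovpt:
  assumes "a \<in> Fq" "b \<in> Fq" "c \<in> Fq" "d \<in> Fq"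
  shows "mv (S c d) (ovpt a b) = ovpt (c \<oplus> a) (d \<oplus> \<tau> c \<otimes> a \<oplus> b)"
  unfolding ovpt_def ov_add[OF assms] using assms by (simp add: S_mat(2) a_assoc)

lemma S_e4:
  assumes "c \<in> Fq" "d \<in> Fq" shows "mv (S c d) e4 = e4"
  using assms by (simp add: e4_def S_mat(2))

lemma ovpt_zero: "ovpt \<zero> \<zero> = e1"
  by (simp add: ovpt_def e1_def ov_def)

lemma S_preserving:
  assumes a: "a \<in> Fq" "b \<in> Fq"
  shows "S a b \<in> preserving"
proof -
  have "mv (S a b) v \<in> cone" if v: "v \<in> ovoid" for v
  proof (cases "v = e4")
    case True
    then show ?thesis using S_e4[OF a] e4_in_cone by simp
  next
    case False
    then obtain c d where cd: "v = ovpt c d" "c \<in> Fq" "d \<in> Fq" using v by (auto simp: ovoid_def)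
    have "ovpt (a \<oplus> c) (b \<oplus> \<tau> a \<otimes> c \<oplus> d) \<in> ovoid" using a cd by (intro ovpt_in_ovoid) auto
    then show ?thesis using S_ovpt[OF cd(2,3) a] ovoid_subset_cone cd(1) by auto
  qed
  moreover have "form (mv (S a b) v) (mv (S a b) w) = form v w"
    if vw: "v \<in> V" "w \<in> V" for v w
  proof -
    obtain x y z t where v: "v = (x, y, z, t)" by (cases v)
    obtain x' y' z' t' where w: "w = (x', y', z', t')" by (cases w)
    have c: "x \<in> Fq" "y \<in> Fq" "z \<in> Fq" "t \<in> Fq"
      "x' \<in> Fq" "y' \<in> Fq" "z' \<in> Fq" "t' \<in> Fq" using vw v w by auto
    define f where "f = ov a b"
    define g where "g = \<tau> a"
    have fg: "f \<in> Fq" "g \<in> Fq" unfolding f_def g_def using a by auto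
    show ?thesis
      unfolding v w S_mat(2)[OF a c(1-4)] S_mat(2)[OF a c(5-8)] form_def f_def[symmetric] g_def[symmetric]
      using a fg c by (simp add: field_2_simps)
  qed
  ultimately show ?thesis using S_mat(1)[OF a] by (simp add: preserving_def)
qed

lemma T_preserving: "T \<in> preserving"
proof -
  have "mv T v \<in> cone" if v: "v \<in> ovoid" for v
  proof (cases "v = e4")
    case True
    then have "mv T v = e1" by (simp add: e4_def e1_def T_mat(2))
    then show ?thesis using ovpt_in_ovoid[of \<zero> \<zero>] ovpt_zero ovoid_subset_cone True by auto
  next
    case False
    then obtain a b where ab: "v = ovpt a b" "a \<in> Fq" "b \<in> Fq" using v by (auto simp: ovoid_def)
    have T: "mv T v = (ov a b, b, a, \<one>)" using ab by (simp add: ovpt_def T_mat(2))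
    show ?thesis
    proof (cases "ov a b = \<zero>")
      case True
      then have "mv T v = e4" using T ov_eq_zero[OF ab(2,3)] by (simp add: e4_def)
      then show ?thesis using e4_in_cone by simp
    next
      case nz: False
      define i where "i = inv (ov a b)"
      have i: "i \<in> Fq" unfolding i_def using nz ab by simp
      \<comment> \<open>divide the reversed vector by its first coordinate\<close>
      have "mv T v = scal (ov a b) (ovpt (i \<otimes> b) (i \<otimes> a))"
        unfolding T ovpt_def scal_def i_def ov_swap[OF ab(2,3) nz]
        using ab nz by (simp add: inv_left)
      moreover have "scal (ov a b) (ovpt (i \<otimes> b) (i \<otimes> a)) \<in> cone"
        using ab i nz by (intro coneI ovpt_in_ovoid) auto
      ultimately show ?thesis by simp
    qed
  qed
  moreover have "form (mv T v) (mv T w) = form v w" if vw: "v \<in> V" "w \<in> V" for v w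
    using vw by (cases v; cases w) (auto simp: form_def T_mat(2) a_ac m_comm)
  ultimately show ?thesis using T_mat(1) by (simp add: preserving_def)
qed

lemma C_preserving:
  assumes l: "l \<in> Fq" "l \<noteq> \<zero>"
  shows "C l \<in> preserving"
proof -
  define u where "u = half l"
  have u: "u \<in> Fq" "u \<noteq> \<zero>" "\<tau> u = l" unfolding u_def using l half_nonzero tau_half by auto
  note mvC = C_mat(2)[OF l, folded u_def]
  define i where "i = inv l"
  define j where "j = inv u"
  have i: "i \<in> Fq" "l \<otimes> i = \<one>" "i \<otimes> l = \<one>" unfolding i_def using l by auto
  have j: "j \<in> Fq" "u \<otimes> j = \<one>" "j \<otimes> u = \<one>" "j \<noteq> \<zero>" unfolding j_def using u by auto
  have il: "i \<otimes> (l \<otimes> x) = x" "l \<otimes> (i \<otimes> x) = x" and ju: "j \<otimes> (u \<otimes> x) = x" "u \<otimes> (j \<otimes> x) = x"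
    if "x \<in> Fq" for x using that i j l(1) u(1) by (simp_all flip: m_assoc)
  have ij: "inv (l \<otimes> u) = i \<otimes> j"
    using i j l u by (intro comm_inv_char) (simp_all add: m_ac il ju)
  have tj: "\<tau> j = i" unfolding j_def i_def using tau_inv[OF u(1,2)] u(3) by simp
  have ti: "\<tau> i = j \<otimes> j" using tau_tau[OF j(1)] tj by simp
  have lu: "l \<otimes> u \<in> Fq" "l \<otimes> u \<noteq> \<zero>" using l u integral by auto
  have "mv (C l) v \<in> cone" if v: "v \<in> ovoid" for v
  proof (cases "v = e4")
    case True
    then have "mv (C l) v = scal (i \<otimes> j) e4"
      using l u i j by (simp add: e4_def scal_def mvC ij)
    moreover have "i \<otimes> j \<in> Fq" "i \<otimes> j \<noteq> \<zero>" using ij lu i j by (auto simp flip: ij)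
    ultimately show ?thesis by (auto intro!: coneI simp: ovoid_def)
  next
    case False
    then obtain a b where ab: "v = ovpt a b" "a \<in> Fq" "b \<in> Fq" using v by (auto simp: ovoid_def)
    have "mv (C l) v = (l \<otimes> u, u \<otimes> a, j \<otimes> b, i \<otimes> j \<otimes> ov a b)"
      using ab l u by (simp add: ovpt_def mvC ij j_def)
    also have "\<dots> = scal (l \<otimes> u) (ovpt (i \<otimes> a) (i \<otimes> j \<otimes> j \<otimes> b))"
    proof -
      have "ov (i \<otimes> a) (i \<otimes> j \<otimes> j \<otimes> b) = i \<otimes> (i \<otimes> (j \<otimes> (j \<otimes> ov a b)))"
        using ab i(1) j(1) by (simp add: ov_def ti tj r_distr m_ac)
      moreover have "l \<otimes> u \<otimes> (i \<otimes> (i \<otimes> (j \<otimes> (j \<otimes> y)))) = i \<otimes> (j \<otimes> y)" if "y \<in> Fq" for y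
      proof -
        have "l \<otimes> u \<otimes> (i \<otimes> (i \<otimes> (j \<otimes> (j \<otimes> y)))) = l \<otimes> (i \<otimes> (u \<otimes> (j \<otimes> (i \<otimes> (j \<otimes> y)))))"
          using that i(1) j(1) l(1) u(1) by (simp add: m_ac)
        then show ?thesis using that i(1) j(1) by (simp add: il ju)
      qed
      moreover have "l \<otimes> u \<otimes> (i \<otimes> a) = u \<otimes> a"
      proof -
        have "l \<otimes> u \<otimes> (i \<otimes> a) = l \<otimes> (i \<otimes> (u \<otimes> a))" using ab i(1) l(1) u(1) by (simp add: m_ac)
        then show ?thesis using ab u by (simp add: il)
      qed
      moreover have "l \<otimes> u \<otimes> (i \<otimes> j \<otimes> j \<otimes> b) = j \<otimes> b"
      proof -
        have "l \<otimes> u \<otimes> (i \<otimes> j \<otimes> j \<otimes> b) = l \<otimes> (i \<otimes> (u \<otimes> (j \<otimes> (j \<otimes> b))))"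
          using ab i(1) j(1) l(1) u(1) by (simp add: m_ac)
        then show ?thesis using ab i(1) j(1) by (simp add: il ju)
      qed
      ultimately show ?thesis using ab i(1) j(1) l(1) u(1) by (simp add: scal_def ovpt_def m_assoc)
    qed
    also have "\<dots> \<in> cone" using lu ab i j by (intro coneI ovpt_in_ovoid) auto
    finally show ?thesis .
  qed
  moreover have "form (mv (C l) v) (mv (C l) w) = form v w" if vw: "v \<in> V" "w \<in> V" for v w
  proof -
    obtain x y z t where v: "v = (x, y, z, t)" by (cases v)
    obtain x' y' z' t' where w: "w = (x', y', z', t')" by (cases w)
    have c: "x \<in> Fq" "y \<in> Fq" "z \<in> Fq" "t \<in> Fq"
      "x' \<in> Fq" "y' \<in> Fq" "z' \<in> Fq" "t' \<in> Fq" using vw v w by auto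
    have lij: "l \<otimes> u \<otimes> p \<otimes> (i \<otimes> j \<otimes> q) = p \<otimes> q" "i \<otimes> j \<otimes> p \<otimes> (l \<otimes> u \<otimes> q) = p \<otimes> q"
      "u \<otimes> p \<otimes> (j \<otimes> q) = p \<otimes> q" "j \<otimes> p \<otimes> (u \<otimes> q) = p \<otimes> q" if pq: "p \<in> Fq" "q \<in> Fq" for p q
    proof -
      have "l \<otimes> (i \<otimes> (u \<otimes> (j \<otimes> (p \<otimes> q)))) = p \<otimes> q" "u \<otimes> (j \<otimes> (p \<otimes> q)) = p \<otimes> q"
        using pq i(1) j(1) by (simp_all add: il ju)
      then show "l \<otimes> u \<otimes> p \<otimes> (i \<otimes> j \<otimes> q) = p \<otimes> q" "i \<otimes> j \<otimes> p \<otimes> (l \<otimes> u \<otimes> q) = p \<otimes> q"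
        "u \<otimes> p \<otimes> (j \<otimes> q) = p \<otimes> q" "j \<otimes> p \<otimes> (u \<otimes> q) = p \<otimes> q"
        using pq i(1) j(1) l(1) u(1) by (simp_all add: m_ac)
    qed
    show ?thesis unfolding v w mvC[OF c(1-4)] mvC[OF c(5-8)] form_def ij j_def[symmetric]
      using c by (simp add: lij)
  qed
  ultimately show ?thesis using C_mat(1)[OF l] by (simp add: preserving_def)
qed

lemma S_mult:
  assumes "a \<in> Fq" "b \<in> Fq" "c \<in> Fq" "d \<in> Fq"
  shows "S a b \<cdot> S c d = S (a \<oplus> c) (b \<oplus> \<tau> a \<otimes> c \<oplus> d)"
proof (rule mat_eqI)
  fix v assume "v \<in> V"
  then obtain x y z w where v: "v = (x, y, z, w)" "x \<in> Fq" "y \<in> Fq" "z \<in> Fq" "w \<in> Fq"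
    by (cases v) auto
  show "mv (S a b \<cdot> S c d) v = mv (S (a \<oplus> c) (b \<oplus> \<tau> a \<otimes> c \<oplus> d)) v"
    using assms v by (simp add: mv_mult S_mat ov_add) (simp add: field_2_simps)
qed (use assms in \<open>simp_all add: S_mat(1) mult_closed\<close>)

lemma S_zero: "S \<zero> \<zero> = \<one>\<^bsub>M\<^esub>"
proof (rule mat_eqI)
  fix v assume v: "v \<in> V"
  then show "mv (S \<zero> \<zero>) v = mv \<one>\<^bsub>M\<^esub> v"
    unfolding mv_one[OF v] by (cases v) (auto simp: S_mat ov_def)
qed (simp_all add: S_mat one_closed_mat)

lemma T_mult: "T \<cdot> T = \<one>\<^bsub>M\<^esub>"
proof (rule mat_eqI)
  fix v assume v: "v \<in> V"
  then show "mv (T \<cdot> T) v = mv \<one>\<^bsub>M\<^esub> v"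
    unfolding mv_one[OF v] by (cases v) (auto simp: mv_mult T_mat)
qed (simp_all add: T_mat mult_closed one_closed_mat)

end

section \<open>The Suzuki group as a permutation group of the ovoid\<close>

context suzuki_field
begin

abbreviation G :: "'a mat monoid" where "G \<equiv> Sz R n"

definition gens :: "'a mat set" where
  "gens = {S a b | a b. a \<in> Fq \<and> b \<in> Fq}
      \<union> {C l | l. l \<in> Fq - {\<zero>}} \<union> {T}"

lemma Sz_simps:
  "carrier G = generate (GL 4 R) gens" "A \<otimes>\<^bsub>G\<^esub> B = A \<cdot> B" "\<one>\<^bsub>G\<^esub> = \<one>\<^bsub>M\<^esub>"
  "carrier (GL 4 R) = Units M" "A \<otimes>\<^bsub>GL 4 R\<^esub> B = A \<cdot> B" "\<one>\<^bsub>GL 4 R\<^esub> = \<one>\<^bsub>M\<^esub>"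
  by (simp_all only: Sz_def gens_def GL_def units_of_def partial_object.select_convs
      partial_object.update_convs monoid.select_convs)

abbreviation G_mult :: "'a mat \<Rightarrow> 'a mat \<Rightarrow> 'a mat" (infixl "\<star>" 70) where
  "A \<star> B \<equiv> A \<otimes>\<^bsub>G\<^esub> B"

lemma S_inverse:
  assumes "a \<in> Fq" "b \<in> Fq"
  shows "S a b \<cdot> S a (b \<oplus> \<tau> a \<otimes> a) = \<one>\<^bsub>M\<^esub>"
    "S a (b \<oplus> \<tau> a \<otimes> a) \<cdot> S a b = \<one>\<^bsub>M\<^esub>"
  using assms by (simp_all add: S_mult field_2_simps S_zero)

text \<open>
  The matrices are diagonal, and \<open>half\<close> is multiplicative.
\<close>

lemma C_inverse:
  assumes l: "l \<in> Fq" "l \<noteq> \<zero>"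
  shows "C (inv l) \<cdot> C l = \<one>\<^bsub>M\<^esub>"
proof -
  define k u v where "k = inv l" and "u = half l" and "v = half k"
  have k: "k \<in> Fq" "k \<noteq> \<zero>" "l \<otimes> k = \<one>" unfolding k_def using l by auto
  have u: "u \<in> Fq" and v: "v \<in> Fq" unfolding u_def v_def using l k by auto
  have uv: "u \<otimes> v = \<one>" unfolding u_def v_def half_mult[OF l(1) k(1)] k(3) by (simp add: half_def)
  note C = C_mat(1)[OF l] and C' = C_mat(1)[OF k(1,2)]
  note mvC = C_mat(2)[OF l, folded u_def] and mvC' = C_mat(2)[OF k(1,2), folded v_def]
  have iv: "inv v = u" using uv u v by (intro comm_inv_char) (simp_all add: m_comm)
  have iu: "inv u = v" using uv u v by (intro comm_inv_char) simp_all
  have luv: "l \<otimes> u \<otimes> (k \<otimes> v) = \<one>"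
  proof -
    have "l \<otimes> u \<otimes> (k \<otimes> v) = (l \<otimes> k) \<otimes> (u \<otimes> v)" using l u k(1) v by (simp add: m_ac)
    then show ?thesis using k(3) uv by simp
  qed
  have ilu: "inv (l \<otimes> u) = k \<otimes> v" using luv l u k v by (intro comm_inv_char) simp_all
  have ikv: "inv (k \<otimes> v) = l \<otimes> u" using luv l u k v by (intro comm_inv_char) (simp_all add: m_comm)
  show ?thesis unfolding k_def[symmetric]
  proof (rule mat_eqI)
    fix w assume w: "w \<in> V"
    then obtain x y z t where w': "w = (x, y, z, t)" "x \<in> Fq" "y \<in> Fq" "z \<in> Fq" "t \<in> Fq"
      by (cases w) auto
    have "k \<otimes> v \<otimes> (l \<otimes> u \<otimes> x) = x" "v \<otimes> (u \<otimes> y) = y" "u \<otimes> (v \<otimes> z) = z" "l \<otimes> u \<otimes> (k \<otimes> v \<otimes> t) = t"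
    proof -
      have "k \<otimes> v \<otimes> (l \<otimes> u \<otimes> x) = (l \<otimes> u \<otimes> (k \<otimes> v)) \<otimes> x"
        "v \<otimes> (u \<otimes> y) = (u \<otimes> v) \<otimes> y" "u \<otimes> (v \<otimes> z) = (u \<otimes> v) \<otimes> z"
        "l \<otimes> u \<otimes> (k \<otimes> v \<otimes> t) = (l \<otimes> u \<otimes> (k \<otimes> v)) \<otimes> t"
        using l u k(1) v w' by (simp_all add: m_ac)
      then show "k \<otimes> v \<otimes> (l \<otimes> u \<otimes> x) = x" "v \<otimes> (u \<otimes> y) = y" "u \<otimes> (v \<otimes> z) = z" "l \<otimes> u \<otimes> (k \<otimes> v \<otimes> t) = t"
        unfolding luv uv using w' by simp_all
    qed
    then show "mv (C k \<cdot> C l) w = mv \<one>\<^bsub>M\<^esub> w"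
      using l u k v w' w unfolding mv_one[OF w] mv_mult[OF C' C w]
      by (simp add: mvC mvC' iu iv ilu ikv)
  qed (use C C' in \<open>simp_all add: mult_closed one_closed_mat\<close>)
qed

lemma gens_preserving: "h \<in> gens \<Longrightarrow> h \<in> preserving"
  using S_preserving T_preserving C_preserving unfolding gens_def by blast

lemma gens_in_carrier: "h \<in> gens \<Longrightarrow> h \<in> carrier M"
  using gens_preserving by (simp add: preserving_def)

lemma gens_inverse:
  assumes "h \<in> gens" obtains h' where "h' \<in> gens" "h' \<cdot> h = \<one>\<^bsub>M\<^esub>" "h \<cdot> h' = \<one>\<^bsub>M\<^esub>"
proof -
  consider (S) a b where "h = S a b" "a \<in> Fq" "b \<in> Fq"
    | (C) l where "h = C l" "l \<in> Fq" "l \<noteq> \<zero>" | (T) "h = T"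
    using assms unfolding gens_def by blast
  then show ?thesis
  proof cases
    case S
    have "b \<oplus> \<tau> a \<otimes> a \<in> Fq" using S by simp
    then have "S a (b \<oplus> \<tau> a \<otimes> a) \<in> gens" using S(2) unfolding gens_def by blast
    then show ?thesis using that S_inverse[OF S(2,3)] S(1) by simp
  next
    case C
    have i: "inv l \<in> Fq" "inv l \<noteq> \<zero>" "inv (inv l) = l"
      using C(2,3) by (auto intro: comm_inv_char)
    then have "C (inv l) \<in> gens" unfolding gens_def by blast
    then show ?thesis using that C_inverse[OF C(2,3)] C_inverse[OF i(1,2)] C(1) i(3) by simp
  next
    case T
    then show ?thesis using that[of h] assms T_mult by simp
  qed
qed

lemma gens_in_GL: "gens \<subseteq> carrier (GL 4 R)"
proof
  fix h assume h: "h \<in> gens"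
  obtain h' where "h' \<in> gens" "h' \<cdot> h = \<one>\<^bsub>M\<^esub>" "h \<cdot> h' = \<one>\<^bsub>M\<^esub>"
    by (rule gens_inverse[OF h])
  then show "h \<in> carrier (GL 4 R)"
    unfolding Sz_simps Units_def using h gens_in_carrier by blast
qed

lemma group_Sz: "group G"
proof -
  interpret GL: group "GL 4 R" by (rule group_GL)
  have "subgroup (generate (GL 4 R) gens) (GL 4 R)" by (rule GL.generate_is_subgroup[OF gens_in_GL])
  then have "group (GL 4 R\<lparr>carrier := generate (GL 4 R) gens\<rparr>)" by (rule GL.subgroup_imp_group)
  then show ?thesis unfolding Sz_def gens_def .
qed

lemma gens_in_G: "gens \<subseteq> carrier G"
  unfolding Sz_simps by (auto intro: generate.incl)

lemma G_preserving: "carrier G \<subseteq> preserving"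
proof
  interpret GL: group "GL 4 R" by (rule group_GL)
  fix g assume "g \<in> carrier G"
  then have "g \<in> generate (GL 4 R) gens" by (simp only: Sz_simps)
  then show "g \<in> preserving"
  proof (induction rule: generate.induct)
    case one
    have "S \<zero> \<zero> \<in> preserving" by (rule S_preserving) auto
    then show ?case by (simp only: S_zero Sz_simps)
  next
    case (incl h)
    then show ?case by (rule gens_preserving)
  next
    case (inv h)
    obtain h' where h': "h' \<in> gens" "h' \<cdot> h = \<one>\<^bsub>M\<^esub>"
      by (rule gens_inverse[OF inv])
    have "inv\<^bsub>GL 4 R\<^esub> h = h'"
      using h' inv gens_in_GL by (intro GL.inv_equality) (auto simp only: Sz_simps)
    then show ?case using gens_preserving[OF h'(1)] by simp
  next
    case (eng h1 h2)
    then show ?case using preserving_mult by (simp only: Sz_simps)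
  qed
qed

lemma G_in_M: "carrier G \<subseteq> carrier M"
  using G_preserving by (auto simp: preserving_def)

lemma S_in_G: "a \<in> Fq \<Longrightarrow> b \<in> Fq \<Longrightarrow> S a b \<in> carrier G"
  and T_in_G: "T \<in> carrier G"
  using gens_in_G unfolding gens_def by blast+

lemma finite_V: "finite V"
  unfolding V_def using finite_carrier by simp

lemma finite_G: "finite (carrier G)"
proof -
  define f where "f A = (mv A e1, mv A e2, mv A e3, mv A e4)" for A
  have "inj_on f (carrier M)"
    by (intro inj_onI mat_eqI_basis) (simp_all add: f_def)
  moreover have "f ` carrier M \<subseteq> V \<times> V \<times> V \<times> V" by (auto simp: f_def mv_closed)
  then have "finite (f ` carrier M)" using finite_V finite_subset by (metis finite_cartesian_product)
  ultimately have "finite (carrier M)" by (simp add: finite_image_iff)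
  then show ?thesis using G_in_M finite_subset by blast
qed

text \<open>
  A projective point is the set of its representing vectors, so that the group acts on points simply
  by taking images.
\<close>

definition line :: "'a vec4 \<Rightarrow> 'a vec4 set" where
  "line v = (\<lambda>c. scal c v) ` (Fq - {\<zero>})"

definition lines :: "'a vec4 set set" where "lines = line ` ovoid"

definition act :: "'a mat \<Rightarrow> 'a vec4 set \<Rightarrow> 'a vec4 set" where "act g \<omega> = mv g ` \<omega>"

lemma line_scal:
  assumes "v \<in> V" "c \<in> Fq" "c \<noteq> \<zero>" shows "line (scal c v) = line v"
proof -
  have "scal d (scal c v) \<in> line v" if "d \<in> Fq - {\<zero>}" for d
    using that assms integral[of d c] by (auto simp: line_def scal_scal)
  moreover have "scal d v \<in> line (scal c v)" if d: "d \<in> Fq - {\<zero>}" for d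
  proof -
    have "scal d v = scal (d \<otimes> inv c) (scal c v)" using assms d by (simp add: scal_scal m_assoc)
    moreover have "d \<otimes> inv c \<in> Fq - {\<zero>}"
      using assms d integral[of d "inv c"] by auto
    ultimately show ?thesis unfolding line_def by blast
  qed
  ultimately have "line (scal c v) \<subseteq> line v" "line v \<subseteq> line (scal c v)"
    unfolding line_def by blast+
  then show ?thesis by (rule equalityI)
qed

lemma self_in_line: "v \<in> V \<Longrightarrow> v \<in> line v"
  unfolding line_def by (rule image_eqI[of _ _ \<one>]) (simp_all add: scal_one)

lemma act_line: "g \<in> carrier M \<Longrightarrow> v \<in> V \<Longrightarrow> act g (line v) = line (mv g v)"
  unfolding act_def line_def image_image by (intro image_cong) (auto simp: mv_scal)

lemma scal_ovpt_eq:
  assumes "c \<in> Fq" "a \<in> Fq" "b \<in> Fq" "a' \<in> Fq" "b' \<in> Fq"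
    "scal c (ovpt a b) = ovpt a' b'"
  shows "c = \<one>" "a' = a" "b' = b"
  using assms by (auto simp: scal_def ovpt_def)

lemma e4_not_ovpt: "e4 \<noteq> ovpt a b" "c \<in> Fq \<Longrightarrow> scal c e4 \<noteq> ovpt a b"
  by (auto simp: e4_def ovpt_def scal_def)

lemma line_inj: "inj_on line ovoid"
proof (rule inj_onI)
  fix v w assume vw: "v \<in> ovoid" "w \<in> ovoid" "line v = line w"
  have "v \<in> line w" "w \<in> line v" using vw self_in_line ovoid_subset by blast+
  then obtain c d where c: "v = scal c w" "c \<in> Fq" and d: "w = scal d v" "d \<in> Fq"
    unfolding line_def by blast
  show "v = w"
  proof (cases "v = e4")
    case True
    then show ?thesis using vw(2) d e4_not_ovpt(2)[OF d(2)] by (auto simp: ovoid_def)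
  next
    case False
    then obtain a b where v: "v = ovpt a b" "a \<in> Fq" "b \<in> Fq" using vw(1) by (auto simp: ovoid_def)
    then have "w \<noteq> e4" using c e4_not_ovpt(2)[OF c(2)] by auto
    then obtain a' b' where w: "w = ovpt a' b'" "a' \<in> Fq" "b' \<in> Fq" using vw(2) by (auto simp: ovoid_def)
    show ?thesis using scal_ovpt_eq[OF c(2) w(2,3) v(2,3)] c(1) v w by simp
  qed
qed

lemma card_lines: "card lines = 2 ^ (2 * (2 * n + 1)) + 1"
proof -
  have "inj_on (\<lambda>(a, b). ovpt a b) (Fq \<times> Fq)"
    by (auto simp: inj_on_def ovpt_def)
  then have "card ((\<lambda>(a, b). ovpt a b) ` (Fq \<times> Fq)) = card Fq * card Fq"
    by (simp add: card_image card_cartesian_product)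
  also have "(\<lambda>(a, b). ovpt a b) ` (Fq \<times> Fq) = {ovpt a b | a b. a \<in> Fq \<and> b \<in> Fq}"
    by auto
  finally have "card {ovpt a b | a b. a \<in> Fq \<and> b \<in> Fq} = 2 ^ (2 * (2 * n + 1))"
    using card_carrier by (simp only: mult_2 power_add)
  moreover have "e4 \<notin> {ovpt a b | a b. a \<in> Fq \<and> b \<in> Fq}" using e4_not_ovpt(1) by auto
  moreover have "finite {ovpt a b | a b. a \<in> Fq \<and> b \<in> Fq}"
    by (rule finite_subset[OF _ finite_V]) auto
  ultimately have "card ovoid = 2 ^ (2 * (2 * n + 1)) + 1" by (simp add: ovoid_def)
  then show ?thesis unfolding lines_def using card_image[OF line_inj] by simp
qed

sublocale A: finite_group_action G lines act
proof (intro finite_group_action.intro finite_group_action_axioms.intro)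
  show "group G" by (rule group_Sz)
  show "finite (carrier G)" by (rule finite_G)
  show "finite lines" using card_lines by (metis card.infinite add_is_0 one_neq_zero)
next
  fix g \<omega> assume g: "g \<in> carrier G" and "\<omega> \<in> lines"
  then obtain v where v: "\<omega> = line v" "v \<in> ovoid" by (auto simp: lines_def)
  have gM: "g \<in> carrier M" "g \<in> preserving" using g G_in_M G_preserving by auto
  have "mv g v \<in> cone" using v(2) gM(2) by (auto simp: preserving_def)
  then obtain c w where w: "mv g v = scal c w" "c \<in> Fq" "c \<noteq> \<zero>" "w \<in> ovoid" by (auto simp: cone_def)
  have "act g \<omega> = line (mv g v)" unfolding v(1) using v(2) ovoid_subset gM(1) by (intro act_line) auto
  also have "\<dots> = line w" unfolding w(1) using w ovoid_subset by (intro line_scal) auto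
  finally show "act g \<omega> \<in> lines" using w(4) by (auto simp: lines_def)
next
  fix \<omega> assume "\<omega> \<in> lines"
  then obtain v where v: "\<omega> = line v" "v \<in> V" using ovoid_subset by (auto simp: lines_def)
  then show "act \<one>\<^bsub>G\<^esub> \<omega> = \<omega>" unfolding Sz_simps by (simp add: act_line one_closed_mat mv_one)
next
  fix g h \<omega> assume gh: "g \<in> carrier G" "h \<in> carrier G" and "\<omega> \<in> lines"
  then obtain v where v: "\<omega> = line v" "v \<in> V" using ovoid_subset by (auto simp: lines_def)
  have "g \<in> carrier M" "h \<in> carrier M" using gh G_in_M by auto
  then show "act (g \<star> h) \<omega> = act g (act h \<omega>)"
    unfolding Sz_simps v(1) using v(2) by (simp add: act_line mult_closed mv_mult mv_closed)
qed

text \<open>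
  The eigenvalue at \<open>e4\<close> of a matrix that fixes the point \<open>line e4\<close>.
\<close>

definition mu :: "'a mat \<Rightarrow> 'a" where "mu g = g $$ (3, 3)"

lemma e4_ovoid: "e4 \<in> ovoid" by (simp add: ovoid_def)

lemma pt_in_lines: "line e4 \<in> lines"
  using e4_ovoid by (simp add: lines_def)

lemma stab_e4:
  assumes "g \<in> A.stab (line e4)"
  shows "g \<in> carrier G" "g \<in> carrier M" "mu g \<in> Fq" "mu g \<noteq> \<zero>" "mv g e4 = scal (mu g) e4"
proof -
  show g: "g \<in> carrier G" using assms by (simp add: A.stab_def)
  then show gM: "g \<in> carrier M" using G_in_M by auto
  have "mv g e4 \<in> act g (line e4)" unfolding act_def using self_in_line by simp
  then have "mv g e4 \<in> line e4" using assms by (simp add: A.stab_def)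
  then obtain c where c: "mv g e4 = scal c e4" "c \<in> Fq" "c \<noteq> \<zero>" by (auto simp: line_def)
  have "mu g = c" using c(1,2) mv_columns(4)[OF gM] by (simp add: mu_def scal_def e4_def)
  then show "mu g \<in> Fq" "mu g \<noteq> \<zero>" "mv g e4 = scal (mu g) e4" using c by auto
qed

lemma mu_eqI:
  assumes "g \<in> carrier M" "mv g e4 = scal c e4" "c \<in> Fq" shows "mu g = c"
  using assms mv_columns(4)[OF assms(1)] by (simp add: mu_def scal_def e4_def)

lemma mu_mult:
  assumes g: "g \<in> A.stab (line e4)" and h: "h \<in> A.stab (line e4)"
  shows "mu (g \<star> h) = mu g \<otimes> mu h"
proof (rule mu_eqI)
  have "mv (g \<cdot> h) e4 = scal (mu h \<otimes> mu g) e4"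
    using stab_e4[OF g] stab_e4[OF h] by (simp add: mv_mult mv_scal scal_scal)
  then show "mv (g \<star> h) e4 = scal (mu g \<otimes> mu h) e4"
    using stab_e4[OF g] stab_e4[OF h] by (simp add: Sz_simps m_comm)
qed (use stab_e4[OF g] stab_e4[OF h] in \<open>simp_all add: Sz_simps mult_closed\<close>)

lemma mu_one: "mu \<one>\<^bsub>G\<^esub> = \<one>"
  unfolding Sz_simps by (rule mu_eqI) (simp_all add: one_closed_mat mv_one scal_one)

lemma S_stab:
  assumes "a \<in> Fq" "b \<in> Fq"
  shows "S a b \<in> A.stab (line e4)" "mu (S a b) = \<one>"
  using assms S_in_G S_mat(1) S_e4
  by (auto simp: A.stab_def act_line scal_one intro!: mu_eqI)

text \<open>
  Since \<open>g\<close> preserves the form and fixes \<open>e4\<close>, it maps \<open>e1\<close> to a vector \<open>ovpt a b\<close> of the ovoid, not merely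
  to a multiple of one.  Then the product \<open>k\<close> of the inverse of \<open>S(a, b)\<close> with \<open>g\<close> fixes \<open>e1\<close> and \<open>e4\<close> and hence
  acts on the span of \<open>e2\<close> and \<open>e3\<close>.  As \<open>k\<close> preserves the ovoid, this action leaves the function
  \<open>ov\<close> invariant, and so it is trivial.
\<close>

lemma stab_kernel:
  assumes g: "g \<in> A.stab (line e4)" and mu1: "mu g = \<one>"
  obtains a b where "a \<in> Fq" "b \<in> Fq" "g = S a b"
proof -
  note st = stab_e4[OF g]
  have gp: "g \<in> preserving" using st(1) G_preserving by auto
  have ge4: "mv g e4 = e4" using st mu1 by (simp add: scal_one)
  have form: "form (mv A v) (mv A w) = form v w" if "A \<in> preserving" "v \<in> V" "w \<in> V" for A v w
    using that by (auto simp: preserving_def)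
  have cone: "mv A v \<in> cone" if "A \<in> preserving" "v \<in> ovoid" for A v
    using that by (auto simp: preserving_def)
  have "e1 \<in> ovoid" using ovpt_in_ovoid[of \<zero> \<zero>] ovpt_zero by simp
  then have "mv g e1 \<in> cone" by (rule cone[OF gp])
  then obtain c w where w: "mv g e1 = scal c w" "c \<in> Fq" "w \<in> ovoid" by (auto simp: cone_def)
  have f14: "form (scal c w) e4 = \<one>"
    using form[OF gp, of e1 e4] unfolding ge4 w(1) by (simp add: form_def e1_def e4_def)
  have "w \<noteq> e4" using f14 w(2) by (auto simp: form_def scal_def e4_def)
  then obtain a b where ab: "w = ovpt a b" "a \<in> Fq" "b \<in> Fq" using w(3) by (auto simp: ovoid_def)
  have "c = \<one>" using f14 w(2) ab by (simp add: form_def scal_def e4_def ovpt_def)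
  then have ge1: "mv g e1 = ovpt a b" using w(1) ab by (simp add: scal_one)
  define d where "d = b \<oplus> \<tau> a \<otimes> a"
  have d: "d \<in> Fq" unfolding d_def using ab by simp
  define k where "k = S a d \<cdot> g"
  have SM: "S a d \<in> carrier M" by (rule S_mat(1)[OF ab(2) d])
  have kp: "k \<in> preserving" unfolding k_def by (rule preserving_mult[OF S_preserving[OF ab(2) d] gp])
  then have kM: "k \<in> carrier M" by (simp add: preserving_def)
  have ke4: "mv k e4 = e4"
    unfolding k_def using SM st(2) ge4 S_e4[OF ab(2) d] by (simp add: mv_mult)
  have ke1: "mv k e1 = e1"
  proof -
    have "mv k e1 = ovpt (a \<oplus> a) (d \<oplus> \<tau> a \<otimes> a \<oplus> b)"
      unfolding k_def using SM st(2) ge1 S_ovpt[OF ab(2,3) ab(2) d] by (simp add: mv_mult)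
    also have "a \<oplus> a = \<zero>" using ab char_2 by simp
    also have "d \<oplus> \<tau> a \<otimes> a \<oplus> b = \<zero>" unfolding d_def using ab by (simp add: field_2_simps)
    finally show ?thesis using ovpt_zero by simp
  qed
  let ?e = "\<lambda>i j. k $$ (i, j)"
  have ent: "?e i j \<in> Fq" if "i < 4" "j < 4" for i j using mat_entry[OF kM that] .
  have col1: "?e 0 0 = \<one>" "?e 1 0 = \<zero>" "?e 2 0 = \<zero>" "?e 3 0 = \<zero>"
    using ke1 unfolding mv_columns(1)[OF kM] by (simp_all add: e1_def)
  have col4: "?e 0 3 = \<zero>" "?e 1 3 = \<zero>" "?e 2 3 = \<zero>" "?e 3 3 = \<one>"
    using ke4 unfolding mv_columns(4)[OF kM] by (simp_all add: e4_def)
  have col2: "?e 3 1 = \<zero>" "?e 0 1 = \<zero>"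
    using form[OF kp, of e1 e2] form[OF kp, of e4 e2] ent
    unfolding ke1 ke4 mv_columns(2)[OF kM] by (simp_all add: form_def e1_def e2_def e4_def)
  have col3: "?e 3 2 = \<zero>" "?e 0 2 = \<zero>"
    using form[OF kp, of e1 e3] form[OF kp, of e4 e3] ent
    unfolding ke1 ke4 mv_columns(3)[OF kM] by (simp_all add: form_def e1_def e3_def e4_def)
  have inv_ov: "ov (?e 1 1 \<otimes> x \<oplus> ?e 1 2 \<otimes> y) (?e 2 1 \<otimes> x \<oplus> ?e 2 2 \<otimes> y) = ov x y"
    if xy: "x \<in> Fq" "y \<in> Fq" for x y
  proof -
    have "mv k (ovpt x y) = (\<one>, ?e 1 1 \<otimes> x \<oplus> ?e 1 2 \<otimes> y, ?e 2 1 \<otimes> x \<oplus> ?e 2 2 \<otimes> y, ov x y)"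
      using xy ent col1 col2 col3 col4 by (simp add: mv_def row_mult_def ovpt_def)
    moreover have "mv k (ovpt x y) \<in> cone" using xy by (intro cone[OF kp] ovpt_in_ovoid)
    ultimately obtain c v where v: "c \<in> Fq" "v \<in> ovoid"
      "(\<one>, ?e 1 1 \<otimes> x \<oplus> ?e 1 2 \<otimes> y, ?e 2 1 \<otimes> x \<oplus> ?e 2 2 \<otimes> y, ov x y) = scal c v"
      by (auto simp: cone_def)
    have "v \<noteq> e4" using v(1,3) by (auto simp: scal_def e4_def)
    then obtain x' y' where v': "v = ovpt x' y'" "x' \<in> Fq" "y' \<in> Fq"
      using v(2) by (auto simp: ovoid_def)
    then show ?thesis using v(1,3) by (auto simp: scal_def ovpt_def)
  qed
  have "?e 1 1 = \<one>" "?e 2 1 = \<zero>" "?e 1 2 = \<zero>" "?e 2 2 = \<one>"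
    using ov_linear_invariance[OF _ _ _ _ inv_ov] ent by simp_all
  then have "mv k e2 = e2" "mv k e3 = e3"
    unfolding mv_columns(2,3)[OF kM] using col2 col3 by (simp_all add: e2_def e3_def)
  then have "k = \<one>\<^bsub>M\<^esub>"
    using ke1 ke4 by (intro mat_eqI_basis[OF kM one_closed_mat]) (simp_all add: mv_one)
  then have Sg: "S a d \<cdot> g = \<one>\<^bsub>M\<^esub>" by (simp add: k_def)
  interpret M: monoid M by (rule monoid_M)
  have SbM: "S a b \<in> carrier M" by (rule S_mat(1)[OF ab(2,3)])
  have "g = S a b \<cdot> S a d \<cdot> g"
    using S_inverse(1)[OF ab(2,3)] st(2) by (simp add: d_def)
  also have "\<dots> = S a b" using Sg SM SbM st(2) by (simp add: M.m_assoc)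
  finally show ?thesis using that ab by blast
qed

text \<open>
  In characteristic \<open>2\<close> the eigenvalue of such an element, being a fourth root of unity, is \<open>\<one>\<close>.
\<close>

lemma stab_fourth_power:
  assumes u: "u \<in> A.stab (line e4)" "(u \<star> u) \<star> (u \<star> u) = \<one>\<^bsub>G\<^esub>"
  obtains a b where "a \<in> Fq" "b \<in> Fq" "u = S a b"
proof -
  have sub: "subgroup (A.stab (line e4)) G" by (rule A.stab_subgroup[OF pt_in_lines])
  have uu: "u \<star> u \<in> A.stab (line e4)" by (rule subgroup.m_closed[OF sub u(1) u(1)])
  have c: "mu u \<in> Fq" by (rule stab_e4(3)[OF u(1)])
  have "(mu u \<otimes> mu u) \<otimes> (mu u \<otimes> mu u) = \<one>"
    using mu_mult[OF uu uu] mu_mult[OF u(1) u(1)] u(2) mu_one by simp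
  then have "mu u \<otimes> mu u = \<one>" using square_eq_one_iff[of "mu u \<otimes> mu u"] c by simp
  then have "mu u = \<one>" by (rule square_eq_one_iff[OF c])
  then show ?thesis using stab_kernel[OF u(1)] that by blast
qed

lemma S_inj:
  assumes "a \<in> Fq" "b \<in> Fq" "c \<in> Fq" "d \<in> Fq"
    "S a b = S c d"
  shows "a = c" "b = d"
proof -
  have "mv (S a b) (ovpt \<zero> \<zero>) = mv (S c d) (ovpt \<zero> \<zero>)" using assms(5) by simp
  then show "a = c" "b = d" using assms(1-4) by (auto simp: S_ovpt) (auto simp: ovpt_def)
qed

text \<open>
  Apply \<open>\<tau>\<close> to the equation: this multiplies the left-hand side by \<open>a\<close> and the right-hand side by \<open>c\<close>.
\<close>

lemma tau_mult_self_inj: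
  assumes a: "a \<in> Fq" and c: "c \<in> Fq" and eq: "\<tau> a \<otimes> a = \<tau> c \<otimes> c"
  shows "a = c"
proof (cases "\<tau> a \<otimes> a = \<zero>")
  case True
  then have "a = \<zero>" "c = \<zero>"
    using eq a c integral[of "\<tau> a" a] integral[of "\<tau> c" c] tau_eq_zero_iff by auto
  then show ?thesis by simp
next
  case False
  have "\<tau> (\<tau> a \<otimes> a) = \<tau> (\<tau> c \<otimes> c)" using eq by simp
  then have "a \<otimes> (\<tau> a \<otimes> a) = c \<otimes> (\<tau> c \<otimes> c)" using a c by (simp add: m_ac)
  then have "a \<otimes> (\<tau> a \<otimes> a) = c \<otimes> (\<tau> a \<otimes> a)" using eq by simp
  then show ?thesis using m_rcancel[of "\<tau> a \<otimes> a" a c] False a c by simp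
qed

lemma S_square:
  assumes "a \<in> Fq" "b \<in> Fq"
  shows "S a b \<cdot> S a b = S \<zero> (\<tau> a \<otimes> a)"
  using assms by (simp add: S_mult field_2_simps)

lemma fourth_power_S:
  assumes "a \<in> Fq" "b \<in> Fq" and u: "u = S a b"
  shows "(u \<star> u) \<star> (u \<star> u) = \<one>\<^bsub>G\<^esub>"
  using assms(1,2) unfolding Sz_simps u by (simp add: S_square S_zero)

text \<open>
  The elements of the stabilizer of \<open>line e4\<close> with trivial fourth power are the matrices \<open>S(a, b)\<close>, and these
  form the kernel of \<open>mu\<close>, whose values lie in the cyclic group of nonzero field elements.
\<close>

sublocale Z: suzuki_type_action G lines act "line e4"
proof (unfold_locales)
  show "odd (card lines)" by (simp add: card_lines)
  show "line e4 \<in> lines" by (rule pt_in_lines)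
next
  fix \<omega> assume "\<omega> \<in> lines"
  then obtain v where v: "\<omega> = line v" "v \<in> ovoid" by (auto simp: lines_def)
  show "\<exists>g\<in>carrier G. act g (line e4) = \<omega>"
  proof (cases "v = e4")
    case True
    then show ?thesis using v A.act_one[OF pt_in_lines] A.one_closed by blast
  next
    case False
    then obtain a b where ab: "v = ovpt a b" "a \<in> Fq" "b \<in> Fq" using v(2) by (auto simp: ovoid_def)
    have ST: "S a b \<in> carrier G" "T \<in> carrier G" using S_in_G[OF ab(2,3)] T_in_G by auto
    have "mv T e4 = ovpt \<zero> \<zero>" unfolding ovpt_zero by (simp add: e4_def e1_def T_mat(2))
    then have "act (S a b) (act T (line e4)) = \<omega>"
      using v(1) ab S_ovpt[OF zero_closed zero_closed ab(2,3)]
      by (simp add: act_line T_mat(1) S_mat(1))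
    then have "act (S a b \<star> T) (line e4) = \<omega>"
      using A.act_mult[OF ST pt_in_lines] by simp
    then show ?thesis using A.m_closed[OF ST] by blast
  qed
next
  fix u \<omega> assume u: "u \<in> A.stab (line e4)" "u \<star> u \<star> (u \<star> u) = \<one>\<^bsub>G\<^esub>" "u \<noteq> \<one>\<^bsub>G\<^esub>"
    and w: "\<omega> \<in> lines" "act u \<omega> = \<omega>"
  obtain a b where ab: "a \<in> Fq" "b \<in> Fq" "u = S a b"
    by (rule stab_fourth_power[OF u(1,2)])
  obtain v where v: "\<omega> = line v" "v \<in> ovoid" using w(1) by (auto simp: lines_def)
  show "\<omega> = line e4"
  proof (cases "v = e4")
    case True then show ?thesis using v by simp
  next
    case False
    then obtain c d where cd: "v = ovpt c d" "c \<in> Fq" "d \<in> Fq" using v(2) by (auto simp: ovoid_def)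
    have "line (ovpt (a \<oplus> c) (b \<oplus> \<tau> a \<otimes> c \<oplus> d)) = line (ovpt c d)"
      using w(2) v(1) cd ab S_ovpt[OF cd(2,3) ab(1,2)] by (simp add: act_line S_mat(1))
    then have "ovpt (a \<oplus> c) (b \<oplus> \<tau> a \<otimes> c \<oplus> d) = ovpt c d"
      using ab cd by (intro inj_onD[OF line_inj] ovpt_in_ovoid) auto
    then have eq: "a \<oplus> c = c" "b \<oplus> \<tau> a \<otimes> c \<oplus> d = d" by (auto simp: ovpt_def)
    have a0: "a = \<zero>" using eq(1) ab cd by simp
    then have "b = \<zero>" using eq(2) ab cd by simp
    then show ?thesis using a0 ab(3) u(3) by (simp add: S_zero Sz_simps)
  qed
next
  fix u v assume u: "u \<in> A.stab (line e4)" "u \<star> u = \<one>\<^bsub>G\<^esub>"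
    and v: "v \<in> A.stab (line e4)" "v \<star> v \<star> (v \<star> v) = \<one>\<^bsub>G\<^esub>"
  obtain a b where ab: "a \<in> Fq" "b \<in> Fq" "u = S a b"
    using stab_fourth_power[OF u(1)] u(2) A.l_one[OF A.one_closed] by metis
  obtain c d where cd: "c \<in> Fq" "d \<in> Fq" "v = S c d"
    by (rule stab_fourth_power[OF v])
  have "S \<zero> (\<tau> a \<otimes> a) = S \<zero> \<zero>"
    using u(2) ab by (simp add: Sz_simps S_square S_zero)
  then have "\<tau> a \<otimes> a = \<zero>" using S_inj(2)[OF zero_closed _ zero_closed zero_closed] ab by simp
  then have "a = \<zero>" using integral[of "\<tau> a" a] ab tau_eq_zero_iff by auto
  then show "u \<star> v = v \<star> u"
    using ab cd by (simp add: Sz_simps S_mult a_comm)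
next
  fix u v assume u: "u \<in> A.stab (line e4)" "u \<star> u \<star> (u \<star> u) = \<one>\<^bsub>G\<^esub>"
    and v: "v \<in> A.stab (line e4)" "v \<star> v \<star> (v \<star> v) = \<one>\<^bsub>G\<^esub>"
    and eq: "u \<star> u = v \<star> v"
  obtain a b where ab: "a \<in> Fq" "b \<in> Fq" "u = S a b"
    by (rule stab_fourth_power[OF u])
  obtain c d where cd: "c \<in> Fq" "d \<in> Fq" "v = S c d"
    by (rule stab_fourth_power[OF v])
  have eqS: "S \<zero> (\<tau> a \<otimes> a) = S \<zero> (\<tau> c \<otimes> c)"
    using eq ab cd by (simp add: Sz_simps S_square)
  have "\<tau> a \<otimes> a = \<tau> c \<otimes> c"
    by (rule S_inj(2)[OF zero_closed _ zero_closed _ eqS]) (use ab(1) cd(1) in simp_all)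
  then have ac: "a = c" by (rule tau_mult_self_inj[OF ab(1) cd(1)])
  have Sd: "S a (b \<oplus> \<tau> a \<otimes> a) \<in> carrier G" using ab by (intro S_in_G) auto
  have inv: "inv\<^bsub>G\<^esub> u = S a (b \<oplus> \<tau> a \<otimes> a)"
    using S_inverse(2)[OF ab(1,2)] Sd S_in_G[OF ab(1,2)] ab(3)
    by (intro A.inv_equality) (simp_all add: Sz_simps(2,3))
  define y where "y = b \<oplus> \<tau> a \<otimes> a \<oplus> \<tau> a \<otimes> c \<oplus> d"
  have y: "y \<in> Fq" unfolding y_def using ab cd by simp
  have "inv\<^bsub>G\<^esub> u \<star> v = S \<zero> y"
    unfolding inv y_def using ab cd ac char_2 by (simp add: Sz_simps S_mult)
  then show "inv\<^bsub>G\<^esub> u \<star> v \<star> (inv\<^bsub>G\<^esub> u \<star> v) = \<one>\<^bsub>G\<^esub>"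
    using y by (simp add: Sz_simps S_square S_zero)
next
  fix H assume H: "subgroup H G"
  let ?B = "A.stab (line e4)"
  let ?U = "Multiplicative_Group.mult_of R"
  have HB: "subgroup (H \<inter> ?B) G" by (rule A.subgroups_Inter_pair[OF H A.stab_subgroup[OF pt_in_lines]])
  obtain a where a: "a \<in> Fq" "a \<noteq> \<zero>" and gen: "carrier ?U = {a [^] i | i::nat. i \<in> UNIV}"
    using finite_field_mult_group_has_gen[OF finite_carrier] by auto
  have pw: "\<exists>k::nat. mu h = a [^] k" if "h \<in> ?B" for h
    using stab_e4(3,4)[OF that] gen by auto
  \<comment> \<open>a subgroup of a cyclic group is generated by the element with the least positive exponent\<close>
  define P where "P i \<longleftrightarrow> i > 0 \<and> (\<exists>h\<in>H \<inter> ?B. mu h = a [^] i)" for i :: nat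
  have "P (2 ^ (2 * n + 1) - 1)"
  proof -
    have "a [^] (2 ^ (2 * n + 1) - 1 :: nat) \<otimes> a = \<one> \<otimes> a"
    proof -
      have "(2 ^ (2 * n + 1) :: nat) = Suc (2 ^ (2 * n + 1) - 1)" by simp
      then show ?thesis using power_card[OF a(1)] a by (metis l_one nat_pow_Suc)
    qed
    then have "a [^] (2 ^ (2 * n + 1) - 1 :: nat) = \<one>"
      using m_rcancel[of a "a [^] (2 ^ (2 * n + 1) - 1 :: nat)" \<one>] a by simp
    moreover have "(1::nat) < 2 ^ (2 * n + 1)" by (rule one_less_power) auto
    ultimately show ?thesis unfolding P_def using subgroup.one_closed[OF HB] mu_one by force
  qed
  then have Pi: "P (LEAST i. P i)" by (rule LeastI)
  define i where "i = (LEAST i. P i)"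
  have i: "i > 0" and "\<exists>x\<in>H \<inter> ?B. mu x = a [^] i" using Pi unfolding i_def P_def by auto
  then obtain x where x: "x \<in> H \<inter> ?B" "mu x = a [^] i" by blast
  have mu_pow: "x [^]\<^bsub>G\<^esub> j \<in> H \<inter> ?B" "mu (x [^]\<^bsub>G\<^esub> j) = a [^] (i * j)" for j :: nat
  proof -
    show "x [^]\<^bsub>G\<^esub> j \<in> H \<inter> ?B" for j :: nat by (rule A.subgroup_pow_closed[OF HB x(1)])
    then show "mu (x [^]\<^bsub>G\<^esub> j) = a [^] (i * j)"
    proof (induction j)
      case 0 then show ?case by (simp add: mu_one)
    next
      case (Suc j)
      have "mu (x [^]\<^bsub>G\<^esub> Suc j) = mu (x [^]\<^bsub>G\<^esub> j) \<otimes> mu x"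
        using Suc.prems[of j] x(1) by (simp add: mu_mult)
      also have "\<dots> = a [^] (i * j) \<otimes> a [^] i" using Suc x(2) by simp
      also have "\<dots> = a [^] (i * Suc j)" using a by (simp add: nat_pow_mult add.commute)
      finally show ?case .
    qed
  qed
  show "\<exists>x\<in>H \<inter> ?B. \<forall>h\<in>H \<inter> ?B. \<exists>j::nat.
      let u = inv\<^bsub>G\<^esub> (x [^]\<^bsub>G\<^esub> j) \<star> h in u \<star> u \<star> (u \<star> u) = \<one>\<^bsub>G\<^esub>"
  proof (rule bexI[OF _ x(1)], rule ballI)
    fix h assume h: "h \<in> H \<inter> ?B"
    obtain k :: nat where k: "mu h = a [^] k" using pw h by blast
    define j where "j = k div i"
    define u where "u = inv\<^bsub>G\<^esub> (x [^]\<^bsub>G\<^esub> j) \<star> h"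
    have xG: "x [^]\<^bsub>G\<^esub> j \<in> carrier G" "h \<in> carrier G"
      using mu_pow(1)[of j] h subgroup.mem_carrier[OF HB] by blast+
    have u: "u \<in> H \<inter> ?B" unfolding u_def
      by (intro subgroup.m_closed[OF HB] subgroup.m_inv_closed[OF HB] mu_pow(1) h)
    have "x [^]\<^bsub>G\<^esub> j \<star> u = h" unfolding u_def by (rule A.inv_cancel_left(2)[OF xG])
    then have "mu (x [^]\<^bsub>G\<^esub> j) \<otimes> mu u = a [^] k"
      using mu_mult[of "x [^]\<^bsub>G\<^esub> j" u] mu_pow(1)[of j] u k by simp
    also have "a [^] k = a [^] (i * j) \<otimes> a [^] (k mod i)"
      using a by (simp add: nat_pow_mult j_def)
    finally have "a [^] (i * j) \<otimes> mu u = a [^] (i * j) \<otimes> a [^] (k mod i)" using mu_pow(2)[of j] by simp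
    then have muu: "mu u = a [^] (k mod i)"
      using m_lcancel[of "a [^] (i * j)" "mu u" "a [^] (k mod i)"] a pow_nonzero[OF a] stab_e4(3) u by simp
    have "k mod i = 0"
    proof (rule ccontr)
      assume "k mod i \<noteq> 0"
      then have "P (k mod i)" unfolding P_def using u muu by blast
      then have "i \<le> k mod i" unfolding i_def by (rule Least_le)
      then show False using mod_less_divisor[OF i, of k] by linarith
    qed
    then have "mu u = \<one>" using muu by simp
    moreover have "u \<in> ?B" using u by simp
    ultimately obtain c d where cd: "c \<in> Fq" "d \<in> Fq" "u = S c d"
      using stab_kernel by blast
    have "u \<star> u \<star> (u \<star> u) = \<one>\<^bsub>G\<^esub>" by (rule fourth_power_S[OF cd])
    then show "\<exists>j::nat. let u = inv\<^bsub>G\<^esub> (x [^]\<^bsub>G\<^esub> j) \<star> h in u \<star> u \<star> (u \<star> u) = \<one>\<^bsub>G\<^esub>"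
      unfolding u_def Let_def by blast
  qed
qed

lemma card_S: "card {S a b | a b. a \<in> Fq \<and> b \<in> Fq} = 2 ^ (2 * (2 * n + 1))"
proof -
  have "inj_on (\<lambda>(a, b). S a b) (Fq \<times> Fq)"
    using S_inj by (auto simp: inj_on_def)
  then have "card ((\<lambda>(a, b). S a b) ` (Fq \<times> Fq)) = card Fq * card Fq"
    by (simp add: card_image card_cartesian_product)
  also have "(\<lambda>(a, b). S a b) ` (Fq \<times> Fq) = {S a b | a b. a \<in> Fq \<and> b \<in> Fq}"
    by auto
  finally show ?thesis using card_carrier by (simp only: mult_2 power_add)
qed

text \<open>
  Count first along the orbit of \<open>line e4\<close>, which is the whole ovoid, and then along \<open>mu\<close>, whose kernel
  consists of the \<open>q ^ 2\<close> matrices \<open>S(a, b)\<close> and whose image is a subgroup of the nonzero field elements.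
\<close>

lemma order_Sz_dvd:
  "order G dvd 2 ^ (2 * (2 * n + 1)) * ((2 ^ (2 * n + 1) - 1) * (2 ^ (2 * (2 * n + 1)) + 1))"
proof -
  let ?B = "A.stab (line e4)" and ?P = "{S a b | a b. a \<in> Fq \<and> b \<in> Fq}"
  let ?U = "Multiplicative_Group.mult_of R"
  interpret U: group ?U by (rule field_mult_group)
  have B: "subgroup ?B G" by (rule A.stab_subgroup[OF pt_in_lines])
  have "order G = card ((\<lambda>h. act h (line e4)) ` carrier G) * card (carrier G \<inter> ?B)"
    unfolding order_def
    by (rule A.card_eq_card_orbit_times_card_stab[OF A.subgroup_self pt_in_lines])
  also have "(\<lambda>h. act h (line e4)) ` carrier G = lines"
    using Z.transitive A.act_closed[OF _ pt_in_lines] by blast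
  also have "carrier G \<inter> ?B = ?B" using subgroup.subset[OF B] by blast
  finally have ord: "order G = card lines * card ?B" .
  have mu_inv: "mu (inv\<^bsub>G\<^esub> x) \<otimes> mu x = \<one>" if "x \<in> ?B" for x
    using mu_mult[OF subgroup.m_inv_closed[OF B that] that] subgroup.mem_carrier[OF B that] mu_one by simp
  have PB: "?P = {g \<in> ?B. mu g = \<one>}"
  proof (intro equalityI subsetI)
    fix g assume "g \<in> {g \<in> ?B. mu g = \<one>}"
    then have g: "g \<in> ?B" "mu g = \<one>" by auto
    show "g \<in> ?P" by (rule stab_kernel[OF g]) blast
  qed (use S_stab in blast)
  have "subgroup ?P G"
  proof (rule A.subgroupI)
    show "?P \<subseteq> carrier G" using S_in_G by blast
    show "?P \<noteq> {}" by blast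
    fix u assume u: "u \<in> ?P"
    then have u': "u \<in> ?B" "mu u = \<one>" using PB by auto
    then have "mu (inv\<^bsub>G\<^esub> u) = \<one>"
      using mu_inv[OF u'(1)] stab_e4(3)[OF subgroup.m_inv_closed[OF B u'(1)]] by simp
    then show "inv\<^bsub>G\<^esub> u \<in> ?P" using PB subgroup.m_inv_closed[OF B u'(1)] by blast
    fix v assume "v \<in> ?P"
    then have "v \<in> ?B" "mu v = \<one>" using PB by auto
    then have "u \<star> v \<in> ?B" "mu (u \<star> v) = \<one>"
      using u' subgroup.m_closed[OF B] by (auto simp: mu_mult)
    then show "u \<star> v \<in> ?P" using PB by blast
  qed
  then have cardB: "card ?B = card (mu ` ?B) * card ?P"
  proof (rule A.card_eq_card_image_times_card_fibre[OF finite_G B])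
    show "?P \<subseteq> ?B" using PB by blast
    fix x y assume x: "x \<in> ?B" and y: "y \<in> ?B"
    have ix: "inv\<^bsub>G\<^esub> x \<in> ?B" by (rule subgroup.m_inv_closed[OF B x])
    have c: "mu x \<in> Fq" "mu y \<in> Fq" "mu (inv\<^bsub>G\<^esub> x) \<in> Fq" "mu (inv\<^bsub>G\<^esub> x) \<noteq> \<zero>"
      using stab_e4(3,4) x y ix by auto
    have "mu x = mu y \<longleftrightarrow> mu (inv\<^bsub>G\<^esub> x) \<otimes> mu x = mu (inv\<^bsub>G\<^esub> x) \<otimes> mu y"
      using m_lcancel[OF c(4,3,1,2)] by simp
    also have "\<dots> \<longleftrightarrow> mu (inv\<^bsub>G\<^esub> x \<star> y) = \<one>" using mu_inv[OF x] mu_mult[OF ix y] by auto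
    finally show "mu x = mu y \<longleftrightarrow> inv\<^bsub>G\<^esub> x \<star> y \<in> ?P"
      unfolding PB using subgroup.m_closed[OF B ix y] by simp
  qed
  have "subgroup (mu ` ?B) ?U"
  proof (rule U.subgroupI)
    show "mu ` ?B \<subseteq> carrier ?U" using stab_e4(3,4) by auto
    show "mu ` ?B \<noteq> {}" using subgroup.one_closed[OF B] by blast
    fix s assume "s \<in> mu ` ?B"
    then obtain x where x: "x \<in> ?B" "s = mu x" by blast
    have ix: "inv\<^bsub>G\<^esub> x \<in> ?B" by (rule subgroup.m_inv_closed[OF B x(1)])
    have "inv\<^bsub>?U\<^esub> s = mu (inv\<^bsub>G\<^esub> x)"
      using mu_inv[OF x(1)] x stab_e4(3,4) ix by (intro U.inv_equality) auto
    then show "inv\<^bsub>?U\<^esub> s \<in> mu ` ?B" using ix by blast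
    fix t assume "t \<in> mu ` ?B"
    then obtain y where y: "y \<in> ?B" "t = mu y" by blast
    have "s \<otimes>\<^bsub>?U\<^esub> t = mu (x \<star> y)" using mu_mult[OF x(1) y(1)] x y by simp
    then show "s \<otimes>\<^bsub>?U\<^esub> t \<in> mu ` ?B" using subgroup.m_closed[OF B x(1) y(1)] by blast
  qed
  then have "card (mu ` ?B) dvd order ?U" using U.lagrange by (metis dvd_triv_right)
  then have dv: "card (mu ` ?B) dvd 2 ^ (2 * n + 1) - 1"
    using order_mult_of[OF finite_carrier] card_carrier by (simp add: order_def)
  have "order G = 2 ^ (2 * (2 * n + 1)) * (card (mu ` ?B) * (2 ^ (2 * (2 * n + 1)) + 1))"
    unfolding ord cardB card_S card_lines by (simp only: mult_ac)
  then show ?thesis using dv by (simp only: mult_dvd_mono dvd_refl)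
qed

lemma card_subgroups_ge: "2 ^ (n * (n + 1)) \<le> card {H. subgroup H G}"
proof -
  define E where "E = (\<lambda>b. S \<zero> b) ` Fq"
  have mul: "S \<zero> b \<star> S \<zero> d = S \<zero> (b \<oplus> d)"
    if "b \<in> Fq" "d \<in> Fq" for b d
    using that by (simp add: Sz_simps S_mult)
  have EG: "E \<subseteq> carrier G" unfolding E_def using S_in_G by auto
  have sq: "x \<star> x = \<one>\<^bsub>G\<^esub>" if "x \<in> E" for x
    using that by (auto simp: E_def mul char_2 S_zero Sz_simps(3))
  have "subgroup E G"
  proof (rule A.subgroupI[OF EG])
    show "E \<noteq> {}" unfolding E_def by blast
    fix x assume x: "x \<in> E"
    have "inv\<^bsub>G\<^esub> x = x" using sq[OF x] x EG by (intro A.inv_equality) auto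
    then show "inv\<^bsub>G\<^esub> x \<in> E" using x by simp
    fix y assume "y \<in> E"
    then show "x \<star> y \<in> E" using x by (auto simp: E_def mul)
  qed
  moreover have "card E = 2 ^ (2 * n + 1)"
  proof -
    have "inj_on (\<lambda>b. S \<zero> b) Fq" by (intro inj_onI S_inj(2)[of \<zero> _ \<zero>]) auto
    then show ?thesis unfolding E_def using card_carrier by (simp add: card_image)
  qed
  ultimately have "2 ^ (n * (2 * n + 1 - n)) \<le> card {H. subgroup H G}"
    using sq by (intro A.card_subgroups_elementary_abelian[OF finite_G]) auto
  moreover have "2 * n + 1 - n = n + 1" by simp
  ultimately show ?thesis by simp
qed

lemma permutability_degree_bound:
  defines "D \<equiv> (2 ^ (2 * n + 1) - 1) * (2 ^ (2 * (2 * n + 1)) + 1) :: nat"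
  shows "subgroup_permutability_degree G
    \<le> 2 * 2 ^ (6 * (2 * n + 1) * (size (prime_factorization D) + 3)) / 2 ^ (n * (n + 1)) + 1 / 2 ^ n"
proof -
  define m where "m = 2 * n + 1"
  define k where "k = size (prime_factorization D) + 3"
  have D: "odd D" unfolding D_def by simp
  have ord: "order G dvd 2 ^ (2 * m) * D" using order_Sz_dvd unfolding D_def m_def .
  have "order G \<le> 2 ^ (2 * m) * D" using ord D by (intro dvd_imp_le) (auto intro: Nat.gr0I)
  also have "D \<le> 2 ^ m * 2 ^ (3 * m)"
  proof -
    have "(1::nat) \<le> 2 ^ (2 * m)" by simp
    then have "(2 ^ (2 * m) + 1 :: nat) \<le> 2 ^ (2 * m) * 2" by simp
    also have "\<dots> \<le> 2 ^ (2 * m) * 2 ^ m" unfolding m_def by (intro mult_le_mono) auto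
    also have "\<dots> = 2 ^ (3 * m)" by (simp flip: power_add)
    finally show ?thesis unfolding D_def m_def[symmetric] by (intro mult_le_mono) auto
  qed
  finally have "order G \<le> 2 ^ (2 * m) * (2 ^ m * 2 ^ (3 * m))" by simp
  also have "\<dots> = 2 ^ (6 * m)" by (simp flip: power_add)
  finally have "order G ^ k \<le> (2 ^ (6 * m)) ^ k" by (rule power_mono) simp
  then have "order G ^ k \<le> 2 ^ (6 * m * k)" by (simp only: power_mult)
  then have "real (order G ^ k) \<le> real (2 ^ (6 * m * k))" by (rule of_nat_mono)
  moreover have "real (2 ^ (n * (n + 1))) \<le> real (card Z.subgroups)"
    unfolding Z.subgroups_def by (rule of_nat_mono[OF card_subgroups_ge])
  ultimately have "2 * real (order G ^ k) / real (card Z.subgroups) \<le> 2 * 2 ^ (6 * m * k) / 2 ^ (n * (n + 1))"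
    by (intro frac_le) auto
  moreover have "1 / real (card lines) \<le> 1 / 2 ^ n"
  proof -
    have "(2::real) ^ n \<le> 2 ^ (2 * (2 * n + 1))" by (rule power_increasing) auto
    then show ?thesis unfolding card_lines by (intro frac_le) auto
  qed
  ultimately show ?thesis
    using Z.permutability_degree_le[OF ord D] unfolding k_def m_def by linarith
qed

end

section \<open>The limit\<close>

lemma subgroup_permutability_degree_nonneg: "subgroup_permutability_degree G \<ge> 0"
  by (simp add: subgroup_permutability_degree_def)

theorem theorem1p1:
  fixes F :: "nat \<Rightarrow> 'a ring"
  assumes "\<And>n. n \<ge> 1 \<Longrightarrow> field (F n)"
    and "\<And>n. n \<ge> 1 \<Longrightarrow> card (carrier (F n)) = 2 ^ (2 * n + 1)"
  shows "(\<lambda>n. subgroup_permutability_degree (Sz (F n) n)) \<longlonglongrightarrow> 0"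
proof (rule tendsto_sandwich[OF always_eventually])
  show "\<forall>n. 0 \<le> subgroup_permutability_degree (Sz (F n) n)"
    using subgroup_permutability_degree_nonneg by blast
  obtain m0 where m0: "\<And>m. m \<ge> m0 \<Longrightarrow>
      50 * size (prime_factorization ((2 ^ m - 1) * (2 ^ (2 * m) + 1) :: nat)) \<le> m"
    using eventually_few_prime_factors by (auto simp: eventually_sequentially)
  have "subgroup_permutability_degree (Sz (F n) n) \<le> 3 * (1 / 2) ^ n" if n: "n \<ge> m0 + 100" for n
  proof -
    interpret suzuki_field "F n" n
      using assms n by (intro suzuki_field.intro suzuki_field_axioms.intro) auto
    define D :: nat where "D = (2 ^ (2 * n + 1) - 1) * (2 ^ (2 * (2 * n + 1)) + 1)"
    define s where "s = size (prime_factorization D)"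
    have s: "50 * s \<le> 2 * n + 1" using m0[of "2 * n + 1"] n by (simp add: s_def D_def)
    \<comment> \<open>the left-hand side is at most \<open>24 / 50 * n ^ 2\<close> up to lower-order terms, because \<open>s\<close> is at most \<open>(2 * n + 1) / 50\<close>\<close>
    have "6 * (2 * n + 1) * (s + 3) + n \<le> n * (n + 1)"
    proof -
      have "50 * (6 * (2 * n + 1) * (s + 3)) = 6 * (2 * n + 1) * (50 * s + 150)" by (simp add: algebra_simps)
      also have "\<dots> \<le> 6 * (2 * n + 1) * (2 * n + 151)" using s by (intro mult_le_mono) auto
      also have "\<dots> = 24 * (n * n) + 1824 * n + 906" by (simp add: algebra_simps)
      also have "\<dots> \<le> 50 * (n * n)"
      proof -
        have "100 * n \<le> n * n" using n by (intro mult_le_mono) auto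
        moreover have "906 \<le> 10 * n" using n by simp
        ultimately show ?thesis by linarith
      qed
      finally show ?thesis by simp
    qed
    then have "(2::real) ^ (6 * (2 * n + 1) * (s + 3)) * 2 ^ n \<le> 2 ^ (n * (n + 1))"
      unfolding power_add[symmetric] by (intro power_increasing) auto
    then have "(2::real) ^ (6 * (2 * n + 1) * (s + 3)) / 2 ^ (n * (n + 1)) \<le> 1 / 2 ^ n"
      by (simp add: field_simps)
    then have "2 * (2::real) ^ (6 * (2 * n + 1) * (s + 3)) / 2 ^ (n * (n + 1)) + 1 / 2 ^ n \<le> 3 * (1 / 2 ^ n)"
      by simp
    then show ?thesis
      using permutability_degree_bound unfolding D_def[symmetric] s_def[symmetric]
      by (simp add: power_one_over)
  qed
  then show "\<forall>\<^sub>F n in sequentially. subgroup_permutability_degree (Sz (F n) n) \<le> 3 * (1 / 2) ^ n"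
    unfolding eventually_sequentially by blast
  show "(\<lambda>n. 3 * (1 / 2) ^ n :: real) \<longlonglongrightarrow> 0"
    using tendsto_mult_right[OF LIMSEQ_realpow_zero[of "1 / 2 :: real"], of 3] by simp
qed simp

end
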